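(* Let $W$ be a Coxeter group of type $D_n$ with $n\ge 4$, with a fixed Coxeter element $c$, and let $\mathsf{Pop}_T=\mathsf{Pop}_T(\cdot,c)$. Then (1) $\mathsf{Pop}_T^{2n-3}(w)=e$ for all $w\in W$, and (2) $\max_{w\in W}|O_{\mathsf{Pop}_T}(w)|=2n-2$.
   Context: $W$ has set of simple reflections $S$, set of reflections $T=\{wsw^{-1}: s\in S,\ w\in W\}$, and Coxeter number $h$ (for $D_n$, $h=2n-2$). $\ell_T(w)$ is the minimum number of reflections whose product is $w$; the absolute order is $v\le_T w$ iff $\ell_T(wv^{-1})=\ell_T(w)-\ell_T(v)$. A Coxeter element is a regular element of $W$ (one with an eigenvector lying on no reflecting hyperplane) of order $h$. $\mathrm{NC}(W,c)$ is the interval $[e,c]$ in absolute order, a lattice with join $\bigvee$. The noncrossing projection is $\pi_T(w,c)=\bigvee_{t\in T,\ t\le_T w} t$ (join in $\mathrm{NC}(W,c)$, empty join $=e$), and $\mathsf{Pop}_T(w,c)=w\,\pi_T(w,c)^{-1}$. The forward orbit of $x$ under $f$ is $O_f(x)=\{x,f(x),f^2(x),\ldots\}$. *)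

theory Defs
  imports "HOL-Analysis.Analysis" "HOL-Algebra.Multiplicative_Group" "HOL-Algebra.Generated_Groups"
begin

definition reflections_of :: "('g, 'b) monoid_scheme \<Rightarrow> 'g set \<Rightarrow> 'g set" where
  "reflections_of W S =
     {w \<otimes>\<^bsub>W\<^esub> s \<otimes>\<^bsub>W\<^esub> inv\<^bsub>W\<^esub> w | s w. s \<in> S \<and> w \<in> carrier W}"

definition reflection_length :: "('g, 'b) monoid_scheme \<Rightarrow> 'g set \<Rightarrow> 'g \<Rightarrow> nat" where
  "reflection_length W T w =
     (LEAST k. \<exists>ts. set ts \<subseteq> T \<and> length ts = k \<and> foldr (\<otimes>\<^bsub>W\<^esub>) ts \<one>\<^bsub>W\<^esub> = w)"

definition absolute_le :: "('g, 'b) monoid_scheme \<Rightarrow> 'g set \<Rightarrow> 'g \<Rightarrow> 'g \<Rightarrow> bool" where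
  "absolute_le W T v w \<longleftrightarrow>
     int (reflection_length W T (w \<otimes>\<^bsub>W\<^esub> inv\<^bsub>W\<^esub> v))
       = int (reflection_length W T w) - int (reflection_length W T v)"

definition NC :: "('g, 'b) monoid_scheme \<Rightarrow> 'g set \<Rightarrow> 'g \<Rightarrow> 'g gorder" where
  "NC W T c =
     \<lparr>carrier = {w \<in> carrier W. absolute_le W T \<one>\<^bsub>W\<^esub> w \<and> absolute_le W T w c},
      eq = (=), le = absolute_le W T\<rparr>"

definition nc_projection :: "('g, 'b) monoid_scheme \<Rightarrow> 'g set \<Rightarrow> 'g \<Rightarrow> 'g \<Rightarrow> 'g" where
  "nc_projection W T c w = \<Squnion>\<^bsub>NC W T c\<^esub> {t \<in> T. absolute_le W T t w}"

definition Pop :: "('g, 'b) monoid_scheme \<Rightarrow> 'g set \<Rightarrow> 'g \<Rightarrow> 'g \<Rightarrow> 'g" where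
  "Pop W T c w = w \<otimes>\<^bsub>W\<^esub> inv\<^bsub>W\<^esub> (nc_projection W T c w)"

definition forward_orbit :: "('a \<Rightarrow> 'a) \<Rightarrow> 'a \<Rightarrow> 'a set" where
  "forward_orbit f x = range (\<lambda>k::nat. (f ^^ k) x)"

definition general_linear_group :: "('a::euclidean_space \<Rightarrow> 'a) monoid" where
  "general_linear_group = \<lparr>carrier = {f. linear f \<and> bij f}, monoid.mult = (\<circ>), one = id\<rparr>"

definition orthogonal_reflection :: "'a::euclidean_space \<Rightarrow> 'a \<Rightarrow> 'a" where
  "orthogonal_reflection a x = x - (2 * (x \<bullet> a) / (a \<bullet> a)) *\<^sub>R a"

text \<open>The Coxeter diagram of type D on the nodes 0, ..., n - 1: the path 0 -- 1 -- ... -- n - 2,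
  together with the edge joining n - 3 and n - 1.\<close>

definition D_edge :: "nat \<Rightarrow> nat \<Rightarrow> nat \<Rightarrow> bool" where
  "D_edge n i j \<longleftrightarrow> (i + 1 = j \<and> j + 1 < n) \<or> (i + 3 = n \<and> j + 1 = n)"

definition D_coxeter_matrix :: "nat \<Rightarrow> nat \<Rightarrow> nat \<Rightarrow> nat" where
  "D_coxeter_matrix n i j =
     (if i = j then 1 else if D_edge n i j \<or> D_edge n j i then 3 else 2)"

definition D_simple_roots :: "nat \<Rightarrow> (nat \<Rightarrow> 'a::euclidean_space) \<Rightarrow> bool" where
  "D_simple_roots n \<alpha> \<longleftrightarrow>
     span (\<alpha> ` {..<n}) = UNIV \<and>
     (\<forall>i<n. \<forall>j<n. \<alpha> i \<bullet> \<alpha> j = - cos (pi / real (D_coxeter_matrix n i j)))"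

definition simple_reflections :: "nat \<Rightarrow> (nat \<Rightarrow> 'a::euclidean_space) \<Rightarrow> ('a \<Rightarrow> 'a) set" where
  "simple_reflections n \<alpha> = (\<lambda>i. orthogonal_reflection (\<alpha> i)) ` {..<n}"

definition reflection_group :: "nat \<Rightarrow> (nat \<Rightarrow> 'a::euclidean_space) \<Rightarrow> ('a \<Rightarrow> 'a) monoid" where
  "reflection_group n \<alpha> =
     general_linear_group
       \<lparr>carrier := generate general_linear_group (simple_reflections n \<alpha>)\<rparr>"

definition reflections :: "nat \<Rightarrow> (nat \<Rightarrow> 'a::euclidean_space) \<Rightarrow> ('a \<Rightarrow> 'a) set" where
  "reflections n \<alpha> = reflections_of (reflection_group n \<alpha>) (simple_reflections n \<alpha>)"

text \<open>Eigenvectors live in the complexification of the space. The pair (x, y) stands for the complex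
  vector x + \<i> y, on which a real linear map w acts by w x + \<i> w y.\<close>

definition complex_eigenvector ::
    "('a::euclidean_space \<Rightarrow> 'a) \<Rightarrow> complex \<Rightarrow> 'a \<times> 'a \<Rightarrow> bool" where
  "complex_eigenvector w \<mu> = (\<lambda>(x, y).
     (x, y) \<noteq> (0, 0) \<and>
     w x = Re \<mu> *\<^sub>R x - Im \<mu> *\<^sub>R y \<and>
     w y = Im \<mu> *\<^sub>R x + Re \<mu> *\<^sub>R y)"

text \<open>The reflecting hyperplane of t is its fixed space; x + \<i> y lies on its complexification
  iff t fixes both x and y.\<close>

definition regular_element :: "('a::euclidean_space \<Rightarrow> 'a) set \<Rightarrow> ('a \<Rightarrow> 'a) \<Rightarrow> bool" where
  "regular_element T w \<longleftrightarrow>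
     (\<exists>\<mu> x y. complex_eigenvector w \<mu> (x, y) \<and> (\<forall>t\<in>T. \<not> (t x = x \<and> t y = y)))"

definition D_coxeter_number :: "nat \<Rightarrow> nat" where
  "D_coxeter_number n = 2 * n - 2"

definition D_coxeter_element :: "nat \<Rightarrow> (nat \<Rightarrow> 'a::euclidean_space) \<Rightarrow> ('a \<Rightarrow> 'a) \<Rightarrow> bool" where
  "D_coxeter_element n \<alpha> c \<longleftrightarrow>
     c \<in> carrier (reflection_group n \<alpha>) \<and>
     regular_element (reflections n \<alpha>) c \<and>
     group.ord (reflection_group n \<alpha>) c = D_coxeter_number n"

definition Pop\<^sub>T :: "nat \<Rightarrow> (nat \<Rightarrow> 'a::euclidean_space) \<Rightarrow> ('a \<Rightarrow> 'a) \<Rightarrow> ('a \<Rightarrow> 'a) \<Rightarrow> 'a \<Rightarrow> 'a" where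
  "Pop\<^sub>T n \<alpha> c = Pop (reflection_group n \<alpha>) (reflections n \<alpha>) c"

end

theory Submission
  imports Defs
begin

text \<open>
  In type D the group consists of even signed permutations of an orthonormal basis, the reflection
  length of \<open>w\<close> is the codimension of its fixed space, and a reflection lies below \<open>w\<close> iff its root
  is orthogonal to that fixed space. A regular element \<open>c\<close> of order \<open>2m\<close>, \<open>m = n - 1\<close>, arranges
  \<open>2m\<close> of the signed basis vectors on a circle, \<open>E i \<mapsto> E (i + 1)\<close> with \<open>E (i + m) = - E i\<close>, and
  exchanges the two remaining central vectors \<open>z\<close> and \<open>- z\<close>.

  For \<open>v\<close> below \<open>c\<close> the ranges of \<open>v - 1\<close> and \<open>c - v\<close> are complementary, so every \<open>f\<close> with
  \<open>(c - 1) f\<close> in the range of \<open>c - v\<close> is fixed by \<open>v\<close>. Since \<open>c - 1\<close> telescopes on sums of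
  consecutive circle vectors, this says that if \<open>v\<close> moves \<open>E i\<close> to \<open>E j\<close>, then the sum over the open
  arc between them is fixed by \<open>v\<close>. The element below \<open>c\<close> with fixed space inside that of \<open>w\<close> and of
  maximal dimension turns out to fix all arcs and half circles fixed by \<open>w\<close>, hence it is the join of
  the reflections below \<open>w\<close>.

  For the upper bound, follow the preimage of a circle point \<open>E j\<close> along the orbit. On the circle
  it moves towards \<open>E j\<close> at every step without overtaking it; it can enter the centre only at
  distance more than \<open>m\<close> and then leaves it at distance less than \<open>m\<close> one step later. If it starts
  in the centre, then it may flip between \<open>z\<close> and \<open>- z\<close> for a while, but the progress of the other
  circle points bounds this time. The lower bound comes from the orbit of \<open>c\<close> inverse, on which
  every projection equals \<open>c\<close>.
\<close>

section \<open>Finite sets and orbits\<close>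

lemma Diff_singleton_exchange:
  assumes "finite A" "finite B" "card A = card B" "A - B = {a}"
  obtains b where "b \<notin> A" "B = insert b (A - {a})"
proof -
  have "card (B - A) = card (A - B)"
    using assms(1-3) by (simp add: card_Diff_subset_Int Int_commute)
  then obtain b where "B - A = {b}" using assms(4) by (auto simp: card_1_singleton_iff)
  then show thesis using assms(4) by (intro that[of b]) auto
qed

lemma Diff_inj_image_nonempty:
  assumes "finite A" "inj_on f A" "f ` A \<noteq> A"
  shows "A - f ` A \<noteq> {}"
proof
  assume "A - f ` A = {}"
  then have "A \<subseteq> f ` A" by blast
  then show False using assms card_subset_eq[of "f ` A" A] by (simp add: card_image)
qed

lemma even_card_eq_doubleton:
  assumes "N \<noteq> {}" "even (card N)" and unique: "\<And>a b. a \<in> N - {y} \<Longrightarrow> b \<in> N - {y} \<Longrightarrow> a = b"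
  obtains b where "b \<noteq> y" "N = {y, b}"
proof -
  have "N \<noteq> {y}" using assms(2) by auto
  then obtain b where b_in_N: "b \<in> N" "b \<noteq> y" using assms(1) by blast
  then have "N = {b} \<or> N = {y, b}" using unique[of _ b] by blast
  then show thesis using assms(2) b_in_N(2) by (intro that[of b]) auto
qed

lemma forward_orbit_eventually_fixed:
  assumes "(f ^^ Suc K) x = (f ^^ K) x"
  shows "forward_orbit f x = (\<lambda>k. (f ^^ k) x) ` {..K}"
proof -
  have stay: "(f ^^ (K + l)) x = (f ^^ K) x" for l
    using assms by (induction l) simp_all
  have "(f ^^ k) x = (f ^^ min k K) x" for k
    using stay[of "k - K"] by (cases "k \<le> K") (simp_all add: min_def)
  then have "(f ^^ k) x \<in> (\<lambda>k. (f ^^ k) x) ` {..K}" for k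
    by (rule image_eqI) simp
  then show ?thesis by (auto simp: forward_orbit_def)
qed

lemma funpow_eq_iff_period_dvd:
  assumes "inj f" and period: "\<And>k. (f ^^ k) a = a \<longleftrightarrow> N dvd k"
  shows "(f ^^ k) a = (f ^^ l) a \<longleftrightarrow> int N dvd int k - int l"
proof -
  have ordered: "(f ^^ k) a = (f ^^ l) a \<longleftrightarrow> int N dvd int l - int k" if "k \<le> l" for k l
  proof -
    have "(f ^^ l) a = (f ^^ k) ((f ^^ (l - k)) a)"
      using that funpow_add[of k "l - k" f] by simp
    then have "(f ^^ k) a = (f ^^ l) a \<longleftrightarrow> a = (f ^^ (l - k)) a"
      using inj_fn[OF assms(1), of k] by (simp add: inj_eq)
    also have "\<dots> \<longleftrightarrow> int N dvd int (l - k)" using period[of "l - k"] by auto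
    finally show ?thesis using that by simp
  qed
  show ?thesis
    using ordered[of k l] ordered[of l k] by (cases "k \<le> l") (auto simp: dvd_diff_commute)
qed

lemma forward_orbit_parametrization:
  assumes inj_f: "inj f" and period: "\<And>k. (f ^^ k) a = a \<longleftrightarrow> N dvd k" and N_pos: "0 < N"
  obtains E :: "int \<Rightarrow> 'a" where "\<And>k. E (int k) = (f ^^ k) a" "\<And>i. f (E i) = E (i + 1)"
    "\<And>i j. E i = E j \<longleftrightarrow> int N dvd i - j" "range E = forward_orbit f a"
proof -
  define E where "E i = (f ^^ nat (i mod int N)) a" for i
  have rep: "\<exists>k. i mod int N = int k mod int N" for i
    using N_pos by (intro exI[of _ "nat (i mod int N)"]) simp
  have E_int: "E i = (f ^^ k) a" if "i mod int N = int k mod int N" for i k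
  proof -
    have "nat (i mod int N) = k mod N" using that by (metis nat_int zmod_int)
    then show ?thesis
      unfolding E_def funpow_eq_iff_period_dvd[OF inj_f period]
      by (simp add: zmod_int flip: mod_eq_dvd_iff)
  qed
  have E_Suc: "f (E i) = E (i + 1)" for i
  proof -
    obtain k where k_rep: "i mod int N = int k mod int N" using rep by blast
    then have "(i + 1) mod int N = int (Suc k) mod int N"
      by (metis add.commute mod_add_cong of_nat_Suc)
    then show ?thesis using E_int[OF k_rep] E_int[of "i + 1" "Suc k"] by simp
  qed
  have E_eq: "E i = E j \<longleftrightarrow> int N dvd i - j" for i j
  proof -
    obtain k l where "i mod int N = int k mod int N" "j mod int N = int l mod int N"
      using rep by blast
    then show ?thesis
      using E_int[of i k] E_int[of j l] funpow_eq_iff_period_dvd[OF inj_f period, of k l]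
      by (metis mod_eq_dvd_iff)
  qed
  have "range E = forward_orbit f a"
    using E_int rep unfolding forward_orbit_def by (auto simp: image_iff) metis+
  then show thesis using that[of E] E_int E_Suc E_eq by simp
qed

lemma card_forward_orbit_period:
  assumes inj_f: "inj f" and period: "\<And>k. (f ^^ k) a = a \<longleftrightarrow> N dvd k" and N_pos: "0 < N"
  shows "finite (forward_orbit f a)" "card (forward_orbit f a) = N"
proof -
  note eq_iff = funpow_eq_iff_period_dvd[OF inj_f period]
  have "(f ^^ k) a = (f ^^ (k mod N)) a" for k
    unfolding eq_iff by (simp add: zmod_int mod_eq_dvd_iff[symmetric])
  then have orbit: "forward_orbit f a = (\<lambda>k. (f ^^ k) a) ` {..<N}"
    using N_pos unfolding forward_orbit_def
    by (auto simp: image_iff) (metis mod_less_divisor lessThan_iff)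
  then show "finite (forward_orbit f a)" by simp
  have "inj_on (\<lambda>k. (f ^^ k) a) {..<N}"
    by (rule inj_onI) (simp add: eq_iff flip: mod_eq_dvd_iff zmod_int)
  then show "card (forward_orbit f a) = N" unfolding orbit by (simp add: card_image)
qed

lemma forward_orbit_eqI_card:
  assumes "finite S" "a \<in> S" "f ` S \<subseteq> S" and "inj f" "\<And>k. (f ^^ k) a = a \<longleftrightarrow> N dvd k" "0 < N"
    and "card S = N"
  shows "forward_orbit f a = S"
proof (rule card_subset_eq[OF assms(1)])
  have "(f ^^ k) a \<in> S" for k using assms(2,3) by (induction k) auto
  then show "forward_orbit f a \<subseteq> S" by (auto simp: forward_orbit_def)
  show "card (forward_orbit f a) = card S"
    using card_forward_orbit_period(2)[OF assms(4-6)] assms(7) by simp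
qed

lemma period_dvd_card:
  assumes "finite S" and inj_f: "inj f" and "f ` S \<subseteq> S" and N_pos: "0 < N"
    and "\<And>a k. a \<in> S \<Longrightarrow> (f ^^ k) a = a \<longleftrightarrow> N dvd k"
  shows "N dvd card S"
  using assms(1,3,5)
proof (induction S rule: finite_psubset_induct)
  case (psubset S)
  show ?case
  proof (cases "S = {}")
    case False
    then obtain a where a_in_S: "a \<in> S" by blast
    let ?O = "forward_orbit f a"
    note orbit = card_forward_orbit_period[OF inj_f psubset.prems(2)[OF a_in_S] N_pos]
    have "(f ^^ k) a \<in> S" for k using a_in_S psubset.prems(1) by (induction k) auto
    then have sub: "?O \<subseteq> S" by (auto simp: forward_orbit_def)
    have "b \<in> ?O" if "f b \<in> ?O" for b
    proof -
      obtain k where f_b_eq: "f b = (f ^^ k) a" using \<open>f b \<in> ?O\<close> by (auto simp: forward_orbit_def)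
      also have "\<dots> = (f ^^ (k + N)) a"
        unfolding funpow_eq_iff_period_dvd[OF inj_f psubset.prems(2)[OF a_in_S]] by simp
      also have "\<dots> = f ((f ^^ (k + N - 1)) a)"
        using N_pos by (cases "k + N") simp_all
      finally have "b = (f ^^ (k + N - 1)) a" using inj_f by (simp add: inj_eq)
      then show ?thesis by (auto simp: forward_orbit_def)
    qed
    then have invariant: "f ` (S - ?O) \<subseteq> S - ?O" using psubset.prems(1) by blast
    have "a \<in> ?O" by (auto simp: forward_orbit_def intro: range_eqI[of _ _ 0])
    then have "N dvd card (S - ?O)"
      using a_in_S invariant psubset.prems(2) by (intro psubset.IH) auto
    moreover have "card S = card ?O + card (S - ?O)"
      using card_Diff_subset[OF orbit(1) sub] card_mono[OF psubset.hyps(1) sub] by simp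
    ultimately show ?thesis using orbit(2) by simp
  qed simp
qed

section \<open>Fixed and moved spaces of isometries\<close>

abbreviation finv :: "('a \<Rightarrow> 'b) \<Rightarrow> 'b \<Rightarrow> 'a" where
  "finv \<equiv> Hilbert_Choice.inv"

definition fixspace :: "('a::euclidean_space \<Rightarrow> 'a) \<Rightarrow> 'a set" where
  "fixspace w = {x. w x = x}"

definition movspace :: "('a::euclidean_space \<Rightarrow> 'a) \<Rightarrow> 'a set" where
  "movspace w = range (\<lambda>x. w x - x)"

lemma fixspace_iff: "x \<in> fixspace w \<longleftrightarrow> w x = x"
  by (simp add: fixspace_def)

lemma movspaceI: "w x - x \<in> movspace w"
  by (simp add: movspace_def)

lemma movspaceE:
  assumes "y \<in> movspace w"
  obtains x where "y = w x - x"
  using assms by (auto simp: movspace_def)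

lemma movspace_id: "movspace id = {0}"
  by (auto simp: movspace_def)

lemma subspace_fixspace: "linear w \<Longrightarrow> subspace (fixspace w)"
  by (auto simp: fixspace_def subspace_def linear_iff linear_0)

lemma subspace_movspace: "linear w \<Longrightarrow> subspace (movspace w)"
  unfolding movspace_def
  by (rule linear_subspace_image) (auto intro: linear_compose_sub linear_ident)

lemma movspace_scaleRI:
  assumes "linear w" "w u - u = k *\<^sub>R b" "k \<noteq> 0"
  shows "b \<in> movspace w"
proof -
  have "(1 / k) *\<^sub>R (w u - u) \<in> movspace w"
    using assms(1) by (intro subspace_scale subspace_movspace movspaceI)
  then show ?thesis using assms(2,3) by simp
qed

lemma fixspace_eq_orthogonal_comp:
  assumes "orthogonal_transformation w"
  shows "fixspace w = (movspace w)\<^sup>\<bottom>"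
proof (intro equalityI subsetI)
  fix y assume "y \<in> fixspace w"
  then have "w x \<bullet> y = x \<bullet> y" for x
    using assms by (metis fixspace_iff orthogonal_transformation_def)
  then show "y \<in> (movspace w)\<^sup>\<bottom>"
    by (auto simp: orthogonal_comp_def orthogonal_def inner_diff_left elim: movspaceE)
next
  fix y assume "y \<in> (movspace w)\<^sup>\<bottom>"
  then have "(w x - x) \<bullet> y = 0" for x
    using movspaceI[of w x] by (simp add: orthogonal_comp_def orthogonal_def)
  then have "w x \<bullet> w y = w x \<bullet> y" for x
    using assms by (simp add: inner_diff_left orthogonal_transformation_def)
  then have "u \<bullet> w y = u \<bullet> y" for u
    using orthogonal_transformation_surj[OF assms] by (metis surjD)
  then show "y \<in> fixspace w" using vector_eq_ldot[of "w y" y] by (simp add: fixspace_iff)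
qed

lemma movspace_eq_orthogonal_comp:
  "orthogonal_transformation w \<Longrightarrow> movspace w = (fixspace w)\<^sup>\<bottom>"
  by (simp add: fixspace_eq_orthogonal_comp orthogonal_comp_self subspace_movspace
      orthogonal_transformation_linear)

lemma dim_fixspace_movspace:
  fixes w :: "'a::euclidean_space \<Rightarrow> 'a"
  assumes "orthogonal_transformation w"
  shows "dim (fixspace w) + dim (movspace w) = DIM('a)"
  using dim_subspace_orthogonal_to_vectors[of "movspace w" UNIV] assms
  by (simp add: fixspace_eq_orthogonal_comp orthogonal_comp_def subspace_movspace
      orthogonal_transformation_linear)

lemma movspace_subset_iff:
  assumes "orthogonal_transformation v" "orthogonal_transformation w"
  shows "movspace w \<subseteq> movspace v \<longleftrightarrow> fixspace v \<subseteq> fixspace w"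
  using assms
  by (metis fixspace_eq_orthogonal_comp movspace_eq_orthogonal_comp orthogonal_comp_anti_mono)

lemma movspace_comp_subset:
  "movspace (v \<circ> w) \<subseteq> {x + y |x y. x \<in> movspace v \<and> y \<in> movspace w}"
proof
  fix u assume "u \<in> movspace (v \<circ> w)"
  then obtain x where "u = (v (w x) - w x) + (w x - x)" by (auto elim: movspaceE)
  then show "u \<in> {x + y |x y. x \<in> movspace v \<and> y \<in> movspace w}" using movspaceI by blast
qed

lemma dim_movspace_comp_le:
  assumes "linear v" "linear w"
  shows "dim (movspace (v \<circ> w)) \<le> dim (movspace v) + dim (movspace w)"
  using dim_subset[OF movspace_comp_subset, of v w]
    dim_sums_Int[OF subspace_movspace[OF assms(1)] subspace_movspace[OF assms(2)]] by linarith

lemma movspace_comp_direct_sum: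
  assumes lin_v: "linear v" and lin_w: "linear w"
    and dim: "dim (movspace (v \<circ> w)) = dim (movspace v) + dim (movspace w)"
  shows "movspace (v \<circ> w) = {x + y |x y. x \<in> movspace v \<and> y \<in> movspace w}"
    and "movspace v \<inter> movspace w = {0}"
proof -
  let ?S = "{x + y |x y. x \<in> movspace v \<and> y \<in> movspace w}"
  have sub: "subspace (movspace v)" "subspace (movspace w)"
    using lin_v lin_w by (simp_all add: subspace_movspace)
  have "linear (v \<circ> w)" using lin_w lin_v by (rule linear_compose)
  then show "movspace (v \<circ> w) = ?S"
    using movspace_comp_subset[of v w] dim dim_sums_Int[OF sub] sub
    by (intro subspace_dim_equal) (auto intro: subspace_movspace subspace_sums)
  then have "dim (movspace v \<inter> movspace w) = 0" using dim dim_sums_Int[OF sub] by simp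
  then show "movspace v \<inter> movspace w = {0}"
    using sub by (auto simp: subspace_0)
qed

lemma orthogonal_reflection_linear: "linear (orthogonal_reflection a)"
  unfolding orthogonal_reflection_def
  by (rule linearI) (simp_all add: algebra_simps add_divide_distrib flip: scaleR_add_left)

lemma orthogonal_transformation_reflection: "orthogonal_transformation (orthogonal_reflection a)"
proof (cases "a = 0")
  case False
  then have "orthogonal_reflection a v \<bullet> orthogonal_reflection a w = v \<bullet> w" for v w
    by (simp add: orthogonal_reflection_def inner_diff_left inner_diff_right inner_commute field_simps)
  then show ?thesis by (simp add: orthogonal_transformation_def orthogonal_reflection_linear)
qed (simp add: orthogonal_reflection_def[abs_def])

lemma orthogonal_reflection_fixes_iff:
  "a \<noteq> 0 \<Longrightarrow> orthogonal_reflection a x = x \<longleftrightarrow> x \<bullet> a = 0"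
  by (auto simp: orthogonal_reflection_def)

lemma orthogonal_reflection_involution: "orthogonal_reflection a (orthogonal_reflection a x) = x"
  by (cases "a = 0") (auto simp: orthogonal_reflection_def algebra_simps)

lemma finv_orthogonal_reflection: "finv (orthogonal_reflection a) = orthogonal_reflection a"
  by (rule inv_unique_comp) (auto simp: fun_eq_iff orthogonal_reflection_involution)

lemma orthogonal_reflection_scaleR:
  "k \<noteq> 0 \<Longrightarrow> orthogonal_reflection (k *\<^sub>R a) = orthogonal_reflection a"
  by (auto simp: orthogonal_reflection_def fun_eq_iff)

lemma orthogonal_reflection_uminus: "orthogonal_reflection (- a) = orthogonal_reflection a"
  using orthogonal_reflection_scaleR[of "-1" a] by simp

lemma orthogonal_reflection_conj:
  assumes "orthogonal_transformation w"
  shows "w \<circ> orthogonal_reflection a = orthogonal_reflection (w a) \<circ> w"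
  using assms
  by (auto simp: orthogonal_reflection_def orthogonal_transformation_def linear_diff linear_scale)

lemma orthogonal_reflection_image:
  fixes w :: "'a::euclidean_space \<Rightarrow> 'a"
  assumes "orthogonal_transformation w"
  shows "orthogonal_reflection (w a) = w \<circ> orthogonal_reflection a \<circ> finv w"
proof -
  have "w \<circ> finv w = id" using orthogonal_transformation_surj[OF assms] by (simp add: surj_iff)
  then show ?thesis unfolding orthogonal_reflection_conj[OF assms] by (simp add: comp_assoc)
qed

lemma movspace_orthogonal_reflection:
  assumes "a \<noteq> 0"
  shows "movspace (orthogonal_reflection a) = span {a}"
proof
  show "movspace (orthogonal_reflection a) \<subseteq> span {a}"
    by (auto simp: movspace_def orthogonal_reflection_def span_scale span_base span_neg)
  have "(- 1 / 2) *\<^sub>R (orthogonal_reflection a a - a) \<in> movspace (orthogonal_reflection a)"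
    by (intro subspace_scale subspace_movspace orthogonal_reflection_linear movspaceI)
  then show "span {a} \<subseteq> movspace (orthogonal_reflection a)"
    using assms
    by (intro span_minimal subspace_movspace orthogonal_reflection_linear)
      (simp add: orthogonal_reflection_def)
qed

lemma dim_movspace_reflection: "a \<noteq> 0 \<Longrightarrow> dim (movspace (orthogonal_reflection a)) = 1"
  by (simp add: movspace_orthogonal_reflection)

text \<open>Since \<open>w\<close> is an isometry, \<open>u\<close> and \<open>w u\<close> are exchanged by the reflection along \<open>w u - u\<close>.\<close>

lemma orthogonal_reflection_comp_fixes:
  assumes "orthogonal_transformation w" "k \<noteq> 0" "w u - u = k *\<^sub>R a"
  shows "orthogonal_reflection a (w u) = u"
proof -
  define b where "b = w u - u"
  have "w u \<bullet> w u = u \<bullet> u" using assms(1) by (simp add: orthogonal_transformation_def)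
  then have "2 * (w u \<bullet> b) = b \<bullet> b"
    by (simp add: b_def inner_diff_left inner_diff_right inner_commute)
  then have "orthogonal_reflection b (w u) = w u - b"
    by (cases "b = 0") (simp_all add: orthogonal_reflection_def)
  moreover have "orthogonal_reflection b = orthogonal_reflection a"
    using orthogonal_reflection_scaleR[OF assms(2)] by (simp add: b_def assms(3))
  ultimately show ?thesis by (simp add: b_def)
qed

lemma fixspace_reflection_comp_subset:
  assumes "orthogonal_transformation w" "a \<in> movspace w"
  shows "fixspace w \<subseteq> fixspace (orthogonal_reflection a \<circ> w)"
proof
  fix x assume x_fixed: "x \<in> fixspace w"
  then have "a \<bullet> x = 0"
    using assms fixspace_eq_orthogonal_comp by (auto simp: orthogonal_comp_def orthogonal_def)
  then show "x \<in> fixspace (orthogonal_reflection a \<circ> w)"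
    using x_fixed by (simp add: fixspace_iff orthogonal_reflection_def inner_commute)
qed

lemma dim_movspace_reflection_comp:
  assumes orth_w: "orthogonal_transformation w" and a_mov: "a \<in> movspace w" "a \<noteq> 0"
  shows "dim (movspace (orthogonal_reflection a \<circ> w)) + 1 = dim (movspace w)"
proof -
  let ?s = "orthogonal_reflection a"
  have orth_sw: "orthogonal_transformation (?s \<circ> w)"
    using orthogonal_transformation_reflection orth_w by (rule orthogonal_transformation_compose)
  obtain u where a_eq: "a = w u - u" using a_mov(1) by (rule movspaceE)
  have "?s (w u) = u" using orthogonal_reflection_comp_fixes[OF orth_w, of 1 u a] a_eq by simp
  then have "u \<in> fixspace (?s \<circ> w)" "u \<notin> fixspace w"
    using a_eq a_mov(2) by (auto simp: fixspace_iff)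
  then have "fixspace w \<subset> fixspace (?s \<circ> w)"
    using fixspace_reflection_comp_subset[OF orth_w a_mov(1)] by blast
  then have "dim (fixspace w) < dim (fixspace (?s \<circ> w))"
    using subspace_fixspace orth_w orth_sw orthogonal_transformation_linear
    by (metis dim_psubset span_eq_iff)
  moreover have "?s \<circ> (?s \<circ> w) = w" by (simp add: fun_eq_iff orthogonal_reflection_involution)
  then have "dim (movspace w) \<le> 1 + dim (movspace (?s \<circ> w))"
    using dim_movspace_comp_le[OF orthogonal_reflection_linear, of "?s \<circ> w" a]
      orthogonal_transformation_linear[OF orth_sw]
      dim_movspace_reflection[OF a_mov(2)] by simp
  ultimately show ?thesis
    using dim_fixspace_movspace[OF orth_w] dim_fixspace_movspace[OF orth_sw] by linarith
qed

lemma fixspace_reflection_comp: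
  assumes orth_w: "orthogonal_transformation w" and u_moved: "w u - u = k *\<^sub>R a" "k \<noteq> 0"
    and a_nonzero: "a \<noteq> 0"
  shows "fixspace (orthogonal_reflection a \<circ> w) = span (insert u (fixspace w))"
proof -
  let ?s = "orthogonal_reflection a"
  have lin: "linear w" using orth_w by (rule orthogonal_transformation_linear)
  have orth_sw: "orthogonal_transformation (?s \<circ> w)"
    using orthogonal_transformation_reflection orth_w by (rule orthogonal_transformation_compose)
  have a_in_mov: "a \<in> movspace w" using lin u_moved by (rule movspace_scaleRI)
  have "?s (w u) = u" using orthogonal_reflection_comp_fixes[OF orth_w u_moved(2,1)] .
  then have sub: "insert u (fixspace w) \<subseteq> fixspace (?s \<circ> w)"
    using fixspace_reflection_comp_subset[OF orth_w a_in_mov] by (auto simp: fixspace_iff)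
  have "u \<notin> span (fixspace w)"
    using u_moved a_nonzero subspace_fixspace[OF lin]
    by (auto simp: fixspace_iff span_eq_iff[THEN iffD2])
  then have "dim (insert u (fixspace w)) = dim (fixspace w) + 1" by (simp add: dim_insert)
  moreover have "dim (fixspace (?s \<circ> w)) = dim (fixspace w) + 1"
    using dim_movspace_reflection_comp[OF orth_w a_in_mov a_nonzero]
      dim_fixspace_movspace[OF orth_w]
      dim_fixspace_movspace[OF orth_sw] by linarith
  ultimately have "span (insert u (fixspace w)) = span (fixspace (?s \<circ> w))"
    using sub by (intro dim_eq_span) auto
  then show ?thesis
    using subspace_fixspace[OF orthogonal_transformation_linear[OF orth_sw]]
    by (simp add: span_eq_iff[THEN iffD2])
qed

section \<open>The absolute order on isometries\<close>

definition isometry_le :: "('a::euclidean_space \<Rightarrow> 'a) \<Rightarrow> ('a \<Rightarrow> 'a) \<Rightarrow> bool" (infix "\<preceq>" 50) where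
  "v \<preceq> w \<longleftrightarrow> dim (movspace (w \<circ> finv v)) + dim (movspace v) = dim (movspace w)"

lemma isometry_le_refl: "orthogonal_transformation w \<Longrightarrow> w \<preceq> w"
  using orthogonal_transformation_surj[of w] by (simp add: isometry_le_def surj_iff movspace_id)

lemma id_isometry_le: "id \<preceq> w"
  by (simp add: isometry_le_def movspace_id)

lemma comp_finv_cancel: "bij v \<Longrightarrow> (w \<circ> finv v) \<circ> v = w"
  by (simp add: comp_assoc bij_is_inj)

lemma orthogonal_transformation_comp_finv:
  fixes v w :: "'a::euclidean_space \<Rightarrow> 'a"
  assumes "orthogonal_transformation v" "orthogonal_transformation w"
  shows "orthogonal_transformation (w \<circ> finv v)"
  using assms by (intro orthogonal_transformation_compose orthogonal_transformation_inv)

lemma movspace_comp_finv: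
  assumes "bij v"
  shows "movspace (w \<circ> finv v) = range (\<lambda>x. w x - v x)"
proof -
  have "range (\<lambda>x. w x - v x) = (\<lambda>y. w (finv v y) - y) ` range v"
    using assms by (simp add: image_image bij_is_inj)
  then show ?thesis using assms by (simp add: movspace_def bij_is_surj)
qed

lemma dim_movspace_le_comp_finv:
  assumes orth_v: "orthogonal_transformation v" and orth_w: "orthogonal_transformation w"
  shows "dim (movspace w) \<le> dim (movspace (w \<circ> finv v)) + dim (movspace v)"
  using dim_movspace_comp_le[of "w \<circ> finv v" v] comp_finv_cancel[of v w]
    orthogonal_transformation_comp_finv[OF orth_v orth_w] orth_v orthogonal_transformation_linear
    orthogonal_transformation_bij by metis

lemma isometry_le_direct_sum:
  assumes orth_v: "orthogonal_transformation v" and orth_w: "orthogonal_transformation w"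
    and v_le_w: "v \<preceq> w"
  shows "movspace v \<subseteq> movspace w"
    and "movspace v \<inter> range (\<lambda>x. w x - v x) = {0}"
proof -
  have bij: "bij v" using orth_v by (rule orthogonal_transformation_bij)
  have lin: "linear (w \<circ> finv v)" "linear v"
    using orthogonal_transformation_comp_finv[OF orth_v orth_w] orth_v
      orthogonal_transformation_linear
    by auto
  have "dim (movspace ((w \<circ> finv v) \<circ> v)) = dim (movspace (w \<circ> finv v)) + dim (movspace v)"
    using v_le_w unfolding comp_finv_cancel[OF bij] isometry_le_def by simp
  note sum = movspace_comp_direct_sum[OF lin this, unfolded comp_finv_cancel[OF bij]]
  show "movspace v \<inter> range (\<lambda>x. w x - v x) = {0}"
    using sum(2) by (simp add: movspace_comp_finv[OF bij] Int_commute)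
  have "0 \<in> movspace (w \<circ> finv v)" using lin(1) subspace_movspace subspace_0 by blast
  then show "movspace v \<subseteq> movspace w" unfolding sum(1) by force
qed

lemma isometry_le_fixes_iff:
  assumes "orthogonal_transformation v" "orthogonal_transformation w" "v \<preceq> w"
  shows "v f = f \<longleftrightarrow> w f - f \<in> range (\<lambda>x. w x - v x)"
proof
  assume "w f - f \<in> range (\<lambda>x. w x - v x)"
  then obtain x where "w f - f = w x - v x" by blast
  then have "v f - f = w (x - f) - v (x - f)"
    using assms by (simp add: orthogonal_transformation_linear linear_diff algebra_simps)
  then have "v f - f \<in> movspace v \<inter> range (\<lambda>x. w x - v x)" using movspaceI[of v f] by blast
  then show "v f = f" using isometry_le_direct_sum(2)[OF assms] by simp
next
  assume "v f = f"
  then have "w f - f = w f - v f" by simp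
  then show "w f - f \<in> range (\<lambda>x. w x - v x)" by (rule range_eqI)
qed

lemma isometry_le_eq_on_movspace:
  assumes "orthogonal_transformation v" "orthogonal_transformation w" "v \<preceq> w"
    and "w y - y \<in> movspace v"
  shows "v y = w y"
proof -
  have "subspace (movspace v)"
    using assms(1) by (intro subspace_movspace orthogonal_transformation_linear)
  then have "(w y - y) - (v y - y) \<in> movspace v"
    using assms(4) movspaceI by (rule subspace_diff)
  then have "w y - v y \<in> movspace v \<inter> range (\<lambda>x. w x - v x)" by simp
  then show ?thesis using isometry_le_direct_sum(2)[OF assms(1-3)] by simp
qed

lemma isometry_le_eqI:
  assumes "orthogonal_transformation v" "orthogonal_transformation w" "v \<preceq> w"
    and "movspace w \<subseteq> movspace v"
  shows "v = w"
  using isometry_le_eq_on_movspace[OF assms(1-3)] movspaceI assms(4) by blast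

lemma isometry_le_displacement_lift:
  assumes orth_u: "orthogonal_transformation u" and orth_v: "orthogonal_transformation v"
    and orth_w: "orthogonal_transformation w"
    and u_le_w: "u \<preceq> w" and v_le_w: "v \<preceq> w" and mov: "movspace u \<subseteq> movspace v"
    and b_mov: "b \<in> movspace u"
  obtains y where "b = u y - y" "v y = u y"
proof -
  obtain y where b_eq: "b = w y - y"
    using b_mov isometry_le_direct_sum(1)[OF orth_u orth_w u_le_w] by (auto elim: movspaceE)
  then have "u y = w y" "v y = w y"
    using b_mov mov isometry_le_eq_on_movspace[OF orth_u orth_w u_le_w, of y]
      isometry_le_eq_on_movspace[OF orth_v orth_w v_le_w, of y]
    by auto
  then show thesis using b_eq by (intro that[of y]) simp_all
qed

lemma isometry_le_range_Int_movspace: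
  assumes orth_u: "orthogonal_transformation u" and orth_v: "orthogonal_transformation v"
    and orth_w: "orthogonal_transformation w"
    and u_le_w: "u \<preceq> w" and v_le_w: "v \<preceq> w" and fixuv: "fixspace v \<subseteq> fixspace u"
  shows "range (\<lambda>x. v x - u x) \<inter> movspace u = {0}"
proof -
  have lin: "linear u" "linear v"
    using orth_u orth_v by (auto intro: orthogonal_transformation_linear)
  have "movspace u \<subseteq> movspace v" using movspace_subset_iff[OF orth_v orth_u] fixuv by blast
  note lift = isometry_le_displacement_lift[OF orth_u orth_v orth_w u_le_w v_le_w this]
  have "v x - u x = 0" if diff_mov: "v x - u x \<in> movspace u" for x
  proof -
    obtain y where diff_eq: "v x - u x = u y - y" "v y = u y" using lift[OF diff_mov] by blast
    obtain y' where disp_eq: "u x - x = u y' - y'" "v y' = u y'"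
      using lift[OF movspaceI[of u x]] by blast
    have "v (x - y - y') = v x - v y - v y'" using lin(2) by (simp add: linear_diff)
    also have "v x = u x + (u y - y)" using diff_eq(1) by (simp add: algebra_simps)
    also have "u x = x + (u y' - y')" using disp_eq(1) by (simp add: algebra_simps)
    also have "x + (u y' - y') + (u y - y) - v y - v y' = x - y - y'" using diff_eq disp_eq by simp
    finally have "v (x - y - y') = x - y - y'" .
    then have "u (x - y - y') = x - y - y'" using fixuv by (auto simp: fixspace_iff)
    then have "(u x - u y - u y') - (x - y - y') = 0" using lin(1) by (simp add: linear_diff)
    moreover have "u y - y = (u x - x) - (u y' - y') - ((u x - u y - u y') - (x - y - y'))"
      by (simp add: algebra_simps)
    ultimately show ?thesis using diff_eq(1) disp_eq(1) by simp
  qed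
  then have "range (\<lambda>x. v x - u x) \<inter> movspace u \<subseteq> {0}" by blast
  moreover have "0 \<in> range (\<lambda>x. v x - u x)"
    using lin by (intro range_eqI[of _ _ 0]) (simp add: linear_0)
  moreover have "0 \<in> movspace u" using lin(1) by (intro subspace_0 subspace_movspace)
  ultimately show ?thesis by blast
qed

lemma isometry_le_antimono_fixspace:
  assumes orth_u: "orthogonal_transformation u" and orth_v: "orthogonal_transformation v"
    and orth_w: "orthogonal_transformation w"
    and u_le_w: "u \<preceq> w" and v_le_w: "v \<preceq> w" and fixuv: "fixspace v \<subseteq> fixspace u"
  shows "u \<preceq> v"
proof -
  let ?R = "range (\<lambda>x. v x - u x)"
  have lin: "linear u" "linear v"
    using orth_u orth_v by (auto intro: orthogonal_transformation_linear)
  have range: "movspace (v \<circ> finv u) = ?R"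
    using orthogonal_transformation_bij[OF orth_u] by (rule movspace_comp_finv)
  have sub: "subspace ?R" "subspace (movspace u)" "subspace (movspace v)"
    using lin by (auto intro: linear_subspace_image linear_compose_sub subspace_movspace)
  have mov: "movspace u \<subseteq> movspace v" using movspace_subset_iff[OF orth_v orth_u] fixuv by blast
  have "v x - u x \<in> movspace v" for x
    using subspace_diff[OF sub(3) movspaceI[of v x], of "u x - x"] mov movspaceI[of u x] by auto
  then have "{a + b |a b. a \<in> ?R \<and> b \<in> movspace u} \<subseteq> movspace v"
    using mov subspace_add[OF sub(3)] by blast
  then have "dim {a + b |a b. a \<in> ?R \<and> b \<in> movspace u} \<le> dim (movspace v)" by (rule dim_subset)
  then have "dim ?R + dim (movspace u) \<le> dim (movspace v)"
    using dim_sums_Int[OF sub(1,2)] isometry_le_range_Int_movspace[OF assms] by simp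
  then show ?thesis
    using dim_movspace_le_comp_finv[OF orth_u orth_v] unfolding isometry_le_def range by simp
qed

lemma isometry_le_trans:
  assumes orth_u: "orthogonal_transformation u" and orth_v: "orthogonal_transformation v"
    and orth_w: "orthogonal_transformation w" and u_le_v: "u \<preceq> v" and v_le_w: "v \<preceq> w"
  shows "u \<preceq> w"
proof -
  have "w \<circ> finv u = (w \<circ> finv v) \<circ> (v \<circ> finv u)"
    using orthogonal_transformation_bij[OF orth_v] by (simp add: fun_eq_iff bij_is_inj)
  then have "dim (movspace (w \<circ> finv u)) \<le> dim (movspace (w \<circ> finv v)) + dim (movspace (v \<circ> finv u))"
    using dim_movspace_comp_le[of "w \<circ> finv v" "v \<circ> finv u"] orthogonal_transformation_linear
      orthogonal_transformation_comp_finv orth_u orth_v orth_w by metis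
  then show ?thesis
    using u_le_v v_le_w dim_movspace_le_comp_finv[OF orth_u orth_w] unfolding isometry_le_def
    by linarith
qed

lemma reflection_comp_isometry_le:
  assumes orth_v: "orthogonal_transformation v" and a_mov: "a \<in> movspace v" "a \<noteq> 0"
  shows "orthogonal_reflection a \<circ> v \<preceq> v"
proof -
  let ?s = "orthogonal_reflection a"
  have "finv (?s \<circ> v) = finv v \<circ> ?s"
    using o_inv_distrib[of ?s v] orth_v orthogonal_transformation_reflection[of a]
      orthogonal_transformation_bij finv_orthogonal_reflection by metis
  then have "v \<circ> finv (?s \<circ> v) = ?s"
    using orthogonal_transformation_surj[OF orth_v] by (simp add: fun_eq_iff surj_f_inv_f)
  then show ?thesis
    using dim_movspace_reflection_comp[OF orth_v a_mov] dim_movspace_reflection[OF a_mov(2)]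
    by (simp add: isometry_le_def)
qed

lemma reflection_isometry_le_iff:
  assumes orth_w: "orthogonal_transformation w" and a_nonzero: "a \<noteq> 0"
  shows "orthogonal_reflection a \<preceq> w \<longleftrightarrow> a \<in> movspace w"
proof
  assume "orthogonal_reflection a \<preceq> w"
  then show "a \<in> movspace w"
    using isometry_le_direct_sum(1)[OF orthogonal_transformation_reflection orth_w, of a]
      movspace_orthogonal_reflection[OF a_nonzero] by (auto simp: span_base)
next
  let ?s = "orthogonal_reflection a"
  assume "a \<in> movspace w"
  then obtain u where a_eq: "a = w u - u" by (rule movspaceE)
  have lin: "linear w" using orth_w by (rule orthogonal_transformation_linear)
  have "w a = w (w u) - w u" using a_eq lin by (simp add: linear_diff)
  then have "w a \<in> movspace w" using movspaceI[of w "w u"] by simp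
  moreover have "w a \<noteq> 0"
    using a_nonzero orth_w by (metis norm_eq_zero orthogonal_transformation_norm)
  moreover have "w \<circ> finv ?s = orthogonal_reflection (w a) \<circ> w"
    unfolding finv_orthogonal_reflection using orth_w by (rule orthogonal_reflection_conj)
  ultimately show "?s \<preceq> w"
    using dim_movspace_reflection_comp[OF orth_w] dim_movspace_reflection[OF a_nonzero]
    by (simp add: isometry_le_def)
qed

section \<open>Even signed permutations of an orthonormal basis\<close>

locale signed_basis =
  fixes X :: "'a::euclidean_space set"
  assumes finite_X: "finite X"
    and neg_X: "a \<in> X \<Longrightarrow> - a \<in> X"
    and unit_X: "a \<in> X \<Longrightarrow> a \<bullet> a = 1"
    and orth_X: "a \<in> X \<Longrightarrow> b \<in> X \<Longrightarrow> b \<noteq> a \<Longrightarrow> b \<noteq> - a \<Longrightarrow> a \<bullet> b = 0"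
    and span_X: "span X = UNIV"
begin

definition roots :: "'a set" where
  "roots = {a - b | a b. a \<in> X \<and> b \<in> X \<and> b \<noteq> a \<and> b \<noteq> - a}"

definition half_system :: "'a set \<Rightarrow> bool" where
  "half_system H \<longleftrightarrow> H \<subseteq> X \<and> (\<forall>a\<in>X. a \<in> H \<longleftrightarrow> - a \<notin> H)"

definition consistent :: "'a set \<Rightarrow> bool" where
  "consistent A \<longleftrightarrow> A \<subseteq> X \<and> (\<forall>a\<in>A. - a \<notin> A)"

lemma X_nonzero: "a \<in> X \<Longrightarrow> a \<noteq> 0" "a \<in> X \<Longrightarrow> - a \<noteq> a" "a \<in> X \<Longrightarrow> a \<noteq> - a"
  using unit_X by (force simp: eq_neg_iff_add_eq_0 neg_eq_iff_add_eq_0 simp flip: scaleR_2)+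

lemma inner_X:
  assumes "a \<in> X" "b \<in> X"
  shows "a \<bullet> b = (if b = a then 1 else if b = - a then -1 else 0)"
  using assms unit_X orth_X by auto

lemma linear_eq_on_X:
  assumes "linear f" "linear g" "\<And>a. a \<in> X \<Longrightarrow> f a = g a"
  shows "f = g"
  using linear_eq_on_span[of f g X] assms span_X by (auto simp: fun_eq_iff)

lemma inner_sum_X:
  assumes "consistent A" "a \<in> X"
  shows "a \<bullet> \<Sum>A = (if a \<in> A then 1 else if - a \<in> A then -1 else 0)"
proof -
  have A_finite_subset: "finite A" "A \<subseteq> X"
    using assms(1) finite_X finite_subset by (auto simp: consistent_def)
  have "a \<bullet> \<Sum>A = (\<Sum>b\<in>A. a \<bullet> b)" by (simp add: inner_sum_right)
  also have "\<dots> = (\<Sum>b\<in>A. (if b = a then 1 else 0) - (if b = - a then 1 else 0))"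
    using A_finite_subset assms(2) X_nonzero by (intro sum.cong) (auto simp: inner_X subset_iff)
  also have "\<dots> = (if a \<in> A then 1 else 0) - (if - a \<in> A then 1 else 0)"
    using A_finite_subset by (simp add: sum_subtractf)
  finally show ?thesis using assms(1) by (auto simp: consistent_def)
qed

lemma roots_nonzero: "b \<in> roots \<Longrightarrow> b \<noteq> 0"
  by (auto simp: roots_def)

lemma rootI: "a \<in> X \<Longrightarrow> b \<in> X \<Longrightarrow> b \<noteq> a \<Longrightarrow> b \<noteq> - a \<Longrightarrow> a - b \<in> roots"
  by (auto simp: roots_def)

lemma rootE:
  assumes "r \<in> roots"
  obtains a b where "a \<in> X" "b \<in> X" "b \<noteq> a" "b \<noteq> - a" "r = a - b"
  using assms by (auto simp: roots_def)

lemma root_reflection_X: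
  assumes "a \<in> X" "b \<in> X" "b \<noteq> a" "b \<noteq> - a" "x \<in> X"
  shows "orthogonal_reflection (a - b) x =
    (if x = a then b else if x = b then a else if x = - a then - b else if x = - b then - a else x)"
proof -
  have ab_distinct: "a \<noteq> b" "a \<noteq> - b" "- a \<noteq> b" using assms(3,4) by auto
  have "a \<bullet> b = 0" "b \<bullet> a = 0" using assms orth_X by (auto simp: inner_commute)
  then have "(a - b) \<bullet> (a - b) = 2"
    using unit_X assms by (simp add: inner_diff_left inner_diff_right)
  then have reflect: "orthogonal_reflection (a - b) x = x - (x \<bullet> a - x \<bullet> b) *\<^sub>R (a - b)"
    by (simp add: orthogonal_reflection_def inner_diff_right)
  show ?thesis
    unfolding reflect using assms ab_distinct X_nonzero[of a] X_nonzero[of b]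
    by (auto simp: inner_X[of x a] inner_X[of x b] neg_X)
qed

subsection \<open>Half systems\<close>

lemma half_system_consistent: "half_system H \<Longrightarrow> consistent H"
  by (auto simp: half_system_def consistent_def)

lemma half_system_subset_X: "half_system H \<Longrightarrow> H \<subseteq> X"
  by (simp add: half_system_def)

lemma half_system_uminus_iff: "half_system H \<Longrightarrow> a \<in> X \<Longrightarrow> - a \<in> H \<longleftrightarrow> a \<notin> H"
  by (auto simp: half_system_def)

lemma finite_half_system: "half_system H \<Longrightarrow> finite H"
  using finite_X finite_subset half_system_subset_X by blast

lemma ex_half_system: "\<exists>H. half_system H"
proof -
  define rep where "rep a = (SOME b. b \<in> {a, - a})" for a :: 'a
  have rep: "rep a = a \<or> rep a = - a" for a
    using someI[of "\<lambda>b. b \<in> {a, - a}" a] by (simp add: rep_def)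
  have rep_uminus: "rep (- a) = rep a" for a by (simp add: rep_def insert_commute)
  have "rep a = a \<longleftrightarrow> rep (- a) \<noteq> - a" if "a \<in> X" for a
    using rep[of a] X_nonzero[OF that] by (auto simp: rep_uminus)
  then have "half_system {a \<in> X. rep a = a}"
    unfolding half_system_def using neg_X by blast
  then show ?thesis by blast
qed

lemma uminus_half_system_Diff:
  assumes "half_system H" "half_system K"
  shows "uminus ` (H - K) = K - H"
proof (intro equalityI subsetI)
  fix a assume a_in_diff: "a \<in> K - H"
  then have "a \<in> X" using half_system_subset_X[OF assms(2)] by blast
  then have "- a \<in> H - K" using a_in_diff assms half_system_uminus_iff by blast
  then show "a \<in> uminus ` (H - K)" by (intro image_eqI[of _ _ "- a"]) auto
qed (use assms half_system_subset_X half_system_uminus_iff in blast)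

lemma card_half_system_Diff_commute:
  assumes "half_system H" "half_system K"
  shows "card (K - H) = card (H - K)"
  unfolding uminus_half_system_Diff[OF assms, symmetric] by (simp add: card_image)

lemma sum_half_system:
  assumes "half_system H" "half_system K"
  shows "\<Sum>K = \<Sum>H - 2 *\<^sub>R \<Sum>(H - K)"
proof -
  have fin: "finite H" "finite K" using assms finite_half_system by auto
  have "\<Sum>(K - H) = - \<Sum>(H - K)"
    unfolding uminus_half_system_Diff[OF assms, symmetric] by (simp add: sum.reindex sum_negf)
  moreover have "\<Sum>K = \<Sum>(K \<inter> H) + \<Sum>(K - H)" "\<Sum>H = \<Sum>(K \<inter> H) + \<Sum>(H - K)"
    using sum.Int_Diff[of K id H] sum.Int_Diff[of H id K] fin by (simp_all add: Int_commute)
  ultimately show ?thesis by (simp add: scaleR_2)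
qed

lemma even_card_half_system_Diff_trans:
  assumes half_H: "half_system H" and half_K: "half_system K" and half_L: "half_system L"
    and even: "even (card (H - K))" "even (card (K - L))"
  shows "even (card (H - L))"
proof -
  have fin: "finite H" "finite K" using half_H half_K finite_half_system by auto
  have "uminus ` ((H - K) \<inter> L) = K - L - H"
  proof (intro equalityI subsetI)
    fix a assume a_in_diff: "a \<in> K - L - H"
    then have "a \<in> X" using half_system_subset_X[OF half_K] by blast
    then have "- a \<in> (H - K) \<inter> L"
      using a_in_diff half_H half_K half_L half_system_uminus_iff by blast
    then show "a \<in> uminus ` ((H - K) \<inter> L)" by (intro image_eqI[of _ _ "- a"]) auto
  qed (use half_H half_K half_L half_system_subset_X half_system_uminus_iff in blast)
  then have "card ((H - K) \<inter> L) = card (K - L - H)"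
    using card_image[of uminus "(H - K) \<inter> L"] by simp
  moreover have "card (H - K) = card ((H - K) \<inter> L) + card (H - K - L)"
    and "card (K - L) = card ((K - L) \<inter> H) + card (K - L - H)"
    using fin by (simp_all add: card_Int_Diff)
  moreover have "(H - L) \<inter> K = (K - L) \<inter> H" "H - L - K = H - K - L" by blast+
  then have "card (H - L) = card ((K - L) \<inter> H) + card (H - K - L)"
    using fin card_Int_Diff[of "H - L" K] by simp
  ultimately show ?thesis using even by presburger
qed

lemma orthogonal_image_X:
  assumes "orthogonal_transformation w" "w ` X \<subseteq> X"
  shows "w ` X = X"
  using assms finite_X orthogonal_transformation_inj
  by (intro endo_inj_surj) (auto intro: inj_on_subset)

lemma half_system_image:
  assumes orth_w: "orthogonal_transformation w" "w ` X \<subseteq> X" and half_H: "half_system H"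
  shows "half_system (w ` H)"
  unfolding half_system_def
proof (intro conjI ballI)
  show "w ` H \<subseteq> X" using orth_w(2) half_system_subset_X[OF half_H] by blast
  fix b assume "b \<in> X"
  then obtain a where a_preimage: "a \<in> X" "b = w a" using orthogonal_image_X[OF orth_w] by blast
  have "- b = w (- a)"
    using a_preimage orth_w(1) by (simp add: orthogonal_transformation_linear linear_neg)
  then show "b \<in> w ` H \<longleftrightarrow> - b \<notin> w ` H"
    using a_preimage half_system_uminus_iff[OF half_H a_preimage(1)]
      orthogonal_transformation_inj[OF orth_w(1)]
    by (simp add: inj_image_mem_iff)
qed

subsection \<open>The group of even signed permutations\<close>

definition W :: "('a \<Rightarrow> 'a) set" where
  "W = {w. orthogonal_transformation w \<and> w ` X \<subseteq> X \<and> (\<forall>H. half_system H \<longrightarrow> even (card (w ` H - H)))}"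

lemma W_orth: "w \<in> W \<Longrightarrow> orthogonal_transformation w"
  and W_image_X: "w \<in> W \<Longrightarrow> w ` X \<subseteq> X"
  and W_even: "w \<in> W \<Longrightarrow> half_system H \<Longrightarrow> even (card (w ` H - H))"
  by (simp_all add: W_def)

lemma W_linear: "w \<in> W \<Longrightarrow> linear w" and W_bij: "w \<in> W \<Longrightarrow> bij w" and W_inj: "w \<in> W \<Longrightarrow> inj w"
  using W_orth orthogonal_transformation_linear orthogonal_transformation_bij bij_is_inj by auto

lemma W_inj_on: "w \<in> W \<Longrightarrow> inj_on w A"
  using W_inj inj_on_subset by blast

lemma W_X: "w \<in> W \<Longrightarrow> a \<in> X \<Longrightarrow> w a \<in> X"
  using W_image_X by blast

lemma W_neg: "w \<in> W \<Longrightarrow> w (- a) = - w a"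
  by (simp add: W_linear linear_neg)

lemma W_finv_left [simp]: "w \<in> W \<Longrightarrow> finv w (w a) = a"
  by (simp add: W_inj)

lemma W_finv_right [simp]: "w \<in> W \<Longrightarrow> w (finv w a) = a"
  by (simp add: W_bij bij_is_surj surj_f_inv_f)

lemma W_eq_iff: "w \<in> W \<Longrightarrow> w a = w b \<longleftrightarrow> a = b"
  by (metis W_finv_left)

lemma W_mem_image_iff: "w \<in> W \<Longrightarrow> w ` A = A \<Longrightarrow> w a \<in> A \<longleftrightarrow> a \<in> A"
  by (metis W_eq_iff image_iff)

lemma half_system_W_image: "w \<in> W \<Longrightarrow> half_system H \<Longrightarrow> half_system (w ` H)"
  using half_system_image W_orth W_image_X by blast

lemma W_roots:
  assumes w_in_W: "w \<in> W" and r_root: "r \<in> roots"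
  shows "w r \<in> roots"
proof -
  obtain a b where r_eq: "a \<in> X" "b \<in> X" "b \<noteq> a" "b \<noteq> - a" "r = a - b" using r_root by (rule rootE)
  have "w r = w a - w b" using r_eq(5) W_linear[OF w_in_W] by (simp add: linear_diff)
  moreover have "w b \<noteq> w a" "w b \<noteq> - w a"
    using r_eq W_eq_iff[OF w_in_W] W_neg[OF w_in_W, of a] by metis+
  ultimately show ?thesis using r_eq W_X[OF w_in_W] by (simp add: rootI)
qed

lemma W_id: "id \<in> W"
  by (simp add: W_def orthogonal_transformation_def linear_id)

lemma W_comp:
  assumes v_in_W: "v \<in> W" and w_in_W: "w \<in> W"
  shows "v \<circ> w \<in> W"
  unfolding W_def
proof (intro CollectI conjI allI impI)
  show "orthogonal_transformation (v \<circ> w)"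
    using v_in_W w_in_W W_orth by (intro orthogonal_transformation_compose) auto
  show "(v \<circ> w) ` X \<subseteq> X" using v_in_W w_in_W W_X by auto
  fix H assume half_H: "half_system H"
  have "v ` (w ` H) - v ` H = v ` (w ` H - H)" using W_inj[OF v_in_W] by (simp add: image_set_diff)
  then have "even (card (v ` (w ` H) - v ` H))"
    using W_even[OF w_in_W half_H] card_image[OF W_inj_on[OF v_in_W]] by simp
  then have "even (card (v ` (w ` H) - H))"
    using W_even[OF v_in_W half_H] half_H half_system_W_image[OF v_in_W]
      half_system_W_image[OF w_in_W]
    by (intro even_card_half_system_Diff_trans[of "v ` (w ` H)" "v ` H" H]) auto
  then show "even (card ((v \<circ> w) ` H - H))" by (simp add: image_comp)
qed

lemma W_finv:
  assumes w_in_W: "w \<in> W"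
  shows "finv w \<in> W"
  unfolding W_def
proof (intro CollectI conjI allI impI)
  show "orthogonal_transformation (finv w)"
    using W_orth[OF w_in_W] by (rule orthogonal_transformation_inv)
  have "w ` X = X" using orthogonal_image_X W_orth[OF w_in_W] W_image_X[OF w_in_W] by blast
  then show "finv w ` X \<subseteq> X" using w_in_W by (metis W_finv_left image_subsetI imageE)
  fix H assume half_H: "half_system H"
  have "w ` (finv w ` H - H) = H - w ` H"
    using W_inj[OF w_in_W] w_in_W by (simp add: image_set_diff image_image)
  then have "card (finv w ` H - H) = card (H - w ` H)"
    using card_image[OF W_inj_on[OF w_in_W]] by metis
  then show "even (card (finv w ` H - H))"
    using card_half_system_Diff_commute[OF half_H half_system_W_image[OF w_in_W half_H]]
      W_even[OF w_in_W half_H]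
    by simp
qed

lemma W_funpow: "w \<in> W \<Longrightarrow> w ^^ k \<in> W"
proof (induction k)
  case (Suc k)
  then show ?case using W_comp[of w "w ^^ k"] by (simp add: o_def)
qed (use W_id in \<open>simp add: id_def\<close>)

lemma W_reflection:
  assumes "r \<in> roots"
  shows "orthogonal_reflection r \<in> W"
proof -
  obtain a b where r_eq: "a \<in> X" "b \<in> X" "b \<noteq> a" "b \<noteq> - a" "r = a - b"
    using assms by (rule rootE)
  let ?s = "orthogonal_reflection r"
  note act = root_reflection_X[OF r_eq(1-4), folded r_eq(5)]
  have inj: "inj ?s"
    using orthogonal_transformation_inj orthogonal_transformation_reflection by blast
  have "even (card (?s ` H - H))" if half_H: "half_system H" for H
  proof -
    note neg_iff = half_system_uminus_iff[OF half_H r_eq(1)] half_system_uminus_iff[OF half_H r_eq(2)]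
    have moves: "?s h \<notin> H \<longleftrightarrow> h \<in> {a, b, - a, - b} \<and> (a \<in> H \<longleftrightarrow> b \<notin> H)" if "h \<in> H" for h
      using that act[OF subsetD[OF half_system_subset_X[OF half_H] that]] neg_iff
      by (auto split: if_splits)
    consider (same) "a \<in> H \<longleftrightarrow> b \<in> H" | (left) "a \<in> H" "b \<notin> H" | (right) "a \<notin> H" "b \<in> H" by blast
    then have "even (card {h \<in> H. ?s h \<notin> H})"
    proof cases
      case same
      then have "{h \<in> H. ?s h \<notin> H} = {}" using moves by blast
      then show ?thesis by (simp only: card.empty) simp
    next
      case left
      then have "{h \<in> H. ?s h \<notin> H} = {a, - b}" using moves neg_iff by blast
      then show ?thesis using r_eq(4) by (simp add: equation_minus_iff)
    next
      case right
      then have "{h \<in> H. ?s h \<notin> H} = {b, - a}" using moves neg_iff by blast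
      then show ?thesis using r_eq(4) by simp
    qed
    moreover have "?s ` H - H = ?s ` {h \<in> H. ?s h \<notin> H}" by blast
    ultimately show ?thesis using card_image[OF inj_on_subset[OF inj subset_UNIV]] by simp
  qed
  moreover have "?s x \<in> X" if "x \<in> X" for x using act[OF that] r_eq neg_X that by simp
  ultimately show ?thesis
    unfolding W_def using orthogonal_transformation_reflection by auto
qed

text \<open>By parity an even signed permutation cannot flip exactly one element of a half system.\<close>

lemma W_half_system_invariantI:
  assumes w_in_W: "w \<in> W" and half_H: "half_system H" and "\<And>h. h \<in> H \<Longrightarrow> h \<noteq> z \<Longrightarrow> w h \<in> H"
  shows "w ` H = H"
proof -
  have "w ` H - H \<subseteq> {w z}" using assms(3) by blast
  then have "w ` H - H = {} \<or> w ` H - H = {w z}" by (rule subset_singletonD)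
  then have "w ` H \<subseteq> H" using W_even[OF w_in_W half_H] by auto
  then show ?thesis
    using finite_half_system[OF half_H] W_inj_on[OF w_in_W] by (intro endo_inj_surj)
qed

lemma W_eq_idI:
  assumes w_in_W: "w \<in> W" and fixed: "\<And>a. a \<in> X \<Longrightarrow> a \<noteq> z \<Longrightarrow> a \<noteq> - z \<Longrightarrow> w a = a"
  shows "w = id"
proof (rule linear_eq_on_X[OF W_linear[OF w_in_W] linear_id])
  obtain H where half_H: "half_system H" using ex_half_system by blast
  define y where "y = (if z \<in> H then z else - z)"
  have H_invariant: "w ` H = H"
  proof (rule W_half_system_invariantI[OF w_in_W half_H, of y])
    fix h assume h_in_H: "h \<in> H" "h \<noteq> y"
    then have "h \<in> X" using half_system_subset_X[OF half_H] by blast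
    moreover have "h \<noteq> z" using h_in_H by (auto simp: y_def)
    moreover have "h \<noteq> - z"
      using h_in_H half_system_uminus_iff[OF half_H \<open>h \<in> X\<close>] unfolding y_def by (metis minus_minus)
    ultimately show "w h \<in> H" using fixed[of h] h_in_H(1) by metis
  qed
  fix a assume a_in_X: "a \<in> X"
  show "w a = id a"
  proof (rule ccontr)
    assume neq: "w a \<noteq> id a"
    then have "w a = z \<or> w a = - z"
      using fixed[OF W_X[OF w_in_W a_in_X]] W_eq_iff[OF w_in_W, of "w a" a] by auto
    moreover have "a = z \<or> a = - z" using neq fixed[OF a_in_X] by auto
    ultimately have "w a = - a" using neq by (auto simp: equation_minus_iff)
    then show False
      using W_mem_image_iff[OF w_in_W H_invariant, of a] half_system_uminus_iff[OF half_H a_in_X]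
      by simp
  qed
qed

lemma W_sum_image: "w \<in> W \<Longrightarrow> w (\<Sum>A) = \<Sum>(w ` A)"
  using linear_sum[OF W_linear, of w "\<lambda>a. a" A]
    sum.reindex[OF W_inj_on, of w "\<lambda>a. a" A]
  by (simp add: comp_def)

lemma W_fixes_sum_iff:
  assumes w_in_W: "w \<in> W" and A_consistent: "consistent A"
  shows "w (\<Sum>A) = \<Sum>A \<longleftrightarrow> w ` A = A"
proof
  have A_subset_X: "A \<subseteq> X" and fin: "finite A"
    using A_consistent finite_X finite_subset by (auto simp: consistent_def)
  have inj: "inj_on w A" using w_in_W by (rule W_inj_on)
  show "w (\<Sum>A) = \<Sum>A" if "w ` A = A" using W_sum_image[OF w_in_W, of A] that by simp
  assume sum_fixed: "w (\<Sum>A) = \<Sum>A"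
  have "w a \<in> A" if a_in_A: "a \<in> A" for a
  proof -
    have "w a \<bullet> \<Sum>A = w a \<bullet> w (\<Sum>A)" using sum_fixed by simp
    also have "\<dots> = a \<bullet> \<Sum>A" using W_orth[OF w_in_W] by (simp add: orthogonal_transformation_def)
    also have "\<dots> = 1" using inner_sum_X[OF A_consistent, of a] a_in_A A_subset_X by auto
    finally show ?thesis
      using inner_sum_X[OF A_consistent, of "w a"] a_in_A A_subset_X W_X[OF w_in_W]
      by (auto split: if_splits)
  qed
  then show "w ` A = A" using fin inj by (intro endo_inj_surj) auto
qed

lemma W_invariant_mono:
  assumes "v \<in> W" "w \<in> W" "fixspace v \<subseteq> fixspace w" "consistent A" "v ` A = A"
  shows "w ` A = A"
  using assms W_fixes_sum_iff by (metis fixspace_iff subsetD)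

subsection \<open>The absolute order\<close>

definition G :: "('a \<Rightarrow> 'a) monoid" where
  "G = \<lparr>carrier = W, monoid.mult = (\<circ>), one = id\<rparr>"

definition T :: "('a \<Rightarrow> 'a) set" where
  "T = orthogonal_reflection ` roots"

lemma mult_G: "v \<otimes>\<^bsub>G\<^esub> w = v \<circ> w" and one_G: "\<one>\<^bsub>G\<^esub> = id" and carrier_G: "carrier G = W"
  by (simp_all add: G_def)

lemma group_G: "group G"
proof (rule groupI)
  fix w assume "w \<in> carrier G"
  then show "\<exists>y\<in>carrier G. y \<otimes>\<^bsub>G\<^esub> w = \<one>\<^bsub>G\<^esub>"
    using W_finv by (intro bexI[of _ "finv w"]) (auto simp: G_def fun_eq_iff)
qed (auto simp: G_def W_comp W_id o_assoc)

lemma inv_G: "w \<in> W \<Longrightarrow> inv\<^bsub>G\<^esub> w = finv w"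
  using W_finv by (intro group.inv_equality[OF group_G]) (auto simp: G_def fun_eq_iff)

lemma pow_G: "w [^]\<^bsub>G\<^esub> (k::nat) = w ^^ k"
proof -
  have "monoid G" using group_G by (rule group.is_monoid)
  note pow = monoid.nat_pow_0[OF this] monoid.nat_pow_Suc[OF this]
  show ?thesis
    by (induction k) (simp_all add: pow one_G mult_G funpow_Suc_right id_def del: funpow.simps)
qed

lemma W_two_sign_changes:
  assumes w_not_id: "w \<in> W" "w \<noteq> id" and signs: "\<And>a. a \<in> X \<Longrightarrow> w a = a \<or> w a = - a"
  obtains a b where "a \<in> X" "b \<in> X" "b \<noteq> a" "b \<noteq> - a" "w a = - a" "w b = - b"
proof -
  obtain H where half_H: "half_system H" using ex_half_system by blast
  have changed: "a \<in> X \<and> w a = - a" if a_in_diff: "a \<in> w ` H - H" for a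
  proof -
    obtain h where h_preimage: "h \<in> H" "a = w h" "w h \<notin> H" using a_in_diff by blast
    have "h \<in> X" using h_preimage(1) half_system_subset_X[OF half_H] by blast
    moreover from this have "w h = - h" using signs[of h] h_preimage by metis
    ultimately show ?thesis using h_preimage neg_X W_neg[OF w_not_id(1)] by simp
  qed
  have "w ` H - H \<noteq> {}"
  proof
    assume "w ` H - H = {}"
    then have "w h = h" if "h \<in> H" for h
      using that signs[of h] half_system_subset_X[OF half_H] half_system_uminus_iff[OF half_H, of h]
      by (metis Diff_eq_empty_iff image_subset_iff subsetD)
    then have "w a = a" if "a \<in> X" for a
      using half_system_uminus_iff[OF half_H that] W_neg[OF w_not_id(1), of a]
      by (metis neg_equal_iff_equal)
    then show False using W_eq_idI[OF w_not_id(1)] w_not_id(2) by blast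
  qed
  then obtain a where a_in_diff: "a \<in> w ` H - H" by blast
  moreover have "w ` H - H \<noteq> {a}" using W_even[OF w_not_id(1) half_H] by auto
  ultimately obtain b where b_in_diff: "b \<in> w ` H - H" "b \<noteq> a" by blast
  have "- a \<notin> w ` H"
    using a_in_diff changed half_system_uminus_iff[OF half_system_W_image[OF w_not_id(1) half_H]]
    by blast
  then have "b \<noteq> - a" using b_in_diff(1) by blast
  then show thesis using that[of a b] a_in_diff b_in_diff changed by blast
qed

lemma ex_root_movspace:
  assumes w_not_id: "w \<in> W" "w \<noteq> id"
  shows "\<exists>b\<in>roots. b \<in> movspace w"
proof (cases "\<exists>a\<in>X. w a \<noteq> a \<and> w a \<noteq> - a")
  case True
  then obtain a where a_moved: "a \<in> X" "w a \<noteq> a" "w a \<noteq> - a" by blast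
  then have "w a - a \<in> roots"
    using W_X[OF w_not_id(1)] by (intro rootI) (auto simp: equation_minus_iff)
  then show ?thesis using movspaceI by blast
next
  case False
  then obtain a b where ab_flipped: "a \<in> X" "b \<in> X" "b \<noteq> a" "b \<noteq> - a" "w a = - a" "w b = - b"
    using W_two_sign_changes[OF w_not_id] by metis
  have "w (a - b) - (a - b) = (-2) *\<^sub>R (a - b)"
    using ab_flipped(5,6)
    by (simp add: linear_diff[OF W_linear[OF w_not_id(1)]] algebra_simps scaleR_2)
  then have "a - b \<in> movspace w"
    using movspace_scaleRI[OF W_linear[OF w_not_id(1)], of "a - b" "-2" "a - b"] by simp
  then show ?thesis using rootI[OF ab_flipped(1-4)] by blast
qed

lemma ex_reflection_factorization:
  assumes "w \<in> W"
  shows "\<exists>bs. set bs \<subseteq> roots \<inter> movspace w \<and> length bs = dim (movspace w) \<and>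
              foldr (\<circ>) (map orthogonal_reflection bs) id = w"
  using assms
proof (induction "dim (movspace w)" arbitrary: w rule: less_induct)
  case less
  show ?case
  proof (cases "w = id")
    case True
    then show ?thesis by (intro exI[of _ "[]"]) (simp add: movspace_id)
  next
    case False
    then obtain b where b_root: "b \<in> roots" "b \<in> movspace w"
      using ex_root_movspace less.prems by blast
    let ?s = "orthogonal_reflection b"
    have sw_in_W: "?s \<circ> w \<in> W" using b_root less.prems W_reflection W_comp by blast
    have dim: "dim (movspace (?s \<circ> w)) + 1 = dim (movspace w)"
      using dim_movspace_reflection_comp W_orth[OF less.prems] b_root roots_nonzero by blast
    then obtain bs where bs: "set bs \<subseteq> roots \<inter> movspace (?s \<circ> w)"
        "length bs = dim (movspace (?s \<circ> w))"
        "foldr (\<circ>) (map orthogonal_reflection bs) id = ?s \<circ> w"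
      using less.hyps[OF _ sw_in_W] by auto
    have "movspace (?s \<circ> w) \<subseteq> movspace w"
      using fixspace_reflection_comp_subset[OF W_orth[OF less.prems] b_root(2)]
        movspace_subset_iff[OF W_orth[OF less.prems] W_orth[OF sw_in_W]] by blast
    moreover have "foldr (\<circ>) (map orthogonal_reflection (b # bs)) id = w"
      using bs(3) by (simp add: fun_eq_iff orthogonal_reflection_involution)
    ultimately show ?thesis
      using bs b_root dim by (intro exI[of _ "b # bs"]) auto
  qed
qed

lemma movspace_subset_span_roots:
  assumes "w \<in> W"
  shows "movspace w \<subseteq> span (roots \<inter> movspace w)"
proof -
  define F where "F as = foldr (\<circ>) (map orthogonal_reflection as) id" for as :: "'a list"
  obtain bs where bs: "set bs \<subseteq> roots \<inter> movspace w" "F bs = w"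
    using ex_reflection_factorization[OF assms] unfolding F_def by blast
  have "F bs x - x \<in> span (set bs)" for x
  proof (induction bs)
    case (Cons b bs)
    have "F bs x - x \<in> span (set (b # bs))"
      using Cons span_mono[of "set bs" "set (b # bs)"] by (meson set_subset_Cons subsetD)
    moreover have "orthogonal_reflection b (F bs x) - F bs x \<in> span (set (b # bs))"
      by (simp add: orthogonal_reflection_def span_neg span_scale span_base)
    ultimately have "(orthogonal_reflection b (F bs x) - F bs x) + (F bs x - x) \<in> span (set (b # bs))"
      by (rule span_add[rotated])
    then show ?case by (simp add: F_def)
  qed (simp add: F_def span_zero)
  then show ?thesis using bs span_mono[OF bs(1)] by (auto elim!: movspaceE)
qed

lemma W_induct [consumes 1, case_names id reflection]:
  assumes w_in_W: "w \<in> W" and id: "P id"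
    and reflection: "\<And>b v. b \<in> roots \<Longrightarrow> P v \<Longrightarrow> P (orthogonal_reflection b \<circ> v)"
  shows "P w"
proof -
  define F where "F bs = foldr (\<circ>) (map orthogonal_reflection bs) id" for bs :: "'a list"
  have F_rec: "F [] = id" "F (b # bs) = orthogonal_reflection b \<circ> F bs" for b bs
    by (simp_all add: F_def)
  obtain bs where bs: "set bs \<subseteq> roots" "F bs = w"
    using ex_reflection_factorization[OF w_in_W] unfolding F_def by blast
  from bs(1) have "P (F bs)"
  proof (induction bs)
    case (Cons b bs)
    then show ?case unfolding F_rec by (intro reflection) auto
  qed (simp only: F_rec id)
  then show ?thesis using bs(2) by simp
qed

lemma dim_movspace_foldr_le:
  assumes "set ts \<subseteq> T"
  shows "dim (movspace (foldr (\<circ>) ts id)) \<le> length ts"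
proof -
  define F where "F us = foldr (\<circ>) us (id :: 'a \<Rightarrow> 'a)" for us
  have F_rec: "F [] = id" "F (u # us) = u \<circ> F us" for u us by (simp_all add: F_def)
  have "linear (F ts) \<and> dim (movspace (F ts)) \<le> length ts"
    using assms
  proof (induction ts)
    case (Cons t ts)
    then obtain b where b_root: "b \<in> roots" "t = orthogonal_reflection b" by (auto simp: T_def)
    then have "dim (movspace t) = 1" "linear t"
      using dim_movspace_reflection roots_nonzero orthogonal_reflection_linear by blast+
    then show ?case
      using Cons dim_movspace_comp_le[of t "F ts"] linear_compose[of "F ts" t]
      by (simp add: F_rec o_def)
  qed (simp add: F_rec movspace_id linear_id)
  then show ?thesis by (simp add: F_def)
qed

lemma reflection_length_eq:
  assumes "w \<in> W"
  shows "reflection_length G T w = dim (movspace w)"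
  unfolding reflection_length_def
proof (rule Least_equality)
  obtain bs where "set bs \<subseteq> roots \<inter> movspace w" "length bs = dim (movspace w)"
      "foldr (\<circ>) (map orthogonal_reflection bs) id = w"
    using ex_reflection_factorization[OF assms] by blast
  then show "\<exists>ts. set ts \<subseteq> T \<and> length ts = dim (movspace w) \<and> foldr (\<otimes>\<^bsub>G\<^esub>) ts \<one>\<^bsub>G\<^esub> = w"
    by (intro exI[of _ "map orthogonal_reflection bs"]) (auto simp: T_def G_def)
next
  fix k assume "\<exists>ts. set ts \<subseteq> T \<and> length ts = k \<and> foldr (\<otimes>\<^bsub>G\<^esub>) ts \<one>\<^bsub>G\<^esub> = w"
  then show "dim (movspace w) \<le> k" using dim_movspace_foldr_le by (auto simp: G_def)
qed

lemma absolute_le_iff: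
  assumes "v \<in> W" "w \<in> W"
  shows "absolute_le G T v w \<longleftrightarrow> v \<preceq> w"
  using assms W_comp[OF _ W_finv]
  by (auto simp: absolute_le_def isometry_le_def inv_G mult_G reflection_length_eq)

lemma reflections_le_iff:
  assumes v_in_W: "v \<in> W" and w_in_W: "w \<in> W"
  shows "(\<forall>t\<in>T. absolute_le G T t w \<longrightarrow> absolute_le G T t v) \<longleftrightarrow> fixspace v \<subseteq> fixspace w"
proof -
  have "absolute_le G T (orthogonal_reflection b) u \<longleftrightarrow> b \<in> movspace u" if "b \<in> roots" "u \<in> W" for b u
    using that absolute_le_iff[OF W_reflection] reflection_isometry_le_iff[OF W_orth roots_nonzero]
    by simp
  then have "(\<forall>t\<in>T. absolute_le G T t w \<longrightarrow> absolute_le G T t v) \<longleftrightarrow> roots \<inter> movspace w \<subseteq> movspace v"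
    using v_in_W w_in_W by (auto simp: T_def)
  also have "\<dots> \<longleftrightarrow> movspace w \<subseteq> movspace v"
  proof
    assume "roots \<inter> movspace w \<subseteq> movspace v"
    then have "span (roots \<inter> movspace w) \<subseteq> movspace v"
      using v_in_W W_linear subspace_movspace by (intro span_minimal) auto
    then show "movspace w \<subseteq> movspace v" using movspace_subset_span_roots[OF w_in_W] by blast
  qed auto
  also have "\<dots> \<longleftrightarrow> fixspace v \<subseteq> fixspace w" using v_in_W w_in_W W_orth movspace_subset_iff by blast
  finally show ?thesis .
qed

lemma carrier_NC:
  assumes "c \<in> W"
  shows "carrier (NC G T c) = {v \<in> W. v \<preceq> c}"
  using assms absolute_le_iff[OF W_id] absolute_le_iff[OF _ assms]
  by (auto simp: NC_def carrier_G one_G id_isometry_le)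

lemma nc_projection_eqI:
  assumes c_in_W: "c \<in> W" "movspace c = UNIV" and w_in_W: "w \<in> W"
    and v_below: "v \<in> W" "v \<preceq> c" "fixspace v \<subseteq> fixspace w"
    and max: "\<And>u. u \<in> W \<Longrightarrow> u \<preceq> c \<Longrightarrow> fixspace u \<subseteq> fixspace w \<Longrightarrow> fixspace u \<subseteq> fixspace v"
  shows "nc_projection G T c w = v"
proof -
  let ?L = "NC G T c" and ?A = "{t \<in> T. absolute_le G T t w}"
  have le_iff: "x \<sqsubseteq>\<^bsub>?L\<^esub> y \<longleftrightarrow> absolute_le G T x y" for x y by (simp add: NC_def)
  have "T \<subseteq> carrier ?L"
    using reflection_isometry_le_iff[OF W_orth[OF c_in_W(1)]] roots_nonzero W_reflection
    unfolding carrier_NC[OF c_in_W(1)] by (auto simp: T_def c_in_W(2))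
  then have Upper: "Upper ?L ?A = {u \<in> W. u \<preceq> c \<and> fixspace u \<subseteq> fixspace w}"
    using reflections_le_iff[OF _ w_in_W] carrier_NC[OF c_in_W(1)] unfolding Upper_def le_iff
    by blast
  have "least ?L v (Upper ?L ?A)"
    unfolding least_def Upper carrier_NC[OF c_in_W(1)] le_iff
  proof (intro conjI ballI)
    fix u assume u_below: "u \<in> {u \<in> W. u \<preceq> c \<and> fixspace u \<subseteq> fixspace w}"
    then have "v \<preceq> u"
      using max v_below c_in_W(1) W_orth by (intro isometry_le_antimono_fixspace[of v u c]) auto
    then show "absolute_le G T v u" using absolute_le_iff u_below v_below(1) by blast
  qed (use v_below in auto)
  moreover have "u = v" if "least ?L u (Upper ?L ?A)" for u
  proof (rule isometry_le_eqI)
    have u_below: "u \<in> W" "u \<preceq> c" "fixspace u \<subseteq> fixspace w" and u_le_v: "absolute_le G T u v"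
      using that v_below unfolding least_def Upper le_iff by auto
    show "orthogonal_transformation u" "orthogonal_transformation v"
      using u_below v_below W_orth by auto
    show "u \<preceq> v" using u_le_v u_below(1) v_below(1) absolute_le_iff by blast
    show "movspace v \<subseteq> movspace u"
      using max[OF u_below] u_below(1) v_below(1) W_orth movspace_subset_iff by blast
  qed
  ultimately show ?thesis
    unfolding nc_projection_def sup_def by (rule someI2[of "\<lambda>u. least ?L u (Upper ?L ?A)"])
qed

end

section \<open>The Coxeter element and its arcs\<close>

locale D_coxeter = signed_basis X for X :: "'a::euclidean_space set" +
  fixes m :: int and E :: "int \<Rightarrow> 'a" and z :: 'a and c :: "'a \<Rightarrow> 'a"
  assumes m_ge: "m \<ge> 2"
    and X_eq: "X = range E \<union> {z, - z}"
    and E_add_m: "E (i + m) = - E i"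
    and E_inj: "E i = E j \<Longrightarrow> 2 * m dvd i - j"
    and z_notin: "z \<notin> range E"
    and c_W: "c \<in> W"
    and c_E: "c (E i) = E (i + 1)"
begin

lemma E_X [simp]: "E i \<in> X" and z_X: "z \<in> X" and neg_z_X: "- z \<in> X"
  by (auto simp: X_eq)

lemma centre_X: "y \<in> {z, - z} \<Longrightarrow> y \<in> X"
  using z_X neg_z_X by auto

lemma E_sub_m: "E (i - m) = - E i"
  using E_add_m[of "i - m"] by simp

lemma E_add_2m: "E (i + 2 * m) = E i"
  using E_add_m[of "i + m"] E_add_m[of i] by (simp add: algebra_simps)

lemma E_add_mult: "E (i + 2 * m * k) = E i"
proof (induction k rule: int_induct[where k = 0])
  case (step1 k)
  then show ?case using E_add_2m[of "i + 2 * m * k"] by (simp add: algebra_simps)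
next
  case (step2 k)
  then show ?case using E_add_2m[of "i + 2 * m * (k - 1)"] by (simp add: algebra_simps)
qed simp

lemma E_eq_imp_eq: "E i = E j \<Longrightarrow> \<bar>i - j\<bar> < 2 * m \<Longrightarrow> i = j"
  using E_inj[of i j] zdvd_imp_le[of "2 * m" "\<bar>i - j\<bar>"] by (cases "i = j") auto

lemma E_normalize:
  obtains k where "E i = E k" "j \<le> k" "k < j + 2 * m"
proof
  let ?k = "j + (i - j) mod (2 * m)"
  have "i = ?k + 2 * m * ((i - j) div (2 * m))"
    using minus_mod_eq_mult_div[of "i - j" "2 * m"] by (simp add: algebra_simps)
  then show "E i = E ?k" using E_add_mult by metis
  show "j \<le> ?k" "?k < j + 2 * m" using m_ge by simp_all
qed

lemma E_neq_centre: "y \<in> {z, - z} \<Longrightarrow> E i \<noteq> y"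
  using z_notin E_add_m[of i] by (metis insertE minus_minus rangeI singletonD)

lemma centre_eq_uminus: "x \<in> {z, - z} \<Longrightarrow> y \<in> {z, - z} \<Longrightarrow> x \<noteq> y \<Longrightarrow> x = - y"
  by auto

lemma X_cases:
  assumes "a \<in> X"
  obtains (circle) i where "a = E i" | (centre) "a \<in> {z, - z}"
  using assms by (auto simp: X_eq)

definition arc :: "int \<Rightarrow> int \<Rightarrow> 'a set" where
  "arc i j = E ` {i..<j}"

definition half :: "int \<Rightarrow> 'a \<Rightarrow> 'a set" where
  "half p y = insert y (arc p (p + m))"

definition segments :: "'a set set" where
  "segments = {arc p q | p q. p < q \<and> q < p + m} \<union> {half p y | p y. y \<in> {z, - z}}"

lemma finite_arc: "finite (arc i j)"
  by (simp add: arc_def)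

lemma arc_empty: "j \<le> i \<Longrightarrow> arc i j = {}"
  by (simp add: arc_def)

lemma arcI: "i \<le> k \<Longrightarrow> k < j \<Longrightarrow> E k \<in> arc i j"
  by (auto simp: arc_def)

lemma arcE:
  assumes "a \<in> arc i j"
  obtains k where "a = E k" "i \<le> k" "k < j"
  using assms by (auto simp: arc_def)

lemma E_mem_arc_iff:
  assumes "p \<le> k" "k < p + 2 * m" "q \<le> p + 2 * m"
  shows "E k \<in> arc p q \<longleftrightarrow> k < q"
proof
  assume "E k \<in> arc p q"
  then obtain l where l_window: "E k = E l" "p \<le> l" "l < q" by (rule arcE)
  then have "k = l" using assms by (intro E_eq_imp_eq) auto
  then show "k < q" using l_window by simp
qed (use assms arcI in simp)

lemma arc_Un: "p \<le> y \<Longrightarrow> y \<le> q \<Longrightarrow> arc p y \<union> arc y q = arc p q"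
  unfolding arc_def image_Un[symmetric] by (simp add: ivl_disj_un)

lemma arc_Int:
  assumes "j - p \<le> 2 * m" "q - i \<le> 2 * m"
  shows "arc i j \<inter> arc p q = arc (max i p) (min j q)"
proof (intro equalityI subsetI)
  fix a assume a_in_arcs: "a \<in> arc i j \<inter> arc p q"
  then obtain k where a_eq: "a = E k" "i \<le> k" "k < j" by (blast elim: arcE)
  obtain l where a_eq_l: "a = E l" "p \<le> l" "l < q" using a_in_arcs by (blast elim: arcE)
  have "k = l" using a_eq a_eq_l assms by (intro E_eq_imp_eq) auto
  then show "a \<in> arc (max i p) (min j q)" using a_eq a_eq_l by (simp add: arcI)
qed (auto simp: arc_def)

lemma centre_notin_arc: "y \<in> {z, - z} \<Longrightarrow> y \<notin> arc i j"
  using E_neq_centre by (auto elim!: arcE)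

lemma E_mem_half_iff:
  assumes "y \<in> {z, - z}" "p \<le> k" "k < p + 2 * m"
  shows "E k \<in> half p y \<longleftrightarrow> k < p + m"
  using assms E_neq_centre E_mem_arc_iff[of p k "p + m"] by (auto simp: half_def)

lemma consistent_arc:
  assumes "j \<le> i + m"
  shows "consistent (arc i j)"
  unfolding consistent_def
proof (intro conjI ballI)
  fix a assume "a \<in> arc i j"
  then obtain k where "a = E k" "i \<le> k" "k < j" by (rule arcE)
  then show "- a \<notin> arc i j" using assms m_ge E_mem_arc_iff[of i "k + m" j] by (simp add: E_add_m)
qed (auto simp: arc_def)

lemma half_system_half:
  assumes y_central: "y \<in> {z, - z}"
  shows "half_system (half p y)"
  unfolding half_system_def
proof (intro conjI ballI)
  show "half p y \<subseteq> X" using centre_X[OF y_central] by (auto simp: half_def arc_def)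
  fix a assume "a \<in> X"
  then show "a \<in> half p y \<longleftrightarrow> - a \<notin> half p y"
  proof (cases rule: X_cases)
    case (circle i)
    obtain k where k_window: "E i = E k" "p \<le> k" "k < p + 2 * m" by (rule E_normalize)
    show ?thesis
      using circle k_window m_ge E_mem_half_iff[OF y_central, of p k]
        E_mem_half_iff[OF y_central, of p "k + m"]
        E_mem_half_iff[OF y_central, of p "k - m"]
      by (cases "k < p + m") (auto simp: E_add_m E_sub_m)
  next
    case centre
    then have "- a \<in> {z, - z}" by auto
    then show ?thesis
      using centre centre_notin_arc y_central X_nonzero[OF z_X] by (auto simp: half_def)
  qed
qed

lemma consistent_half: "y \<in> {z, - z} \<Longrightarrow> consistent (half p y)"
  by (simp add: half_system_half half_system_consistent)

lemma centre_in_half: "y \<in> half p y"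
  by (simp add: half_def)

lemma uminus_centre_notin_half: "y \<in> {z, - z} \<Longrightarrow> - y \<notin> half p y"
  using half_system_half[of y p] centre_X[of y] unfolding half_system_def half_def by blast

lemma consistent_segment: "A \<in> segments \<Longrightarrow> consistent A"
  using consistent_arc consistent_half by (auto simp: segments_def)

lemma arc_segment: "p < q \<Longrightarrow> q < p + m \<Longrightarrow> arc p q \<in> segments"
  by (auto simp: segments_def)

lemma half_segment: "y \<in> {z, - z} \<Longrightarrow> half p y \<in> segments"
  unfolding segments_def by blast

lemma linear_c: "linear c" and orth_c: "orthogonal_transformation c"
  using c_W W_linear W_orth by auto

lemma c_sum_arc:
  assumes "i \<le> j" "j \<le> i + 2 * m"
  shows "c (\<Sum>(arc i j)) - \<Sum>(arc i j) = E j - E i"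
  using assms
proof (induction j rule: int_ge_induct)
  case base
  then show ?case using linear_c by (simp add: arc_empty linear_0)
next
  case (step j)
  have "{i..<j + 1} = insert j {i..<j}" using step.hyps by auto
  then have "arc i (j + 1) = insert (E j) (arc i j)" by (simp add: arc_def)
  moreover have "E j \<notin> arc i j" using step E_mem_arc_iff[of i j j] by simp
  ultimately show ?case
    using step linear_c by (simp add: finite_arc linear_add c_E algebra_simps)
qed

lemma c_centre:
  assumes y_central: "y \<in> {z, - z}"
  shows "c y = - y"
proof -
  have "c y \<in> {z, - z}"
    using W_X[OF c_W centre_X[OF y_central]]
  proof (cases rule: X_cases)
    case (circle i)
    then have "y = E (i - 1)" using c_E[of "i - 1"] W_eq_iff[OF c_W, of y "E (i - 1)"] by simp
    then show ?thesis using E_neq_centre[OF y_central] by metis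
  qed
  moreover have "c y \<noteq> y"
  proof
    assume c_fixes_y: "c y = y"
    let ?H = "half 0 y"
    have "c ` ?H = ?H"
    proof (rule W_half_system_invariantI[OF c_W half_system_half[OF y_central]])
      fix h assume h_in_H: "h \<in> ?H" "h \<noteq> E (m - 1)"
      show "c h \<in> ?H"
      proof (cases "h = y")
        case False
        then obtain k where h_eq: "h = E k" "0 \<le> k" "k < 0 + m"
          using h_in_H by (auto simp: half_def elim: arcE)
        then have "k \<noteq> m - 1" using h_in_H(2) by auto
        then show ?thesis using h_eq E_mem_half_iff[OF y_central, of 0 "k + 1"] by (simp add: c_E)
      qed (use c_fixes_y in \<open>simp add: centre_in_half\<close>)
    qed
    moreover have "E (m - 1) \<in> ?H" using m_ge E_mem_half_iff[OF y_central] by simp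
    ultimately have "E m \<in> ?H" using c_E[of "m - 1"] by (metis diff_add_cancel imageI)
    then show False using m_ge E_mem_half_iff[OF y_central, of 0 m] by simp
  qed
  ultimately show ?thesis using y_central by (intro centre_eq_uminus)
qed

lemma c_sum_half:
  assumes y_central: "y \<in> {z, - z}"
  shows "c (\<Sum>(half p y)) - \<Sum>(half p y) = (-2) *\<^sub>R (E p + y)"
proof -
  have "c (\<Sum>(arc p (p + m))) - \<Sum>(arc p (p + m)) = - E p - E p"
    using c_sum_arc[of p "p + m"] m_ge by (simp add: E_add_m)
  moreover have "\<Sum>(half p y) = y + \<Sum>(arc p (p + m))"
    using centre_notin_arc[OF y_central] by (simp add: half_def finite_arc)
  ultimately show ?thesis
    by (simp add: linear_add[OF linear_c] c_centre[OF y_central] algebra_simps scaleR_2)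
qed

lemma root_cases:
  assumes "b \<in> roots"
  obtains (arc) p q where "p < q" "q < p + m" "b = E q - E p"
    | (half) p y where "y \<in> {z, - z}" "b = E p + y"
proof -
  obtain x y where b_eq: "x \<in> X" "y \<in> X" "y \<noteq> x" "y \<noteq> - x" "b = x - y"
    using assms by (rule rootE)
  from b_eq(1) show thesis
  proof (cases rule: X_cases)
    case x: (circle j0)
    from b_eq(2) show thesis
    proof (cases rule: X_cases)
      case y: (circle i)
      obtain j where j_window: "E j0 = E j" "i \<le> j" "j < i + 2 * m" by (rule E_normalize)
      have "j \<noteq> i" "j \<noteq> i + m" using b_eq x y j_window E_add_m[of i] by auto
      then consider (near) "i < j" "j < i + m" | (far) "i + m < j" using j_window by linarith
      then show thesis
      proof cases
        case near
        then show thesis using arc[of i j] b_eq x y j_window by simp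
      next
        case far
        then show thesis
          using arc[of "j - m" "i + m"] b_eq x y j_window by (simp add: E_add_m E_sub_m)
      qed
    next
      case y: centre
      then show thesis using half[of "- y" j0] b_eq x by auto
    qed
  next
    case x: centre
    then obtain i where "y = E i" using b_eq by (auto elim: X_cases)
    then show thesis using half[OF x, of "i + m"] b_eq by (simp add: E_add_m)
  qed
qed

lemma root_segment:
  assumes "b \<in> roots"
  obtains A k where "A \<in> segments" "k \<noteq> 0" "c (\<Sum>A) - \<Sum>A = k *\<^sub>R b"
  using assms
proof (cases rule: root_cases)
  case (arc p q)
  then show thesis using that[of "arc p q" 1] arc_segment[of p q] c_sum_arc[of p q] m_ge by simp
next
  case (half p y)
  then show thesis using that[of "half p y" "-2"] half_segment[of y p] c_sum_half[of y p] by simp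
qed

subsection \<open>The shape of the elements below \<open>c\<close>\<close>

definition noncrossing :: "('a \<Rightarrow> 'a) \<Rightarrow> bool" where
  "noncrossing v \<longleftrightarrow> v \<in> W \<and> v \<preceq> c"

lemma noncrossing_W: "noncrossing v \<Longrightarrow> v \<in> W"
  and noncrossing_le: "noncrossing v \<Longrightarrow> v \<preceq> c"
  by (simp_all add: noncrossing_def)

lemma noncrossing_invariantI:
  assumes "noncrossing v" "consistent A" "c (\<Sum>A) - \<Sum>A = c x - v x"
  shows "v ` A = A"
proof -
  note v_in_W = noncrossing_W[OF assms(1)]
  have "v (\<Sum>A) = \<Sum>A"
    using isometry_le_fixes_iff[OF W_orth[OF v_in_W] orth_c noncrossing_le[OF assms(1)]] assms(3)
    by auto
  then show ?thesis using W_fixes_sum_iff[OF v_in_W assms(2)] by simp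
qed

lemma noncrossing_arc_forward:
  assumes v_noncrossing: "noncrossing v" "v (E i) = E j" and ij_range: "i < j" "j \<le> i + m + 1"
  shows "v ` arc (i + 1) j = arc (i + 1) j"
proof (rule noncrossing_invariantI[OF v_noncrossing(1) consistent_arc])
  show "c (\<Sum>(arc (i + 1) j)) - \<Sum>(arc (i + 1) j) = c (- E i) - v (- E i)"
    using v_noncrossing c_sum_arc[of "i + 1" j] ij_range m_ge
      W_neg[OF noncrossing_W[OF v_noncrossing(1)]] W_neg[OF c_W]
    by (simp add: c_E)
qed (use ij_range in simp)

lemma noncrossing_arc_backward:
  assumes v_noncrossing: "noncrossing v" "v (E i) = E j" and ij_range: "j \<le> i" "i < j + m"
  shows "v ` arc j (i + 1) = arc j (i + 1)"
proof (rule noncrossing_invariantI[OF v_noncrossing(1) consistent_arc])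
  show "c (\<Sum>(arc j (i + 1))) - \<Sum>(arc j (i + 1)) = c (E i) - v (E i)"
    using v_noncrossing c_sum_arc[of j "i + 1"] ij_range m_ge by (simp add: c_E)
qed (use ij_range in simp)

lemma noncrossing_half_exit:
  assumes v_noncrossing: "noncrossing v" "v y = E p" and y_central: "y \<in> {z, - z}"
  shows "v ` half p y = half p y"
proof (rule noncrossing_invariantI[OF v_noncrossing(1) consistent_half[OF y_central]])
  show "c (\<Sum>(half p y)) - \<Sum>(half p y) = c (2 *\<^sub>R y) - v (2 *\<^sub>R y)"
    using v_noncrossing W_linear[OF noncrossing_W] linear_c c_centre[OF y_central]
    by (simp add: c_sum_half[OF y_central] linear_scale algebra_simps)
qed

lemma noncrossing_half_enter:
  assumes v_noncrossing: "noncrossing v" "v (E i) = y" and y_central: "y \<in> {z, - z}"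
  shows "v ` half (i - m + 1) y = half (i - m + 1) y" (is "v ` ?H = ?H")
proof (rule noncrossing_invariantI[OF v_noncrossing(1) consistent_half[OF y_central]])
  have "E (i - m + 1) = - E (i + 1)" using E_sub_m[of "i + 1"] by (simp add: algebra_simps)
  then show "c (\<Sum>?H) - \<Sum>?H = c (2 *\<^sub>R E i) - v (2 *\<^sub>R E i)"
    using v_noncrossing W_linear[OF noncrossing_W] linear_c
    by (simp add: c_sum_half[OF y_central] linear_scale c_E algebra_simps)
qed

lemma noncrossing_preimage_cases:
  assumes v_noncrossing: "noncrossing v" and a_preimage: "a \<in> X" "v a = E j"
  obtains (forward) i where "a = E i" "i < j" "j \<le> i + m + 1" "v ` arc (i + 1) j = arc (i + 1) j"
    | (backward) i where "a = E i" "j \<le> i" "i < j + m" "v ` arc j (i + 1) = arc j (i + 1)"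
    | (exit) "a \<in> {z, - z}" "v ` half j a = half j a"
  using a_preimage(1)
proof (cases rule: X_cases)
  case (circle i0)
  obtain i where i_window: "E i0 = E i" "j \<le> i" "i < j + 2 * m" by (rule E_normalize)
  show thesis
  proof (cases "i < j + m")
    case True
    then show thesis
      using backward[of i] noncrossing_arc_backward[OF v_noncrossing, of i j] a_preimage circle
        i_window
      by simp
  next
    case False
    have "E (i - 2 * m) = E i" using E_add_2m[of "i - 2 * m"] by simp
    then show thesis
      using forward[of "i - 2 * m"] noncrossing_arc_forward[OF v_noncrossing, of "i - 2 * m" j]
        a_preimage circle i_window False
      by simp
  qed
next
  case centre
  then show thesis using exit noncrossing_half_exit[OF v_noncrossing a_preimage(2)] by blast
qed

lemma fixspace_c: "fixspace c = {0}"
proof (intro equalityI subsetI)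
  fix f assume "f \<in> fixspace c"
  then have step: "c a \<bullet> f = a \<bullet> f" for a
    using orth_c by (metis fixspace_iff orthogonal_transformation_def)
  have "E (i + int k) \<bullet> f = E i \<bullet> f" for i k
  proof (induction k)
    case (Suc k)
    then show ?case using step[of "E (i + int k)"] by (simp add: c_E algebra_simps)
  qed simp
  then have "E (i + int (nat m)) \<bullet> f = E i \<bullet> f" for i by blast
  then have "- (E i \<bullet> f) = E i \<bullet> f" for i using m_ge by (simp add: E_add_m)
  then have "E i \<bullet> f = 0" for i by (metis neg_equal_zero)
  moreover have "z \<bullet> f = 0" using step[of z] by (simp add: c_centre)
  ultimately have "a \<bullet> f = 0" if "a \<in> X" for a using that by (auto simp: X_eq)
  then have "X \<subseteq> {x. x \<bullet> f = 0}" by blast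
  then have "span X \<subseteq> {x. x \<bullet> f = 0}"
    by (rule span_minimal) (simp add: subspace_def inner_add_left)
  moreover have "f \<in> span X" by (simp add: span_X)
  ultimately have "f \<bullet> f = 0" by blast
  then show "f \<in> {0}" by simp
qed (use linear_c in \<open>auto simp: fixspace_iff linear_0\<close>)

lemma movspace_c: "movspace c = UNIV"
  using movspace_eq_orthogonal_comp[OF orth_c] by (simp add: fixspace_c)

lemma c_diff_id_inject: "c x - x = c y - y \<longleftrightarrow> x = y"
proof
  assume "c x - x = c y - y"
  then have "c (x - y) = x - y" using linear_c by (simp add: linear_diff algebra_simps)
  then have "x - y \<in> fixspace c" by (simp add: fixspace_iff)
  then show "x = y" by (simp add: fixspace_c)
qed simp

lemma noncrossing_root_segment:
  assumes v_noncrossing: "noncrossing v" and b_root: "b \<in> roots" "b \<in> movspace (c \<circ> finv v)"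
  obtains A k where "A \<in> segments" "v ` A = A" "k \<noteq> 0" "c (\<Sum>A) - \<Sum>A = k *\<^sub>R b"
proof -
  note v_in_W = noncrossing_W[OF v_noncrossing]
  obtain A k where A_lifts_b: "A \<in> segments" "k \<noteq> 0" "c (\<Sum>A) - \<Sum>A = k *\<^sub>R b"
    using b_root(1) by (rule root_segment)
  obtain x where b_eq: "b = c x - v x"
    using b_root(2) unfolding movspace_comp_finv[OF W_bij[OF v_in_W]] by blast
  have "c (\<Sum>A) - \<Sum>A = c (k *\<^sub>R x) - v (k *\<^sub>R x)"
    unfolding A_lifts_b(3) b_eq using linear_c W_linear[OF v_in_W]
    by (simp add: linear_scale scaleR_diff_right)
  then have "v ` A = A"
    by (rule noncrossing_invariantI[OF v_noncrossing consistent_segment[OF A_lifts_b(1)]])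
  then show thesis using A_lifts_b by (intro that)
qed

text \<open>The preimages of the roots under \<open>c - 1\<close> are, up to scaling, the sums of the segments.\<close>

lemma noncrossing_fixspace:
  assumes v_noncrossing: "noncrossing v"
  shows "fixspace v = span ((\<lambda>A. \<Sum>A) ` {A \<in> segments. v ` A = A})" (is "_ = span ?S")
proof
  note v_in_W = noncrossing_W[OF v_noncrossing]
  show "span ?S \<subseteq> fixspace v"
    using W_fixes_sum_iff[OF v_in_W consistent_segment] subspace_fixspace[OF W_linear[OF v_in_W]]
    by (intro span_minimal) (auto simp: fixspace_iff)
  let ?D = "\<lambda>f. c f - f"
  have lin: "linear ?D" using linear_c by (intro linear_compose_sub linear_ident)
  have "b \<in> ?D ` span ?S" if b_root: "b \<in> roots" "b \<in> movspace (c \<circ> finv v)" for b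
  proof -
    obtain A k where A_lifts_b: "A \<in> segments" "v ` A = A" "k \<noteq> 0" "?D (\<Sum>A) = k *\<^sub>R b"
      using v_noncrossing b_root by (rule noncrossing_root_segment)
    have "b = ?D ((1 / k) *\<^sub>R \<Sum>A)" unfolding linear_scale[OF lin] using A_lifts_b(3,4) by simp
    moreover have "(1 / k) *\<^sub>R \<Sum>A \<in> span ?S"
      using A_lifts_b(1,2) by (intro span_scale span_base) blast
    ultimately show ?thesis by blast
  qed
  then have "span (roots \<inter> movspace (c \<circ> finv v)) \<subseteq> ?D ` span ?S"
    using linear_subspace_image[OF lin] by (intro span_minimal) auto
  then have sub: "movspace (c \<circ> finv v) \<subseteq> ?D ` span ?S"
    using movspace_subset_span_roots[OF W_comp[OF c_W W_finv[OF v_in_W]]] by blast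
  show "fixspace v \<subseteq> span ?S"
  proof
    fix f assume "f \<in> fixspace v"
    then have "?D f = c f - v f" by (simp add: fixspace_iff)
    then have "?D f \<in> movspace (c \<circ> finv v)"
      unfolding movspace_comp_finv[OF W_bij[OF v_in_W]] by (rule range_eqI)
    then obtain g where "?D f = ?D g" "g \<in> span ?S" using sub by blast
    then show "f \<in> span ?S" using c_diff_id_inject by simp
  qed
qed

section \<open>Existence of the join\<close>

lemma W_image_Int: "w \<in> W \<Longrightarrow> w ` A = A \<Longrightarrow> w ` B = B \<Longrightarrow> w ` (A \<inter> B) = A \<inter> B"
  by (simp add: image_Int W_inj)

lemma W_image_Diff: "w \<in> W \<Longrightarrow> w ` A = A \<Longrightarrow> w ` B = B \<Longrightarrow> w ` (A - B) = A - B"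
  by (simp add: image_set_diff W_inj)

text \<open>Every entry point \<open>E y\<close> of \<open>v\<close> into an invariant set of \<open>w\<close> splits this set: its preimage
  under \<open>v\<close> lies outside, and the segment between the two is invariant under \<open>v\<close>, hence under \<open>w\<close>.\<close>

lemma invariant_arc_split:
  assumes v_noncrossing: "noncrossing v" and w_in_W: "w \<in> W" and fix_v_w: "fixspace v \<subseteq> fixspace w"
    and D_subset: "D \<subseteq> {z, - z}" and A_split: "A = arc p q \<union> D" "w ` A = A"
    and q_le: "q \<le> p + m" and y_range: "p \<le> y" "y < q" and a_preimage: "a \<in> X" "a \<notin> A" "v a = E y"
  shows "w ` arc p y = arc p y \<or> w ` arc y q = arc y q"
proof -
  note inv = W_invariant_mono[OF noncrossing_W[OF v_noncrossing] w_in_W fix_v_w]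
  have D_arc: "D \<inter> arc i j = {}" for i j using D_subset centre_notin_arc by blast
  from v_noncrossing a_preimage(1,3) show ?thesis
  proof (cases rule: noncrossing_preimage_cases)
    case (forward i)
    have "i < p" using arcI[of p i q] a_preimage(2) forward A_split(1) y_range by auto
    moreover have "arc (i + 1) y \<inter> arc p q = arc (max (i + 1) p) (min y q)"
      using forward q_le y_range m_ge by (intro arc_Int) auto
    ultimately have "arc (i + 1) y \<inter> A = arc p y"
      using A_split(1) D_arc[of "i + 1" y] y_range by (auto simp: max_def min_def)
    moreover have "w ` arc (i + 1) y = arc (i + 1) y"
      using inv consistent_arc forward by simp
    ultimately show ?thesis using W_image_Int[OF w_in_W _ A_split(2)] by metis
  next
    case (backward i)
    have "q \<le> i" using arcI[of p i q] a_preimage(2) backward A_split(1) y_range by auto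
    moreover have "arc y (i + 1) \<inter> arc p q = arc (max y p) (min (i + 1) q)"
      using backward q_le y_range m_ge by (intro arc_Int) auto
    ultimately have "arc y (i + 1) \<inter> A = arc y q"
      using A_split(1) D_arc[of y "i + 1"] y_range by (auto simp: max_def min_def)
    moreover have "w ` arc y (i + 1) = arc y (i + 1)"
      using inv consistent_arc backward by simp
    ultimately show ?thesis using W_image_Int[OF w_in_W _ A_split(2)] by metis
  next
    case exit
    have "arc y (y + m) \<inter> arc p q = arc y q"
      using arc_Int[of "y + m" p q y] q_le y_range m_ge by (simp add: max_absorb1 min_absorb2)
    then have "half y a \<inter> A = arc y q"
      using A_split(1) a_preimage(2) D_arc[of y "y + m"] by (auto simp: half_def)
    moreover have "w ` half y a = half y a" using inv consistent_half exit by simp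
    ultimately show ?thesis using W_image_Int[OF w_in_W _ A_split(2)] by metis
  qed
qed

definition optimal :: "('a \<Rightarrow> 'a) \<Rightarrow> ('a \<Rightarrow> 'a) \<Rightarrow> bool" where
  "optimal w v \<longleftrightarrow> noncrossing v \<and> fixspace v \<subseteq> fixspace w \<and>
     (\<forall>u. noncrossing u \<longrightarrow> fixspace u \<subseteq> fixspace w \<longrightarrow> dim (fixspace u) \<le> dim (fixspace v))"

lemma ex_optimal:
  assumes "w \<in> W"
  shows "\<exists>v. optimal w v"
proof -
  let ?P = "\<lambda>v. noncrossing v \<and> fixspace v \<subseteq> fixspace w"
  have "?P c"
    using c_W W_linear[OF assms] isometry_le_refl[OF orth_c] fixspace_c
    by (auto simp: noncrossing_def fixspace_iff linear_0)
  moreover have "\<forall>v. ?P v \<longrightarrow> dim (fixspace v) < DIM('a) + 1"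
    by (simp add: dim_subset_UNIV less_Suc_eq_le)
  ultimately have "\<exists>v. ?P v \<and> (\<forall>u. ?P u \<longrightarrow> dim (fixspace u) \<le> dim (fixspace v))"
    using ex_has_greatest_nat[of ?P c "\<lambda>v. dim (fixspace v)" "DIM('a) + 1"] by blast
  then show ?thesis unfolding optimal_def by blast
qed

lemma optimalD:
  assumes "optimal w v"
  shows "noncrossing v" "v \<in> W" "fixspace v \<subseteq> fixspace w"
    "\<And>u. noncrossing u \<Longrightarrow> fixspace u \<subseteq> fixspace w \<Longrightarrow> dim (fixspace u) \<le> dim (fixspace v)"
  using assms noncrossing_W by (auto simp: optimal_def)

lemma optimal_no_root_displacement:
  assumes w_in_W: "w \<in> W" and v_optimal: "optimal w v" and u_fixed: "w u = u" "k \<noteq> 0"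
    and b_root: "b \<in> roots"
  shows "v u - u \<noteq> k *\<^sub>R b"
proof
  assume v_displacement: "v u - u = k *\<^sub>R b"
  note v_in_W = optimalD(2)[OF v_optimal]
  let ?sv = "orthogonal_reflection b \<circ> v"
  have b_nonzero: "b \<noteq> 0" and b_in_mov: "b \<in> movspace v"
    using roots_nonzero[OF b_root]
      movspace_scaleRI[OF W_linear[OF v_in_W] v_displacement u_fixed(2)]
    by auto
  have sv_in_W: "?sv \<in> W" using W_reflection[OF b_root] v_in_W by (rule W_comp)
  have "?sv \<preceq> v" using W_orth[OF v_in_W] b_in_mov b_nonzero by (rule reflection_comp_isometry_le)
  then have sv_noncrossing: "noncrossing ?sv"
    using isometry_le_trans[of ?sv v c] sv_in_W v_in_W W_orth orth_c
      noncrossing_le[OF optimalD(1)[OF v_optimal]]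
    by (simp add: noncrossing_def)
  have "fixspace ?sv = span (insert u (fixspace v))"
    using fixspace_reflection_comp[OF W_orth[OF v_in_W] v_displacement u_fixed(2) b_nonzero] .
  also have "\<dots> \<subseteq> fixspace w"
    using optimalD(3)[OF v_optimal] u_fixed(1) subspace_fixspace[OF W_linear[OF w_in_W]]
    by (intro span_minimal) (auto simp: fixspace_iff)
  finally have "dim (fixspace ?sv) \<le> dim (fixspace v)"
    using optimalD(4)[OF v_optimal sv_noncrossing] by blast
  moreover have "dim (movspace ?sv) + 1 = dim (movspace v)"
    using W_orth[OF v_in_W] b_in_mov b_nonzero by (rule dim_movspace_reflection_comp)
  ultimately show False
    using dim_fixspace_movspace[OF W_orth[OF v_in_W]] dim_fixspace_movspace[OF W_orth[OF sv_in_W]]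
    by linarith
qed

lemma W_half_circle_fixes_centre:
  assumes w_invariant: "w \<in> W" "w ` arc p (p + m) = arc p (p + m)" and y_central: "y \<in> {z, - z}"
  shows "w y = y"
proof -
  have "w ` half p y = half p y"
    using W_mem_image_iff[OF w_invariant]
    by (intro W_half_system_invariantI[OF w_invariant(1) half_system_half[OF y_central], where z = y])
      (auto simp: half_def)
  then have "w y \<in> half p y" using W_mem_image_iff[OF w_invariant(1)] centre_in_half by blast
  moreover have "w y \<notin> arc p (p + m)"
    using W_mem_image_iff[OF w_invariant] centre_notin_arc[OF y_central] by simp
  ultimately show ?thesis by (simp add: half_def)
qed

lemma E_in_half_circle: "E k \<in> arc p (p + m) \<or> - E k \<in> arc p (p + m)"
  using half_system_half[of z p] E_neq_centre[of z k] E_neq_centre[of "- z" k]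
  unfolding half_system_def half_def by (metis E_X insertE insertI1 insertI2 minus_minus)

lemma W_half_circle_flips_centre:
  assumes v_in_W: "v \<in> W" and h_in_arcs: "h \<in> arc p (p + m)" "- v h \<in> arc p (p + m)"
    and stays: "\<And>a. a \<in> arc p (p + m) \<Longrightarrow> a \<noteq> h \<Longrightarrow> v a \<in> arc p (p + m)"
    and y_central: "y \<in> {z, - z}"
  shows "v y = - y"
proof -
  let ?Q = "arc p (p + m)"
  have neg: "- a \<in> range E" if "a \<in> range E" for a using that E_add_m by (metis imageE rangeI)
  have Q_subset: "?Q \<subseteq> range E" by (auto simp: arc_def)
  have v_a_on_circle: "v a \<in> range E" if "a \<in> ?Q" for a
    using that stays[of a] h_in_arcs Q_subset neg[of "- v h"] by (cases "a = h") auto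
  have "v (E k) \<in> range E" for k
    using E_in_half_circle[of k p] v_a_on_circle[of "E k"] v_a_on_circle[of "- E k"]
      neg[of "v (- E k)"] W_neg[OF v_in_W, of "E k"]
    by auto
  moreover have "finite (range E)" using finite_X X_eq by simp
  ultimately have "v ` range E = range E"
    using W_inj_on[OF v_in_W] by (intro endo_inj_surj) auto
  then have "v y \<notin> range E"
    using W_mem_image_iff[OF v_in_W] E_neq_centre[OF y_central] by (metis rangeE)
  then have "v y \<in> {z, - z}" using W_X[OF v_in_W centre_X[OF y_central]] X_eq by blast
  moreover have "v y \<noteq> y"
  proof
    assume v_fixes_y: "v y = y"
    have "v ` half p y = half p y"
      using v_fixes_y stays
      by (intro W_half_system_invariantI[OF v_in_W half_system_half[OF y_central], where z = h])
        (auto simp: half_def)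
    then have "v h \<in> half p y" using h_in_arcs(1) unfolding half_def by blast
    then show False
      using h_in_arcs(2)
        half_system_uminus_iff[OF half_system_half[OF y_central] W_X[OF v_in_W, of h], of p] h_in_arcs(1)
      by (auto simp: half_def arc_def)
  qed
  ultimately show ?thesis using y_central by (intro centre_eq_uminus)
qed

lemma noncrossing_antipodal_arc_centre:
  assumes v_noncrossing: "noncrossing v" and fix_v_w: "fixspace v \<subseteq> fixspace w"
    and w_invariant: "w \<in> W" "w ` arc p q = arc p q" and pq_range: "p < q" "q < p + m"
    and v_image: "v ` arc p q = insert (- E p) (arc p q - {E p})"
  shows "v z = - z" and "w z = z"
proof -
  let ?A = "arc p q" and ?Q = "arc p (p + m)"
  note v_in_W = noncrossing_W[OF v_noncrossing]
  obtain i where i_in_arc: "v (E i) = - E p" "p \<le> i" "i < q"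
    using v_image by (metis arcE imageE insertI1)
  let ?P = "arc (i + 1) (p + m)"
  have P_invariant: "v ` ?P = ?P"
    using noncrossing_arc_forward[OF v_noncrossing, of i "p + m"] i_in_arc pq_range
    by (simp add: E_add_m)
  have "p + m = max q (p + m)" using pq_range by simp
  then have Q_eq: "?Q = ?A \<union> ?P" using i_in_arc pq_range unfolding arc_def image_Un[symmetric]
    by (intro arg_cong[where f = "image E"]) auto
  show "v z = - z"
  proof (rule W_half_circle_flips_centre[OF v_in_W, of "E i" p])
    show "E i \<in> ?Q" "- v (E i) \<in> ?Q" using i_in_arc pq_range m_ge by (auto intro: arcI)
    fix a assume a_in_Q: "a \<in> ?Q" "a \<noteq> E i"
    then have "v a \<noteq> - E p" using i_in_arc(1) W_eq_iff[OF v_in_W] by metis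
    then show "v a \<in> ?Q" using a_in_Q(1) P_invariant v_image Q_eq by blast
  qed simp
  have "w ` ?P = ?P"
    using W_invariant_mono[OF v_in_W w_invariant(1) fix_v_w] P_invariant consistent_arc i_in_arc
    by simp
  then have "w ` ?Q = ?Q" using w_invariant(2) Q_eq by (simp add: image_Un)
  then show "w z = z" using w_invariant(1) by (intro W_half_circle_fixes_centre) auto
qed

lemma optimal_image_arc_neq:
  assumes w_invariant: "w \<in> W" "w ` arc p q = arc p q" and v_optimal: "optimal w v"
    and pq_range: "p < q" "q < p + m"
  shows "v ` arc p q \<noteq> insert (- E p) (arc p q - {E p})"
proof
  let ?A = "arc p q"
  assume v_image: "v ` ?A = insert (- E p) (?A - {E p})"
  note v_in_W = optimalD(2)[OF v_optimal]
  note centre = noncrossing_antipodal_arc_centre[OF optimalD(1,3)[OF v_optimal] w_invariant pq_range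
      v_image]
  have Ep_in_A: "E p \<in> ?A" using pq_range by (simp add: arcI)
  then have "- E p \<notin> ?A"
    using consistent_arc[of q p] pq_range by (auto simp: consistent_def)
  then have "v (\<Sum>?A) - \<Sum>?A = (-2) *\<^sub>R E p"
    using Ep_in_A by (simp add: W_sum_image[OF v_in_W] v_image finite_arc sum_diff1 scaleR_2)
  moreover have "w (\<Sum>?A) = \<Sum>?A"
    using W_fixes_sum_iff[OF w_invariant(1) consistent_arc] w_invariant(2) pq_range by simp
  ultimately have "w (\<Sum>?A + z) = \<Sum>?A + z" "v (\<Sum>?A + z) - (\<Sum>?A + z) = (-2) *\<^sub>R (E p - (- z))"
    using W_linear[OF w_invariant(1)] W_linear[OF v_in_W] centre
    by (simp_all add: linear_add algebra_simps scaleR_2)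
  moreover have "E p - (- z) \<in> roots"
    using neg_z_X E_neq_centre[of z p] E_neq_centre[of "- z" p] by (intro rootI) auto
  ultimately show False
    using optimal_no_root_displacement[OF w_invariant(1) v_optimal, of _ "-2"] by simp
qed

text \<open>If \<open>v\<close> does not preserve the arc, then by induction its only entry point is the left end.
  So \<open>v\<close> exchanges this end for a single point, and the sum of the arc is displaced along a root
  or, if this point is antipodal to the end, the preceding lemma applies.\<close>

lemma optimal_arc_entry:
  assumes w_invariant: "w \<in> W" "w ` arc p q = arc p q" and v_optimal: "optimal w v"
    and q_less: "q < p + m"
    and IH: "\<And>r s. w ` arc r s = arc r s \<Longrightarrow> s < r + m \<Longrightarrow> s - r < q - p \<Longrightarrow> v ` arc r s = arc r s"
    and neq: "v ` arc p q \<noteq> arc p q"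
  shows "arc p q - v ` arc p q \<subseteq> {E p}"
proof
  let ?A = "arc p q"
  note v_in_W = optimalD(2)[OF v_optimal]
  fix b assume b_in_diff: "b \<in> ?A - v ` ?A"
  then obtain y where b_eq: "b = E y" "p \<le> y" "y < q" by (blast elim: arcE)
  show "b \<in> {E p}"
  proof (rule ccontr)
    assume "b \<notin> {E p}"
    then have p_less_y: "p < y" using b_eq by (cases "p = y") auto
    have preimage: "finv v b \<in> X" "finv v b \<notin> ?A" "v (finv v b) = E y"
      using b_in_diff b_eq W_X[OF W_finv[OF v_in_W]] v_in_W by (auto simp: image_iff)
    have "w ` arc p y = arc p y \<or> w ` arc y q = arc y q"
      using w_invariant q_less b_eq preimage optimalD[OF v_optimal]
      by (intro invariant_arc_split[of v w "{}" ?A p q y "finv v b"]) auto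
    moreover have "arc p y \<inter> arc y q = {}"
      using arc_Int[of y y q p] q_less b_eq m_ge by (simp add: arc_empty)
    then have "arc y q = ?A - arc p y" "arc p y = ?A - arc y q"
      using arc_Un[of p y q] b_eq by auto
    ultimately have "w ` arc p y = arc p y" "w ` arc y q = arc y q"
      using W_image_Diff[OF w_invariant] by metis+
    then have "v ` arc p y = arc p y" and "v ` arc y q = arc y q"
      using b_eq p_less_y q_less by (intro IH; simp)+
    then have "v ` (arc p y \<union> arc y q) = arc p y \<union> arc y q" by (simp add: image_Un)
    then show False using neq arc_Un[of p y q] b_eq by simp
  qed
qed

lemma optimal_arc:
  assumes w_in_W: "w \<in> W" and v_optimal: "optimal w v" and "w ` arc p q = arc p q" "q < p + m"
  shows "v ` arc p q = arc p q"
  using assms(3,4)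
proof (induction "nat (q - p)" arbitrary: p q rule: less_induct)
  case less
  note v_in_W = optimalD(2)[OF v_optimal]
  let ?A = "arc p q"
  have inj: "inj_on v B" for B using v_in_W by (rule W_inj_on)
  show ?case
  proof (rule ccontr)
    assume neq: "v ` ?A \<noteq> ?A"
    then have p_less_q: "p < q" using arc_empty[of q p] by (cases "p < q") auto
    have "?A - v ` ?A \<subseteq> {E p}"
    proof (rule optimal_arc_entry[OF w_in_W less.prems(1) v_optimal less.prems(2) _ neq])
      show "v ` arc r s = arc r s" if "w ` arc r s = arc r s" "s < r + m" "s - r < q - p" for r s
        using that p_less_q by (intro less.hyps) auto
    qed
    moreover have "?A - v ` ?A \<noteq> {}"
      using finite_arc inj neq by (rule Diff_inj_image_nonempty)
    ultimately have entry: "?A - v ` ?A = {E p}" using subset_singletonD by metis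
    then have Ep_in_A: "E p \<in> ?A" by blast
    obtain y where y_exchange: "y \<notin> ?A" "v ` ?A = insert y (?A - {E p})"
      using finite_arc finite_imageI[OF finite_arc] card_image[OF inj, symmetric] entry
      by (rule Diff_singleton_exchange)
    have antipodal: "y \<noteq> - E p"
      using optimal_image_arc_neq[OF w_in_W less.prems(1) v_optimal p_less_q less.prems(2)]
        y_exchange(2)
      by blast
    have "y \<in> v ` ?A" using y_exchange(2) by blast
    then have "y \<in> X" using W_X[OF v_in_W] by (auto elim: arcE)
    then have "y - E p \<in> roots"
      using y_exchange(1) Ep_in_A antipodal by (intro rootI) (auto simp: equation_minus_iff)
    moreover have "v (\<Sum>?A) - \<Sum>?A = 1 *\<^sub>R (y - E p)"
      using y_exchange Ep_in_A by (simp add: W_sum_image[OF v_in_W] finite_arc sum_diff1)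
    moreover have "w (\<Sum>?A) = \<Sum>?A"
      using W_fixes_sum_iff[OF w_in_W consistent_arc] less.prems by simp
    ultimately show False
      using optimal_no_root_displacement[OF w_in_W v_optimal _ one_neq_zero] by blast
  qed
qed

lemma optimal_half_entry_unique:
  assumes w_invariant: "w \<in> W" "w ` half p y = half p y" and v_optimal: "optimal w v"
    and y_central: "y \<in> {z, - z}"
    and k_in_diff: "E k \<in> half p y - v ` half p y" "p \<le> k" "k < p + m"
    and l_in_diff: "E l \<in> half p y - v ` half p y" "k \<le> l" "l < p + m"
  shows "l = k"
proof (rule ccontr)
  assume "l \<noteq> k"
  then have kl_less: "k < l" "p < l" using k_in_diff l_in_diff by auto
  note v_in_W = optimalD(2)[OF v_optimal]
  let ?H = "half p y"
  have H_eq: "?H = arc p (p + m) \<union> {y}" by (simp add: half_def)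
  have preimage: "finv v (E l) \<in> X" "finv v (E l) \<notin> ?H" "v (finv v (E l)) = E l"
    using l_in_diff(1) W_X[OF W_finv[OF v_in_W]] v_in_W by (auto simp: image_iff)
  have "w ` arc p l = arc p l \<or> w ` arc l (p + m) = arc l (p + m)"
    using w_invariant optimalD[OF v_optimal] H_eq y_central kl_less l_in_diff(3) preimage
    by (intro invariant_arc_split[of v w "{y}" ?H p "p + m" l "finv v (E l)"]) auto
  then have "v ` arc p l = arc p l \<or> v ` arc l (p + m) = arc l (p + m)"
    using optimal_arc[OF w_invariant(1) v_optimal, of p l]
      optimal_arc[OF w_invariant(1) v_optimal, of l "p + m"] kl_less l_in_diff
    by auto
  moreover have "E k \<in> arc p l" "E l \<in> arc l (p + m)"
    using k_in_diff kl_less l_in_diff by (auto intro: arcI)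
  moreover have "arc p l \<subseteq> ?H" "arc l (p + m) \<subseteq> ?H"
    using kl_less l_in_diff by (auto simp: half_def arc_def)
  ultimately show False using k_in_diff(1) l_in_diff(1) by blast
qed

lemma optimal_half_Diff_image:
  assumes w_invariant: "w \<in> W" "w ` half p y = half p y" and v_optimal: "optimal w v"
    and y_central: "y \<in> {z, - z}" and neq: "v ` half p y \<noteq> half p y"
  obtains b where "b \<noteq> y" "half p y - v ` half p y = {y, b}"
proof -
  note v_in_W = optimalD(2)[OF v_optimal]
  let ?H = "half p y"
  let ?N = "?H - v ` ?H"
  have half_H: "half_system ?H" using y_central by (rule half_system_half)
  have "?N \<noteq> {}"
    using finite_half_system[OF half_H] W_inj_on[OF v_in_W] neq by (rule Diff_inj_image_nonempty)
  moreover have "even (card ?N)"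
    using W_even[OF v_in_W half_H]
      card_half_system_Diff_commute[OF half_system_W_image[OF v_in_W half_H] half_H] by simp
  moreover have "a = b" if "a \<in> ?N - {y}" "b \<in> ?N - {y}" for a b
  proof -
    have "a \<in> arc p (p + m)" "b \<in> arc p (p + m)" using that by (auto simp: half_def)
    then obtain k l where a_eq: "a = E k" "p \<le> k" "k < p + m"
        and b_eq: "b = E l" "p \<le> l" "l < p + m"
      by (blast elim: arcE)
    show ?thesis
      using that a_eq b_eq optimal_half_entry_unique[OF w_invariant v_optimal y_central, of k l]
        optimal_half_entry_unique[OF w_invariant v_optimal y_central, of l k]
      by (cases "k \<le> l") auto
  qed
  ultimately show thesis using that by (rule even_card_eq_doubleton)
qed

lemma optimal_half:
  assumes w_invariant: "w \<in> W" "w ` half p y = half p y" and v_optimal: "optimal w v"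
    and y_central: "y \<in> {z, - z}"
  shows "v ` half p y = half p y"
proof (rule ccontr)
  assume neq: "v ` half p y \<noteq> half p y"
  note v_in_W = optimalD(2)[OF v_optimal]
  let ?H = "half p y"
  obtain b where b_neq: "b \<noteq> y" and Diff_eq: "?H - v ` ?H = {y, b}"
    using w_invariant v_optimal y_central neq by (rule optimal_half_Diff_image)
  have half_H: "half_system ?H" using y_central by (rule half_system_half)
  have "v (\<Sum>?H) = \<Sum>(v ` ?H)" using v_in_W by (rule W_sum_image)
  also have "\<dots> = \<Sum>?H - 2 *\<^sub>R \<Sum>(?H - v ` ?H)"
    using half_H half_system_W_image[OF v_in_W half_H] by (rule sum_half_system)
  finally have "v (\<Sum>?H) - \<Sum>?H = (-2) *\<^sub>R (b - (- y))"
    using b_neq Diff_eq by (simp add: add.commute)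
  moreover have "w (\<Sum>?H) = \<Sum>?H"
    using W_fixes_sum_iff[OF w_invariant(1) half_system_consistent[OF half_H]] w_invariant(2)
    by simp
  moreover have "b - (- y) \<in> roots"
  proof (rule rootI)
    have "b \<in> ?H" "y \<in> ?H" using Diff_eq by auto
    then show "b \<in> X" "- y \<in> X" "- y \<noteq> b" "- y \<noteq> - b"
      using half_system_subset_X[OF half_H] neg_X uminus_centre_notin_half[OF y_central] b_neq
      by auto
  qed
  ultimately show False
    using optimal_no_root_displacement[OF w_invariant(1) v_optimal, of _ "-2"] by simp
qed

lemma optimal_segment:
  assumes "w \<in> W" "optimal w v" "A \<in> segments" "w ` A = A"
  shows "v ` A = A"
proof -
  from assms(3) consider p q where "A = arc p q" "q < p + m"
    | p y where "A = half p y" "y \<in> {z, - z}"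
    unfolding segments_def by blast
  then show ?thesis using assms optimal_arc optimal_half by cases metis+
qed

lemma optimal_maximum:
  assumes w_in_W: "w \<in> W" and v_optimal: "optimal w v"
    and u_noncrossing: "noncrossing u" "fixspace u \<subseteq> fixspace w"
  shows "fixspace u \<subseteq> fixspace v"
proof -
  have "v ` A = A" if A_fixed_segment: "A \<in> segments" "u ` A = A" for A
    using w_in_W noncrossing_W u_noncrossing consistent_segment A_fixed_segment
    by (intro optimal_segment[OF w_in_W v_optimal] W_invariant_mono[of u w A])
  then have "{A \<in> segments. u ` A = A} \<subseteq> {A \<in> segments. v ` A = A}" by blast
  then show ?thesis
    unfolding noncrossing_fixspace[OF u_noncrossing(1)]
      noncrossing_fixspace[OF optimalD(1)[OF v_optimal]]
    by (intro span_mono image_mono)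
qed

abbreviation proj :: "('a \<Rightarrow> 'a) \<Rightarrow> 'a \<Rightarrow> 'a" where
  "proj \<equiv> nc_projection G T c"

lemma optimal_proj:
  assumes w_in_W: "w \<in> W"
  shows "optimal w (proj w)"
proof -
  obtain v where v_optimal: "optimal w v" using ex_optimal[OF w_in_W] by blast
  have "proj w = v"
    using optimalD[OF v_optimal] noncrossing_le optimal_maximum[OF w_in_W v_optimal] movspace_c
    by (intro nc_projection_eqI[OF c_W _ w_in_W]) (auto simp: noncrossing_def)
  then show ?thesis using v_optimal by simp
qed

lemma proj_noncrossing: "w \<in> W \<Longrightarrow> noncrossing (proj w)"
  and proj_W: "w \<in> W \<Longrightarrow> proj w \<in> W"
  and fixspace_proj: "w \<in> W \<Longrightarrow> fixspace (proj w) \<subseteq> fixspace w"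
  using optimalD[OF optimal_proj] by blast+

lemma proj_invariant_imp: "w \<in> W \<Longrightarrow> consistent A \<Longrightarrow> proj w ` A = A \<Longrightarrow> w ` A = A"
  using W_invariant_mono[OF proj_W _ fixspace_proj] .

lemma proj_segment:
  assumes "w \<in> W" "A \<in> segments" "w ` A = A"
  shows "proj w ` A = A"
  using assms(1) optimal_proj[OF assms(1)] assms(2,3) by (rule optimal_segment)

section \<open>Dynamics of the pop operator\<close>

abbreviation pop :: "('a \<Rightarrow> 'a) \<Rightarrow> 'a \<Rightarrow> 'a" where
  "pop \<equiv> Pop G T c"

lemma pop_eq: "w \<in> W \<Longrightarrow> pop w = w \<circ> finv (proj w)"
  by (simp add: Pop_def inv_G proj_W mult_G)

lemma pop_W: "w \<in> W \<Longrightarrow> pop w \<in> W"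
  by (simp add: pop_eq W_comp W_finv proj_W)

lemma funpow_pop_W: "w \<in> W \<Longrightarrow> (pop ^^ k) w \<in> W"
  by (induction k) (simp_all add: pop_W)

lemma pop_proj: "w \<in> W \<Longrightarrow> pop w (proj w a) = w a"
  by (simp add: pop_eq proj_W)

lemma pop_invariant:
  assumes "w \<in> W" "consistent A" "proj w ` A = A"
  shows "pop w ` A = A"
proof -
  have "pop w ` (proj w ` A) = w ` A" using pop_proj[OF assms(1)] by (simp add: image_image)
  then show ?thesis using assms proj_invariant_imp by simp
qed

lemma proj_fixes_circle:
  assumes "w \<in> W" "w (E i) = E i"
  shows "proj w (E i) = E i"
proof -
  have "{i..<i + 1} = {i}" by auto
  then have "arc i (i + 1) = {E i}" by (simp add: arc_def)
  then show ?thesis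
    using proj_segment[OF assms(1) arc_segment[of i "i + 1"]] assms(2) m_ge by simp
qed

lemma proj_centre_moves:
  assumes "w \<in> W" "y \<in> {z, - z}" "w y = E j"
  shows "proj w y \<noteq> y"
proof
  assume "proj w y = y"
  then have "w y = y" using fixspace_proj[OF assms(1)] by (auto simp: fixspace_iff)
  then show False using assms(3) E_neq_centre[OF assms(2)] by metis
qed

subsection \<open>Following the preimage of a point on the circle\<close>

lemma noncrossing_no_overtaking:
  assumes v_noncrossing: "noncrossing v" and w_in_W: "w \<in> W" and fix_v_w: "fixspace v \<subseteq> fixspace w"
    and w_i_eq: "w (E i) = E j" "i < j" "j < i + 2 * m"
    and v_i_eq: "v (E i) = E k" "i < k" "k \<le> i + 2 * m"
  shows "k \<le> j"
proof (rule ccontr)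
  note inv = W_invariant_mono[OF noncrossing_W[OF v_noncrossing] w_in_W fix_v_w consistent_arc]
  assume "\<not> k \<le> j"
  show False
  proof (cases "k \<le> i + m + 1")
    case True
    then have "w ` arc (i + 1) k = arc (i + 1) k"
      using noncrossing_arc_forward[OF v_noncrossing v_i_eq(1)] v_i_eq by (intro inv) auto
    moreover have "E j \<in> arc (i + 1) k" using w_i_eq \<open>\<not> k \<le> j\<close> by (simp add: arcI)
    ultimately have "E (i + 2 * m) \<in> arc (i + 1) k"
      using w_i_eq(1) W_mem_image_iff[OF w_in_W] E_add_2m by metis
    then show False using E_mem_arc_iff[of "i + 1" "i + 2 * m" k] v_i_eq m_ge by simp
  next
    case False
    have "v (E i) = E (k - 2 * m)" using v_i_eq(1) E_add_2m[of "k - 2 * m"] by simp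
    then have "w ` arc (k - 2 * m) (i + 1) = arc (k - 2 * m) (i + 1)"
      using noncrossing_arc_backward[OF v_noncrossing] v_i_eq False by (intro inv) auto
    moreover have "E i \<in> arc (k - 2 * m) (i + 1)" using v_i_eq by (simp add: arcI)
    ultimately have "E j \<in> arc (k - 2 * m) (i + 1)"
      using w_i_eq(1) W_mem_image_iff[OF w_in_W] by metis
    then show False using E_mem_arc_iff[of "k - 2 * m" j "i + 1"] w_i_eq v_i_eq \<open>\<not> k \<le> j\<close> by simp
  qed
qed

lemma noncrossing_enter_centre_far:
  assumes v_noncrossing: "noncrossing v" and w_in_W: "w \<in> W" and fix_v_w: "fixspace v \<subseteq> fixspace w"
    and w_i_eq: "w (E i) = E j" "i < j" and v_i_central: "v (E i) \<in> {z, - z}"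
  shows "i + m < j"
proof (rule ccontr)
  assume "\<not> i + m < j"
  let ?H = "half (i - m + 1) (v (E i))"
  have "w ` ?H = ?H"
    using noncrossing_half_enter[OF v_noncrossing refl v_i_central] noncrossing_W[OF v_noncrossing]
      w_in_W fix_v_w consistent_half[OF v_i_central] by (intro W_invariant_mono[of v w])
  moreover have "E i \<in> ?H" using E_mem_half_iff[OF v_i_central, of "i - m + 1" i] m_ge by simp
  ultimately have "E j \<in> ?H" using w_i_eq(1) W_mem_image_iff[OF w_in_W] by metis
  then show False
    using E_mem_half_iff[OF v_i_central, of "i - m + 1" j] w_i_eq(2) m_ge \<open>\<not> i + m < j\<close> by simp
qed

definition lag_le :: "('a \<Rightarrow> 'a) \<Rightarrow> int \<Rightarrow> int \<Rightarrow> bool" where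
  "lag_le w j D \<longleftrightarrow> (\<exists>d. 0 \<le> d \<and> d \<le> D \<and> w (E (j - d)) = E j)"

lemma lag_leI: "w (E (j - d)) = E j \<Longrightarrow> 0 \<le> d \<Longrightarrow> d \<le> D \<Longrightarrow> lag_le w j D"
  by (auto simp: lag_le_def)

lemma lag_leE:
  assumes "lag_le w j D"
  obtains d where "0 \<le> d" "d \<le> D" "w (E (j - d)) = E j"
  using assms by (auto simp: lag_le_def)

lemma lag_le_mono: "lag_le w j D \<Longrightarrow> D \<le> D' \<Longrightarrow> lag_le w j D'"
  by (meson lag_le_def order_trans)

lemma lag_le_full:
  assumes "w (E i) = E j"
  shows "lag_le w j (2 * m - 1)"
proof -
  obtain k where "E i = E k" "j - 2 * m + 1 \<le> k" "k < j - 2 * m + 1 + 2 * m" by (rule E_normalize)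
  then show ?thesis using assms by (intro lag_leI[of w j "j - k"]) auto
qed

lemma lag_le_pop:
  assumes w_in_W: "w \<in> W" and lag: "lag_le w j D" and D_bounds: "0 < D" "D < 2 * m"
  obtains (closer) "lag_le (pop w) j (D - 1)"
    | (enter) i where "w (E i) = E j" "proj w (E i) \<in> {z, - z}" "m < D"
proof -
  obtain d where d_lag: "0 \<le> d" "d \<le> D" "w (E (j - d)) = E j" using lag by (rule lag_leE)
  show thesis
  proof (cases "d = 0")
    case True
    then have "pop w (E (j - 0)) = E j"
      using d_lag pop_proj[OF w_in_W, of "E j"] proj_fixes_circle[OF w_in_W] by simp
    then show thesis using D_bounds by (intro closer lag_leI) auto
  next
    case False
    note proj_facts = proj_noncrossing[OF w_in_W] w_in_W fixspace_proj[OF w_in_W] d_lag(3)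
    have "proj w (E (j - d)) \<in> X" using W_X[OF proj_W[OF w_in_W]] by simp
    then show thesis
    proof (cases rule: X_cases)
      case (circle k0)
      obtain k where k_window: "E k0 = E k" "j - d + 1 \<le> k" "k < j - d + 1 + 2 * m"
        by (rule E_normalize)
      then have "k \<le> j"
        using False d_lag D_bounds circle by (intro noncrossing_no_overtaking[OF proj_facts]) auto
      moreover have "pop w (E k) = E j"
        using pop_proj[OF w_in_W, of "E (j - d)"] circle k_window(1) d_lag(3) by simp
      ultimately show thesis using k_window(2) d_lag by (intro closer lag_leI[of _ j "j - k"]) auto
    next
      case centre
      then have "j - d + m < j"
        using False d_lag by (intro noncrossing_enter_centre_far[OF proj_facts]) auto
      then show thesis using enter[of "j - d"] d_lag centre by simp
    qed
  qed
qed

lemma proj_exit_centre: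
  assumes w_in_W: "w \<in> W" and y_entry: "y \<in> {z, - z}" "w y = E j" and "proj w y = E x"
  obtains d where "0 \<le> d" "d < m" "proj w y = E (j - d)"
proof -
  obtain k where k_window: "E x = E k" "j - 2 * m + 1 \<le> k" "k < j - 2 * m + 1 + 2 * m"
    by (rule E_normalize)
  then have proj_y: "proj w y = E k" using assms(4) by simp
  have "w ` half k y = half k y"
    using noncrossing_half_exit[OF proj_noncrossing[OF w_in_W] proj_y y_entry(1)]
      proj_invariant_imp[OF w_in_W consistent_half[OF y_entry(1)]] by blast
  then have "w y \<in> half k y" using W_mem_image_iff[OF w_in_W] centre_in_half by blast
  then have "j < k + m" using E_mem_half_iff[OF y_entry(1), of k j] k_window y_entry(2) by simp
  then show thesis using k_window proj_y by (intro that[of "j - k"]) auto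
qed

text \<open>The half circle through which the preimage enters the centre stays invariant,
  so that the preimage cannot pass to the antipode of the centre in the next step.\<close>

lemma lag_le_pop_pop_enter:
  assumes w_in_W: "w \<in> W" and w_i_eq: "w (E i) = E j" and proj_central: "proj w (E i) \<in> {z, - z}"
  shows "lag_le (pop (pop w)) j (m - 1)"
proof -
  let ?y = "proj w (E i)"
  let ?H = "half (i - m + 1) ?y"
  note pop_in_W = pop_W[OF w_in_W]
  have "proj w ` ?H = ?H"
    using noncrossing_half_enter[OF proj_noncrossing[OF w_in_W] refl proj_central] .
  then have "pop w ` ?H = ?H"
    using consistent_half[OF proj_central] by (intro pop_invariant[OF w_in_W])
  then have "proj (pop w) ` ?H = ?H"
    using half_segment[OF proj_central] by (intro proj_segment[OF pop_in_W])
  then have "proj (pop w) ?y \<in> ?H" using centre_in_half by blast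
  then have "proj (pop w) ?y \<noteq> - ?y" using uminus_centre_notin_half[OF proj_central] by metis
  moreover have pop_y: "pop w ?y = E j" using pop_proj[OF w_in_W] w_i_eq by simp
  ultimately have "proj (pop w) ?y \<notin> {z, - z}"
    using proj_centre_moves[OF pop_in_W proj_central] centre_eq_uminus[OF _ proj_central] by blast
  then obtain x where "proj (pop w) ?y = E x"
    using W_X[OF proj_W[OF pop_in_W] centre_X[OF proj_central]] X_eq by auto
  then obtain d where d_return: "0 \<le> d" "d < m" "proj (pop w) ?y = E (j - d)"
    using proj_exit_centre[OF pop_in_W proj_central pop_y] by blast
  then have "pop (pop w) (E (j - d)) = E j" using pop_proj[OF pop_in_W, of ?y] pop_y by simp
  then show ?thesis using d_return by (intro lag_leI) auto
qed

lemma funpow_pop_lag: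
  assumes "w \<in> W" "lag_le w j (int k)" "int k < 2 * m"
  shows "(pop ^^ k) w (E j) = E j"
  using assms
proof (induction k arbitrary: w rule: less_induct)
  case (less k)
  show ?case
  proof (cases k)
    case 0
    then show ?thesis using less.prems by (auto elim: lag_leE)
  next
    case (Suc k')
    have D_pos: "0 < int k" using Suc by simp
    from less.prems(1,2) D_pos less.prems(3) show ?thesis
    proof (cases rule: lag_le_pop)
      case closer
      then have "(pop ^^ k') (pop w) (E j) = E j"
        using less.prems Suc by (intro less.IH pop_W) auto
      then show ?thesis using Suc by (simp add: funpow_Suc_right del: funpow.simps)
    next
      case (enter i)
      then obtain l where k_eq: "k = Suc (Suc l)" using m_ge by (cases k'; cases k) (auto simp: Suc)
      have "lag_le (pop (pop w)) j (int l)"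
        using lag_le_pop_pop_enter[OF less.prems(1) enter(1,2)] enter(3) k_eq
        by (auto intro: lag_le_mono)
      then have "(pop ^^ l) (pop (pop w)) (E j) = E j"
        using less.prems k_eq by (intro less.IH pop_W) auto
      then show ?thesis using k_eq by (simp add: funpow_Suc_right del: funpow.simps)
    qed
  qed
qed

definition central :: "('a \<Rightarrow> 'a) \<Rightarrow> int \<Rightarrow> int \<Rightarrow> bool" where
  "central w j D \<longleftrightarrow> (\<exists>y\<in>{z, - z}. w y = E j) \<and>
     (\<forall>l. E l \<noteq> E j \<longrightarrow> E l \<noteq> - E j \<longrightarrow> lag_le w l D)"

lemma E_near_neq:
  assumes "0 < d" "d < m"
  shows "E (j - d) \<noteq> E j" "E (j - d) \<noteq> - E j" "E (j + d) \<noteq> E j" "E (j + d) \<noteq> - E j"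
  using assms E_eq_imp_eq[of "j - d" j] E_eq_imp_eq[of "j - d" "j - m"] E_eq_imp_eq[of "j + d" j]
    E_eq_imp_eq[of "j + d" "j + m"] by (auto simp: E_add_m E_sub_m)

lemma central_1_half_invariant:
  assumes w_in_W: "w \<in> W" and y_entry: "y \<in> {z, - z}" "w y = E j"
    and others: "\<And>l. E l \<noteq> E j \<Longrightarrow> E l \<noteq> - E j \<Longrightarrow> lag_le w l 1"
  shows "w ` half j y = half j y"
proof -
  have "finv w ` half j y = half j y"
  proof (rule W_half_system_invariantI[OF W_finv[OF w_in_W] half_system_half[OF y_entry(1)], where z = y])
    fix h assume "h \<in> half j y" "h \<noteq> y"
    then have "h \<in> arc j (j + m)" by (simp add: half_def)
    then obtain k where h_eq: "h = E k" "j \<le> k" "k < j + m" by (rule arcE)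
    show "finv w h \<in> half j y"
    proof (cases "k = j")
      case True
      then show ?thesis using h_eq y_entry W_finv_left[OF w_in_W, of y] by (simp add: half_def)
    next
      case False
      then have "lag_le w k 1" using h_eq E_near_neq[of "k - j" j] by (intro others) auto
      then obtain d where d_lag: "0 \<le> d" "d \<le> 1" "w (E (k - d)) = E k" by (rule lag_leE)
      then have "finv w h = E (k - d)" using h_eq W_finv_left[OF w_in_W, of "E (k - d)"] by simp
      then show ?thesis using h_eq d_lag False E_mem_half_iff[OF y_entry(1), of j "k - d"] by simp
    qed
  qed
  then have "w ` (finv w ` half j y) = w ` half j y" by simp
  then show ?thesis using w_in_W by (simp add: image_image)
qed

lemma central_exit_lag_le:
  assumes w_in_W: "w \<in> W" and y_entry: "y \<in> {z, - z}" "w y = E j" and D_pos: "0 < D"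
    and others: "\<And>l. E l \<noteq> E j \<Longrightarrow> E l \<noteq> - E j \<Longrightarrow> lag_le w l D"
    and exit: "proj w y = E x"
  shows "lag_le (pop w) j (D - 1)"
proof -
  obtain d where d_return: "0 \<le> d" "d < m" "proj w y = E (j - d)"
    using proj_exit_centre[OF w_in_W y_entry exit] .
  have "d < D"
  proof (rule ccontr)
    assume "\<not> d < D"
    then have "lag_le w (j - d) D" using D_pos d_return E_near_neq[of d j] by (intro others) auto
    then obtain d' where d'_lag: "0 \<le> d'" "d' \<le> D" "w (E (j - d - d')) = E (j - d)"
      by (rule lag_leE)
    let ?H = "half (j - d) y"
    have "w ` ?H = ?H"
      using noncrossing_half_exit[OF proj_noncrossing[OF w_in_W] d_return(3) y_entry(1)]
        proj_invariant_imp[OF w_in_W consistent_half[OF y_entry(1)]] by blast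
    moreover have "E (j - d) \<in> ?H"
      using E_mem_half_iff[OF y_entry(1), of "j - d" "j - d"] m_ge by simp
    ultimately have "E (j - d - d') \<in> ?H" using d'_lag(3) W_mem_image_iff[OF w_in_W] by metis
    then have "E (j - d - d' + 2 * m) \<in> ?H" by (simp add: E_add_2m)
    then have "d' = 0"
      using E_mem_half_iff[OF y_entry(1), of "j - d" "j - d - d' + 2 * m"] d_return d'_lag \<open>\<not> d < D\<close>
      by (cases "0 < d'") simp_all
    then have "proj w (E (j - d)) = proj w y"
      using d'_lag(3) d_return(3) proj_fixes_circle[OF w_in_W] by simp
    then show False using W_eq_iff[OF proj_W[OF w_in_W]] E_neq_centre[OF y_entry(1)] by metis
  qed
  moreover have "pop w (E (j - d)) = E j"
    using pop_proj[OF w_in_W, of y] d_return(3) y_entry(2) by simp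
  ultimately show ?thesis using d_return(1) by (intro lag_leI) auto
qed

text \<open>While the preimage of \<open>E j\<close> flips between the two central points, no other point can enter
  the centre, and so all of them come closer to their targets.\<close>

lemma central_pop:
  assumes w_in_W: "w \<in> W" and central: "central w j D" and D_bounds: "0 < D" "D < 2 * m"
  obtains (flip) "1 < D" "central (pop w) j (D - 1)" | (exit) "lag_le (pop w) j (D - 1)"
proof -
  obtain y where y_entry: "y \<in> {z, - z}" "w y = E j"
    and others: "\<And>l. E l \<noteq> E j \<Longrightarrow> E l \<noteq> - E j \<Longrightarrow> lag_le w l D"
    using central unfolding central_def by blast
  note proj_in_W = proj_W[OF w_in_W]
  from W_X[OF proj_in_W centre_X[OF y_entry(1)]] show thesis
  proof (cases rule: X_cases)
    case (circle x)
    then show thesis using exit central_exit_lag_le[OF w_in_W y_entry D_bounds(1) others] by blast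
  next
    case centre
    then have flips: "proj w y = - y"
      using proj_centre_moves[OF w_in_W y_entry] y_entry(1) by (intro centre_eq_uminus)
    have uminus_y: "- y \<in> {z, - z}" using y_entry(1) by auto
    have "proj w ` {y, - y} = {z, - z}" using flips W_neg[OF proj_in_W, of y] y_entry(1) by auto
    then have no_enter: "proj w (E i) \<notin> {z, - z}" for i
      using inj_image_mem_iff[OF W_inj[OF proj_in_W], of "E i" "{y, - y}"]
        E_neq_centre[OF y_entry(1), of i] E_neq_centre[OF uminus_y, of i] by simp
    have "1 < D"
    proof (rule ccontr)
      assume "\<not> 1 < D"
      then have "D = 1" using D_bounds by simp
      then have "w ` half j y = half j y"
        using others by (intro central_1_half_invariant[OF w_in_W y_entry]) simp
      then have "proj w ` half j y = half j y"
        using half_segment[OF y_entry(1)] by (intro proj_segment[OF w_in_W])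
      then have "- y \<in> half j y" using flips centre_in_half by (metis image_eqI)
      then show False using uminus_centre_notin_half[OF y_entry(1)] by blast
    qed
    moreover have "pop w (- y) = E j" using pop_proj[OF w_in_W, of y] flips y_entry(2) by simp
    moreover have "lag_le (pop w) l (D - 1)" if l_generic: "E l \<noteq> E j" "E l \<noteq> - E j" for l
      using w_in_W others[OF l_generic] D_bounds by (cases rule: lag_le_pop) (use no_enter in auto)
    ultimately show thesis using flip uminus_y unfolding central_def by blast
  qed
qed

lemma funpow_pop_central:
  assumes "w \<in> W" "central w j (int k)" "0 < k" "int k < 2 * m"
  shows "(pop ^^ k) w (E j) = E j"
  using assms
proof (induction k arbitrary: w)
  case (Suc k)
  have D_pos: "0 < int (Suc k)" by simp
  from Suc.prems(1,2) D_pos Suc.prems(4) have "(pop ^^ k) (pop w) (E j) = E j"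
  proof (cases rule: central_pop)
    case flip
    then show ?thesis using Suc.prems by (intro Suc.IH pop_W) auto
  next
    case exit
    then show ?thesis using Suc.prems by (intro funpow_pop_lag pop_W) auto
  qed
  then show ?case by (simp add: funpow_Suc_right del: funpow.simps)
qed simp

lemma lag_le_or_central:
  assumes w_in_W: "w \<in> W"
  shows "lag_le w j (2 * m - 1) \<or> central w j (2 * m - 1)"
proof -
  have preimage: "w (finv w (E l)) = E l" "finv w (E l) \<in> X" for l
    using w_in_W W_X[OF W_finv[OF w_in_W]] by auto
  from preimage(2)[of j] show ?thesis
  proof (cases rule: X_cases)
    case (circle i)
    then show ?thesis using lag_le_full[of w i j] preimage(1)[of j] by simp
  next
    case centre
    let ?y = "finv w (E j)"
    have "lag_le w l (2 * m - 1)" if l_generic: "E l \<noteq> E j" "E l \<noteq> - E j" for l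
      using preimage(2)[of l]
    proof (cases rule: X_cases)
      case (circle i)
      then show ?thesis using lag_le_full[of w i l] preimage(1)[of l] by simp
    next
      case l_centre: centre
      then have "finv w (E l) = ?y \<or> finv w (E l) = - ?y" using centre by auto
      then show ?thesis
        using l_generic preimage(1)[of l] preimage(1)[of j] W_neg[OF w_in_W, of ?y] by auto
    qed
    then show ?thesis using centre preimage(1)[of j] unfolding central_def by blast
  qed
qed

lemma funpow_pop_eq_id:
  assumes w_in_W: "w \<in> W"
  shows "(pop ^^ nat (2 * m - 1)) w = id"
proof (rule W_eq_idI[OF funpow_pop_W[OF w_in_W], of z])
  fix a assume "a \<in> X" "a \<noteq> z" "a \<noteq> - z"
  then obtain j where "a = E j" by (auto simp: X_eq)
  then show "(pop ^^ nat (2 * m - 1)) w a = a"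
    using lag_le_or_central[OF w_in_W, of j] funpow_pop_lag[OF w_in_W, of j "nat (2 * m - 1)"]
      funpow_pop_central[OF w_in_W, of j "nat (2 * m - 1)"] m_ge by auto
qed

subsection \<open>The orbit of the inverse Coxeter element\<close>

lemma segment_circle_part:
  assumes "A \<in> segments"
  obtains p q where "p < q" "q \<le> p + m" "\<And>k. p \<le> k \<Longrightarrow> k < p + 2 * m \<Longrightarrow> E k \<in> A \<longleftrightarrow> k < q"
proof -
  from assms consider (arc) p q where "A = arc p q" "p < q" "q < p + m"
    | (half) p y where "A = half p y" "y \<in> {z, - z}"
    unfolding segments_def by blast
  then show thesis
  proof cases
    case (arc p q)
    then show thesis using m_ge E_mem_arc_iff[of p _ q] by (intro that[of p q]) auto
  next
    case (half p y)
    then show thesis using m_ge E_mem_half_iff[of y p] by (intro that[of p "p + m"]) auto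
  qed
qed

lemma segment_not_rotation_invariant:
  assumes u_rotation: "u \<in> W" "\<And>l. u (E l) = E (l - r)" and r_range: "0 < r" "r < 2 * m"
    and A_segment: "A \<in> segments"
  shows "u ` A \<noteq> A"
proof
  assume inv: "u ` A = A"
  obtain p q where pq_range: "p < q" "q \<le> p + m"
    and mem: "\<And>k. p \<le> k \<Longrightarrow> k < p + 2 * m \<Longrightarrow> E k \<in> A \<longleftrightarrow> k < q"
    using A_segment by (rule segment_circle_part) blast
  have shift: "E (k - r) \<in> A \<longleftrightarrow> E k \<in> A" for k
    using W_mem_image_iff[OF u_rotation(1) inv, of "E k"] u_rotation(2) by simp
  have "E p \<in> A" using mem[of p] pq_range m_ge by simp
  then have "E (p + r) \<in> A" "E (p - r + 2 * m) \<in> A"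
    using shift[of "p + r"] shift[of p] by (simp_all add: E_add_2m)
  then have "p + r < q" "p - r + 2 * m < q" using mem r_range by simp_all
  then show False using pq_range by simp
qed

lemma noncrossing_above_rotation:
  assumes v_noncrossing: "noncrossing v"
    and u_rotation: "u \<in> W" "\<And>l. u (E l) = E (l - r)" "0 < r" "r < 2 * m"
    and fix_v_u: "fixspace v \<subseteq> fixspace u"
  shows "v = c"
proof -
  have "v ` A \<noteq> A" if "A \<in> segments" for A
    using that segment_not_rotation_invariant[OF u_rotation that] consistent_segment
      W_invariant_mono[OF noncrossing_W[OF v_noncrossing] u_rotation(1) fix_v_u] by blast
  then have "{A \<in> segments. v ` A = A} = {}" by blast
  then have "fixspace v = {0}"
    unfolding noncrossing_fixspace[OF v_noncrossing] by (simp only: image_empty span_empty)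
  then have "movspace v = UNIV"
    using movspace_eq_orthogonal_comp[OF W_orth[OF noncrossing_W[OF v_noncrossing]]] by simp
  then show ?thesis
    using W_orth noncrossing_W[OF v_noncrossing] orth_c noncrossing_le[OF v_noncrossing]
    by (intro isometry_le_eqI) auto
qed

lemma funpow_finv_c: "(finv c ^^ r) (E l) = E (l - int r)"
proof (induction r)
  case (Suc r)
  have "finv c (E k) = E (k - 1)" for k
    using c_E[of "k - 1"] W_finv_left[OF c_W] by (metis diff_add_cancel)
  then show ?case using Suc by (simp add: algebra_simps)
qed simp

lemma funpow_pop_finv_c:
  assumes "int k < 2 * m"
  shows "(pop ^^ k) (finv c) = finv c ^^ Suc k"
  using assms
proof (induction k)
  case (Suc k)
  let ?u = "finv c ^^ Suc k"
  have u_in_W: "?u \<in> W" using W_funpow[OF W_finv[OF c_W]] .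
  have "proj ?u = c"
    using proj_noncrossing[OF u_in_W] u_in_W fixspace_proj[OF u_in_W] funpow_finv_c Suc.prems
    by (intro noncrossing_above_rotation[of _ ?u "int (Suc k)"]) (simp_all del: funpow.simps)
  then have "pop ?u = ?u \<circ> finv c" using pop_eq[OF u_in_W] by (simp only:)
  also have "\<dots> = finv c ^^ Suc (Suc k)" by (simp only: funpow_Suc_right)
  finally have "pop ?u = finv c ^^ Suc (Suc k)" .
  moreover have "(pop ^^ k) (finv c) = ?u" using Suc.prems by (intro Suc.IH) simp
  ultimately show ?case by (simp only: funpow.simps comp_apply)
qed simp

lemma forward_orbit_pop:
  assumes "w \<in> W"
  shows "forward_orbit pop w = (\<lambda>k. (pop ^^ k) w) ` {..nat (2 * m - 1)}"
proof (rule forward_orbit_eventually_fixed)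
  show "(pop ^^ Suc (nat (2 * m - 1))) w = (pop ^^ nat (2 * m - 1)) w"
    unfolding funpow_Suc_right using funpow_pop_eq_id assms pop_W by simp
qed

lemma card_forward_orbit_pop_le:
  assumes "w \<in> W"
  shows "card (forward_orbit pop w) \<le> nat (2 * m)"
proof -
  have "card {..nat (2 * m - 1)} = nat (2 * m)" using m_ge by simp
  then show ?thesis
    unfolding forward_orbit_pop[OF assms] using card_image_le[of "{..nat (2 * m - 1)}"] by simp
qed

lemma card_forward_orbit_finv_c: "card (forward_orbit pop (finv c)) = nat (2 * m)"
proof -
  have "inj_on (\<lambda>k. (pop ^^ k) (finv c)) {..nat (2 * m - 1)}"
  proof (rule inj_onI)
    fix k l assume kl_range: "k \<in> {..nat (2 * m - 1)}" "l \<in> {..nat (2 * m - 1)}"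
      and "(pop ^^ k) (finv c) = (pop ^^ l) (finv c)"
    then have "finv c ^^ Suc k = finv c ^^ Suc l" using funpow_pop_finv_c m_ge by auto
    then have "E (0 - int (Suc k)) = E (0 - int (Suc l))" using funpow_finv_c by metis
    then have "0 - int (Suc k) = 0 - int (Suc l)"
      using kl_range m_ge by (intro E_eq_imp_eq) (auto simp: le_nat_iff)
    then show "k = l" by simp
  qed
  then show ?thesis
    using forward_orbit_pop[OF W_finv[OF c_W]] m_ge by (simp add: card_image)
qed

lemma Max_card_orbit: "(MAX w\<in>W. card (forward_orbit pop w)) = nat (2 * m)"
proof (rule Max_eqI)
  have "(\<lambda>w. card (forward_orbit pop w)) ` W \<subseteq> {..nat (2 * m)}"
    using card_forward_orbit_pop_le by blast
  then show "finite ((\<lambda>w. card (forward_orbit pop w)) ` W)" by (rule finite_subset) simp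
  show "nat (2 * m) \<in> (\<lambda>w. card (forward_orbit pop w)) ` W"
    using card_forward_orbit_finv_c W_finv[OF c_W] by (intro image_eqI[where x = "finv c"]) auto
qed (use card_forward_orbit_pop_le in blast)

end

section \<open>Recognising Coxeter elements\<close>

definition eigencoord :: "'a::euclidean_space \<Rightarrow> 'a \<Rightarrow> 'a \<Rightarrow> complex" where
  "eigencoord x y a = Complex (a \<bullet> x) (a \<bullet> y)"

lemma eigencoord_uminus: "eigencoord x y (- a) = - eigencoord x y a"
  by (simp add: eigencoord_def complex_eq_iff)

lemma eigencoord_funpow:
  assumes orth_c: "orthogonal_transformation c" and eig: "complex_eigenvector c \<mu> (x, y)"
  shows "eigencoord x y a = \<mu> ^ k * eigencoord x y ((c ^^ k) a)"
proof (induction k)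
  case (Suc k)
  let ?b = "(c ^^ k) a"
  have "?b \<bullet> x = c ?b \<bullet> c x" "?b \<bullet> y = c ?b \<bullet> c y"
    using orth_c by (simp_all add: orthogonal_transformation_def)
  moreover have "c x = Re \<mu> *\<^sub>R x - Im \<mu> *\<^sub>R y" "c y = Im \<mu> *\<^sub>R x + Re \<mu> *\<^sub>R y"
    using eig by (simp_all add: complex_eigenvector_def)
  ultimately have "eigencoord x y ?b = \<mu> * eigencoord x y (c ?b)"
    by (simp add: eigencoord_def complex_eq_iff inner_diff_right inner_add_right)
  then show ?case using Suc by simp
qed simp

lemma complex_eigenvector_nonzero:
  assumes "linear c" "inj c" "complex_eigenvector c \<mu> (x, y)"
  shows "\<mu> \<noteq> 0"
proof
  assume "\<mu> = 0"
  then have "c x = c 0" "c y = c 0" "(x, y) \<noteq> (0, 0)"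
    using assms(1,3) by (auto simp: complex_eigenvector_def linear_0)
  then show False using assms(2) by (simp add: inj_eq)
qed

context signed_basis
begin

lemma eigencoord_eq_imp:
  assumes "\<forall>b\<in>roots. \<not> (x \<bullet> b = 0 \<and> y \<bullet> b = 0)"
    and "a \<in> X" "b \<in> X" "eigencoord x y a = eigencoord x y b"
  shows "b = a \<or> b = - a"
proof (rule ccontr)
  assume "\<not> (b = a \<or> b = - a)"
  then have "a - b \<in> roots" using assms(2,3) by (intro rootI) auto
  moreover have "x \<bullet> (a - b) = 0" "y \<bullet> (a - b) = 0"
    using assms(4) by (simp_all add: eigencoord_def inner_diff_right inner_commute)
  ultimately show False using assms(1) by blast
qed

lemma regular_funpow_fixes:
  assumes c_in_W: "c \<in> W" and eig: "complex_eigenvector c \<mu> (x, y)"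
    and reg: "\<forall>b\<in>roots. \<not> (x \<bullet> b = 0 \<and> y \<bullet> b = 0)"
    and a_periodic: "(c ^^ k) a = a" "eigencoord x y a \<noteq> 0"
    and b_eigencoord: "b \<in> X" "eigencoord x y b \<noteq> 0"
  shows "(c ^^ k) b = b"
proof -
  note funpow = eigencoord_funpow[OF W_orth[OF c_in_W] eig, of _ k]
  have "\<mu> ^ k = 1" using funpow[of a] a_periodic by simp
  then have "eigencoord x y b = eigencoord x y ((c ^^ k) b)" using funpow[of b] by simp
  moreover from this have "(c ^^ k) b \<noteq> - b"
    using b_eigencoord(2) by (auto simp: eigencoord_uminus complex_eq_iff)
  ultimately show ?thesis
    using eigencoord_eq_imp[OF reg b_eigencoord(1) W_X[OF W_funpow[OF c_in_W] b_eigencoord(1)]]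
    by blast
qed

text \<open>At most one pair \<open>\<plusminus>z\<close> has zero inner product with the eigenvector, and by parity a power
  of \<open>c\<close> that fixes all other elements of \<open>X\<close> is the identity.\<close>

lemma regular_element_semiregular:
  assumes c_in_W: "c \<in> W" and eig: "complex_eigenvector c \<mu> (x, y)"
    and reg: "\<forall>b\<in>roots. \<not> (x \<bullet> b = 0 \<and> y \<bullet> b = 0)"
  obtains (free) "\<And>a k. a \<in> X \<Longrightarrow> (c ^^ k) a = a \<Longrightarrow> c ^^ k = id"
    | (centre) z where "z \<in> X" "c z \<in> {z, - z}"
        "\<And>a k. a \<in> X - {z, - z} \<Longrightarrow> (c ^^ k) a = a \<Longrightarrow> c ^^ k = id"
proof (cases "\<exists>z\<in>X. eigencoord x y z = 0")
  case True
  then obtain z where z_eigencoord: "z \<in> X" "eigencoord x y z = 0" by blast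
  have nonzero: "eigencoord x y a \<noteq> 0" if "a \<in> X - {z, - z}" for a
    using eigencoord_eq_imp[OF reg z_eigencoord(1), of a] z_eigencoord(2) that by auto
  have "\<mu> \<noteq> 0" using complex_eigenvector_nonzero[OF W_linear[OF c_in_W] W_inj[OF c_in_W] eig] .
  then have "eigencoord x y z = eigencoord x y (c z)"
    using eigencoord_funpow[OF W_orth[OF c_in_W] eig, of z 1] z_eigencoord(2) by simp
  then have "c z \<in> {z, - z}"
    using eigencoord_eq_imp[OF reg z_eigencoord(1) W_X[OF c_in_W z_eigencoord(1)]] by simp
  moreover have "c ^^ k = id" if "a \<in> X - {z, - z}" "(c ^^ k) a = a" for a k
    using regular_funpow_fixes[OF c_in_W eig reg that(2) nonzero[OF that(1)]] nonzero
    by (intro W_eq_idI[OF W_funpow[OF c_in_W], where z = z]) blast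
  ultimately show thesis using centre[of z] z_eigencoord(1) by blast
next
  case False
  then have "c ^^ k = id" if "a \<in> X" "(c ^^ k) a = a" for a k
    using regular_funpow_fixes[OF c_in_W eig reg that(2)] that(1)
    by (intro W_eq_idI[OF W_funpow[OF c_in_W], where z = 0]) blast
  then show thesis using free by blast
qed

lemma funpow_half_period_eq_uminus:
  assumes c_in_W: "c \<in> W" and a_orbit: "a \<in> X" "- a \<in> forward_orbit c a"
    and period: "\<And>k. (c ^^ k) a = a \<longleftrightarrow> 2 * m dvd k"
  shows "(c ^^ m) a = - a"
proof -
  obtain k where k_half: "- a = (c ^^ k) a" using a_orbit(2) unfolding forward_orbit_def by blast
  then have "(c ^^ (k + k)) a = a"
    using W_neg[OF W_funpow[OF c_in_W], of k a] by (simp add: funpow_add) (metis minus_minus)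
  then have "m dvd k" using period[of "k + k"] by (simp flip: mult_2)
  then obtain q where k_eq: "k = m * q" by blast
  have "\<not> 2 * m dvd k" using period[of k] k_half X_nonzero[OF a_orbit(1)] by simp
  then have "odd q" using k_eq by (auto elim!: evenE)
  then obtain r where "q = 2 * r + 1" by (elim oddE)
  then have "int k - int m = int (2 * m) * int r" using k_eq by (simp add: algebra_simps)
  then have "int (2 * m) dvd int k - int m" by simp
  then show ?thesis using k_half funpow_eq_iff_period_dvd[OF W_inj[OF c_in_W] period] by metis
qed

lemma D_coxeter_of_free_orbit:
  assumes c_in_W: "c \<in> W" and m_ge: "2 \<le> m" and cardX: "card X = 2 * m + 2" and z_in_X: "z \<in> X"
    and period: "\<And>a k. a \<in> X - {z, - z} \<Longrightarrow> (c ^^ k) a = a \<longleftrightarrow> 2 * m dvd k"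
    and invariant: "c ` (X - {z, - z}) \<subseteq> X - {z, - z}"
  obtains E where "D_coxeter X (int m) E z c"
proof -
  let ?S = "X - {z, - z}"
  have cardS: "card ?S = 2 * m"
    using cardX z_in_X neg_X X_nonzero finite_X by (simp add: card_Diff_subset)
  then have "?S \<noteq> {}"
    using m_ge by (metis card.empty mult_eq_0_iff not_numeral_le_zero zero_neq_numeral)
  then obtain a where a_in_S: "a \<in> ?S" by blast
  have N_pos: "0 < 2 * m" using m_ge by simp
  note inj = W_inj[OF c_in_W]
  obtain E where E_props: "\<And>k. E (int k) = (c ^^ k) a" "\<And>i. c (E i) = E (i + 1)"
      "\<And>i j. E i = E j \<longleftrightarrow> int (2 * m) dvd i - j" "range E = forward_orbit c a"
    using inj period[OF a_in_S] N_pos by (rule forward_orbit_parametrization) blast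
  have range_E: "range E = ?S"
    unfolding E_props(4) using finite_X a_in_S invariant inj period[OF a_in_S] N_pos cardS
    by (intro forward_orbit_eqI_card) auto
  have "- a \<in> ?S" using a_in_S neg_X by (auto simp: equation_minus_iff)
  then have "- a \<in> forward_orbit c a" using range_E E_props(4) by simp
  then have c_m: "(c ^^ m) a = - a"
    using a_in_S by (intro funpow_half_period_eq_uminus[OF c_in_W _ _ period[OF a_in_S]]) auto
  have E_add: "E (i + int m) = - E i" for i
  proof -
    obtain l where l_rep: "E i = (c ^^ l) a" using E_props(4) unfolding forward_orbit_def by blast
    then have "int (2 * m) dvd (i + int m) - int (l + m)"
      using E_props(1)[of l] E_props(3)[of i "int l"] by simp
    then have "E (i + int m) = (c ^^ (l + m)) a" using E_props(1)[of "l + m"] E_props(3) by metis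
    then show ?thesis using l_rep c_m W_neg[OF W_funpow[OF c_in_W]] by (simp add: funpow_add)
  qed
  have "D_coxeter X (int m) E z c"
  proof unfold_locales
    show "X = range E \<union> {z, - z}" using range_E z_in_X neg_X by auto
    show "z \<notin> range E" using range_E by simp
    show "2 * int m dvd i - j" if "E i = E j" for i j using that E_props(3) by simp
  qed (use m_ge c_in_W E_add E_props(2) in auto)
  then show thesis by (rule that)
qed

lemma ex_coxeter_labelling:
  assumes c_in_W: "c \<in> W" and m_ge: "2 \<le> m" and cardX: "card X = 2 * m + 2"
    and ord: "\<And>k. c ^^ k = id \<longleftrightarrow> 2 * m dvd k"
    and eig: "complex_eigenvector c \<mu> (x, y)"
    and reg: "\<forall>b\<in>roots. \<not> (x \<bullet> b = 0 \<and> y \<bullet> b = 0)"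
  shows "\<exists>E z. D_coxeter X (int m) E z c"
  using c_in_W eig reg
proof (cases rule: regular_element_semiregular)
  case free
  have "(c ^^ k) a = a \<longleftrightarrow> 2 * m dvd k" if "a \<in> X" for a k
    using free[OF that, of k] ord[of k] by auto
  then have "2 * m dvd 2 * m + 2"
    using period_dvd_card[OF finite_X W_inj[OF c_in_W] W_image_X[OF c_in_W], of "2 * m"] m_ge cardX
    by simp
  then have "2 * m dvd 2" by (simp only: dvd_add_triv_left_iff)
  then show ?thesis using m_ge by (auto dest: dvd_imp_le)
next
  case (centre z)
  have period: "(c ^^ k) a = a \<longleftrightarrow> 2 * m dvd k" if "a \<in> X - {z, - z}" for a k
    using centre(3)[OF that, of k] ord[of k] by auto
  have "c a \<in> X - {z, - z}" if "a \<in> X - {z, - z}" for a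
  proof -
    have "c z = z \<or> c z = - z" using centre(2) by simp
    then have "c ` {z, - z} = {z, - z}" using W_neg[OF c_in_W, of z] by (elim disjE) auto
    then show ?thesis using W_mem_image_iff[OF c_in_W, of "{z, - z}" a] W_X[OF c_in_W] that by simp
  qed
  then have "c ` (X - {z, - z}) \<subseteq> X - {z, - z}" by (rule image_subsetI)
  then show ?thesis
    using D_coxeter_of_free_orbit[OF c_in_W m_ge cardX centre(1) period] by metis
qed

end

section \<open>Coordinates for the root system\<close>

lemma group_general_linear_group: "group (general_linear_group :: ('a::euclidean_space \<Rightarrow> 'a) monoid)"
proof (rule groupI)
  fix x :: "'a \<Rightarrow> 'a" assume "x \<in> carrier general_linear_group"
  then have x_linear_bij: "linear x" "bij x" by (auto simp: general_linear_group_def)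
  then have "linear (finv x)" "bij (finv x)" "finv x \<circ> x = id"
    using inj_linear_imp_inv_linear bij_imp_bij_inv bij_is_inj inv_o_cancel by blast+
  then show "\<exists>y\<in>carrier general_linear_group.
      y \<otimes>\<^bsub>general_linear_group\<^esub> x = \<one>\<^bsub>general_linear_group\<^esub>"
    by (auto simp: general_linear_group_def)
qed (auto simp: general_linear_group_def linear_compose bij_comp o_assoc linear_id)

lemma inv_general_linear_group:
  assumes "w \<in> carrier (general_linear_group :: ('a::euclidean_space \<Rightarrow> 'a) monoid)"
  shows "inv\<^bsub>general_linear_group\<^esub> w = finv w"
proof -
  have w_linear_bij: "linear w" "bij w" using assms by (auto simp: general_linear_group_def)
  then have "linear (finv w)" "bij (finv w)" "finv w \<circ> w = id"
    using inj_linear_imp_inv_linear bij_imp_bij_inv bij_is_inj inv_o_cancel by blast+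
  then show ?thesis
    using assms group_general_linear_group
    by (intro group.inv_equality) (auto simp: general_linear_group_def)
qed

locale D_simple_system =
  fixes k :: nat and \<alpha> :: "nat \<Rightarrow> 'a::euclidean_space"
  assumes k_ge: "k \<ge> 1" and simple_roots: "D_simple_roots (k + 2) \<alpha>"
begin

lemma inner_\<alpha>:
  assumes "i < k + 2" "j < k + 2"
  shows "\<alpha> i \<bullet> \<alpha> j =
    (if i = j then 1 else if D_edge (k + 2) i j \<or> D_edge (k + 2) j i then - 1 / 2 else 0)"
  using simple_roots assms by (auto simp: D_simple_roots_def D_coxeter_matrix_def cos_60)

text \<open>The orthonormal basis in which the simple roots, which are unit vectors here, are
  \<open>(e i - e (i + 1)) / sqrt 2\<close> for \<open>i \<le> k\<close> and \<open>(e k + e (Suc k)) / sqrt 2\<close>.\<close>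

definition e :: "nat \<Rightarrow> 'a" where
  "e j = (if j = Suc k then (1 / sqrt 2) *\<^sub>R (\<alpha> (Suc k) - \<alpha> k)
     else (1 / sqrt 2) *\<^sub>R (\<alpha> (Suc k) + \<alpha> k) + sqrt 2 *\<^sub>R (\<Sum>i\<in>{j..<k}. \<alpha> i))"

lemma e_step:
  assumes "i < k"
  shows "e i = e (Suc i) + sqrt 2 *\<^sub>R \<alpha> i"
proof -
  have "{i..<k} = insert i {Suc i..<k}" using assms by auto
  then show ?thesis using assms by (simp add: e_def scaleR_add_right)
qed

lemma sqrt_2_e:
  "sqrt 2 *\<^sub>R e k = \<alpha> (Suc k) + \<alpha> k" "sqrt 2 *\<^sub>R e (Suc k) = \<alpha> (Suc k) - \<alpha> k"
  by (simp_all add: e_def)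

lemma \<alpha>_path:
  assumes "i \<le> k"
  shows "sqrt 2 *\<^sub>R \<alpha> i = e i - e (Suc i)"
proof (cases "i = k")
  case True
  have "sqrt 2 *\<^sub>R (sqrt 2 *\<^sub>R \<alpha> k) = sqrt 2 *\<^sub>R (e k - e (Suc k))"
    by (simp add: scaleR_diff_right sqrt_2_e scaleR_2)
  then show ?thesis unfolding True by (rule scaleR_left_imp_eq[rotated]) simp
qed (use assms e_step in simp)

lemma \<alpha>_last: "sqrt 2 *\<^sub>R \<alpha> (Suc k) = e k + e (Suc k)"
proof -
  have "sqrt 2 *\<^sub>R (sqrt 2 *\<^sub>R \<alpha> (Suc k)) = sqrt 2 *\<^sub>R (e k + e (Suc k))"
    by (simp add: scaleR_add_right sqrt_2_e scaleR_2)
  then show ?thesis by (rule scaleR_left_imp_eq[rotated]) simp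
qed

lemma inner_\<alpha>_e:
  assumes i_range: "i < k + 2" and j_range: "j < k + 2"
  shows "sqrt 2 * (\<alpha> i \<bullet> e j) =
    (if i = Suc k then of_bool (j = k) + of_bool (j = Suc k)
     else of_bool (i = j) - of_bool (Suc i = j))"
proof -
  have scale: "sqrt 2 * (\<alpha> i \<bullet> e j) = \<alpha> i \<bullet> (sqrt 2 *\<^sub>R e j)" for j by simp
  note edges = D_edge_def inner_\<alpha>[OF i_range, of k] inner_\<alpha>[OF i_range, of "Suc k"]
  show ?thesis
  proof (cases "j = Suc k")
    case True
    then show ?thesis
      using i_range k_ge unfolding scale by (auto simp: sqrt_2_e inner_diff_right edges)
  next
    case False
    then have "j \<le> k" using j_range by simp
    then show ?thesis
    proof (induction j rule: inc_induct)
      case base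
      then show ?case
        using i_range k_ge unfolding scale by (auto simp: sqrt_2_e inner_add_right edges)
    next
      case (step j)
      have "sqrt 2 * (\<alpha> i \<bullet> e j) = sqrt 2 * (\<alpha> i \<bullet> e (Suc j)) + 2 * (\<alpha> i \<bullet> \<alpha> j)"
        using e_step[of j] step by (simp add: inner_add_right distrib_left)
      then show ?case
        using step i_range inner_\<alpha>[OF i_range, of j] by (auto simp: D_edge_def)
    qed
  qed
qed

lemma inner_e:
  assumes "i < k + 2" "j < k + 2"
  shows "e i \<bullet> e j = of_bool (i = j)"
proof -
  note \<alpha>_e = inner_\<alpha>_e[OF _ assms(2)]
  have scale: "2 * (e i \<bullet> e j) = sqrt 2 * ((sqrt 2 *\<^sub>R e i) \<bullet> e j)" for i by simp
  consider (last) "i = Suc k" | (linear) "i \<le> k" using assms(1) by linarith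
  then show ?thesis
  proof cases
    case last
    have "2 * (e (Suc k) \<bullet> e j) = 2 * of_bool (Suc k = j)"
      unfolding scale using \<alpha>_e[of k] \<alpha>_e[of "Suc k"]
      by (simp add: sqrt_2_e inner_diff_left right_diff_distrib)
    then show ?thesis using last by simp
  next
    case linear
    then show ?thesis
    proof (induction i rule: inc_induct)
      case base
      have "2 * (e k \<bullet> e j) = 2 * of_bool (k = j)"
        unfolding scale using \<alpha>_e[of k] \<alpha>_e[of "Suc k"]
        by (simp add: sqrt_2_e inner_add_left distrib_left)
      then show ?case by simp
    next
      case (step i)
      have "e i \<bullet> e j = e (Suc i) \<bullet> e j + sqrt 2 * (\<alpha> i \<bullet> e j)"
        using e_step[of i] step by (simp add: inner_add_left)
      then show ?case using step \<alpha>_e[of i] by simp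
    qed
  qed
qed

definition X :: "'a set" where
  "X = e ` {..<k + 2} \<union> uminus ` e ` {..<k + 2}"

lemma e_X: "i < k + 2 \<Longrightarrow> e i \<in> X" "i < k + 2 \<Longrightarrow> - e i \<in> X"
  by (auto simp: X_def)

lemma XE:
  assumes "a \<in> X"
  obtains i where "i < k + 2" "a = e i \<or> a = - e i"
  using assms by (auto simp: X_def)

lemma e_eq_iff: "i < k + 2 \<Longrightarrow> j < k + 2 \<Longrightarrow> e i = e j \<longleftrightarrow> i = j"
  using inner_e[of i j] inner_e[of i i] by auto

lemma e_neq_uminus:
  assumes "i < k + 2" "j < k + 2"
  shows "e i \<noteq> - e j"
proof
  assume "e i = - e j"
  then have "e i \<bullet> e j = - (e j \<bullet> e j)" by simp
  then show False using inner_e assms by (simp add: of_bool_def split: if_splits)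
qed

lemma card_X: "card X = 2 * (k + 2)"
proof -
  have "inj_on e {..<k + 2}" using e_eq_iff by (auto simp: inj_on_def)
  moreover have "e ` {..<k + 2} \<inter> uminus ` e ` {..<k + 2} = {}" using e_neq_uminus by auto
  ultimately show ?thesis
    unfolding X_def by (subst card_Un_disjoint) (auto simp: card_image inj_on_def)
qed

lemma \<alpha>_root:
  assumes "i < k + 2"
  obtains a b where "a \<in> X" "b \<in> X" "b \<noteq> a" "b \<noteq> - a" "sqrt 2 *\<^sub>R \<alpha> i = a - b"
proof (cases "i = Suc k")
  case True
  then show thesis
    using that[of "e k" "- e (Suc k)"] e_X e_eq_iff[of k "Suc k"] e_neq_uminus[of "Suc k" k]
      e_neq_uminus[of k "Suc k"] \<alpha>_last by auto
next
  case False
  then show thesis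
    using that[of "e i" "e (Suc i)"] e_X e_eq_iff[of i "Suc i"] e_neq_uminus[of "Suc i" i]
      \<alpha>_path[of i] assms
    by auto
qed

sublocale signed_basis X
proof
  have "\<alpha> i \<in> span X" if "i < k + 2" for i
  proof -
    obtain a b where root_eq: "a \<in> X" "b \<in> X" "b \<noteq> a" "b \<noteq> - a" "sqrt 2 *\<^sub>R \<alpha> i = a - b"
      using \<open>i < k + 2\<close> by (rule \<alpha>_root)
    have "sqrt 2 *\<^sub>R \<alpha> i \<in> span X"
      unfolding root_eq(5) using root_eq(1,2) by (intro span_diff span_base)
    then have "(1 / sqrt 2) *\<^sub>R (sqrt 2 *\<^sub>R \<alpha> i) \<in> span X" by (rule span_scale)
    then show ?thesis by simp
  qed
  then have "span (\<alpha> ` {..<k + 2}) \<subseteq> span X" by (intro span_minimal) auto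
  then show "span X = UNIV" using simple_roots by (auto simp: D_simple_roots_def)
  show "a \<bullet> b = 0" if "a \<in> X" "b \<in> X" "b \<noteq> a" "b \<noteq> - a" for a b
    using that inner_e by (auto elim!: XE)
qed (auto simp: X_def inner_e)

subsection \<open>The reflection group\<close>

definition \<Gamma> :: "('a \<Rightarrow> 'a) monoid" where
  "\<Gamma> = reflection_group (k + 2) \<alpha>"

definition R :: "('a \<Rightarrow> 'a) set" where
  "R = reflections (k + 2) \<alpha>"

lemma W_subset_GL: "W \<subseteq> carrier general_linear_group"
  using W_linear W_bij by (auto simp: general_linear_group_def)

lemma subgroup_W: "subgroup W general_linear_group"
proof (rule subgroup.intro[OF W_subset_GL])
  show "inv\<^bsub>general_linear_group\<^esub> w \<in> W" if "w \<in> W" for w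
    using that W_finv W_subset_GL inv_general_linear_group by (metis subsetD)
qed (use W_comp W_id in \<open>auto simp: general_linear_group_def\<close>)

lemma simple_root_reflection:
  assumes "i < k + 2"
  obtains r where "r \<in> roots" "orthogonal_reflection (\<alpha> i) = orthogonal_reflection r"
    "\<alpha> i = (1 / sqrt 2) *\<^sub>R r"
proof -
  obtain a b where root_eq: "a \<in> X" "b \<in> X" "b \<noteq> a" "b \<noteq> - a" "sqrt 2 *\<^sub>R \<alpha> i = a - b"
    using assms by (rule \<alpha>_root)
  have "orthogonal_reflection (\<alpha> i) = orthogonal_reflection (a - b)"
    using orthogonal_reflection_scaleR[of "sqrt 2" "\<alpha> i"] root_eq(5) by simp
  moreover have "\<alpha> i = (1 / sqrt 2) *\<^sub>R (a - b)" by (simp flip: root_eq(5))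
  ultimately show thesis using that rootI[OF root_eq(1-4)] by blast
qed

lemma simple_reflections_subset_W: "simple_reflections (k + 2) \<alpha> \<subseteq> W"
  unfolding simple_reflections_def
proof (rule image_subsetI)
  fix i assume "i \<in> {..<k + 2}"
  then obtain r where "r \<in> roots" "orthogonal_reflection (\<alpha> i) = orthogonal_reflection r"
    using simple_root_reflection[of i] by (metis lessThan_iff)
  then show "orthogonal_reflection (\<alpha> i) \<in> W" using W_reflection by simp
qed

lemma carrier_\<Gamma>: "carrier \<Gamma> = generate general_linear_group (simple_reflections (k + 2) \<alpha>)"
  and mult_\<Gamma>: "v \<otimes>\<^bsub>\<Gamma>\<^esub> w = v \<circ> w"
  by (simp_all add: \<Gamma>_def reflection_group_def general_linear_group_def)

lemma carrier_\<Gamma>_subset_W: "carrier \<Gamma> \<subseteq> W"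
  unfolding carrier_\<Gamma> using group_general_linear_group simple_reflections_subset_W subgroup_W
  by (rule group.generate_subgroup_incl)

lemma subgroup_carrier_\<Gamma>: "subgroup (carrier \<Gamma>) general_linear_group"
  unfolding carrier_\<Gamma>
  using simple_reflections_subset_W W_subset_GL
  by (intro group.generate_is_subgroup[OF group_general_linear_group]) blast

lemma inv_\<Gamma>:
  assumes "w \<in> carrier \<Gamma>"
  shows "inv\<^bsub>\<Gamma>\<^esub> w = finv w" "finv w \<in> carrier \<Gamma>"
proof -
  have inv_GL: "inv\<^bsub>general_linear_group\<^esub> w = finv w"
    using assms carrier_\<Gamma>_subset_W W_subset_GL by (intro inv_general_linear_group) blast
  then show "inv\<^bsub>\<Gamma>\<^esub> w = finv w"
    using group.m_inv_consistent[OF group_general_linear_group subgroup_carrier_\<Gamma> assms]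
    by (simp add: carrier_\<Gamma> \<Gamma>_def reflection_group_def)
  show "finv w \<in> carrier \<Gamma>"
    using subgroup.m_inv_closed[OF subgroup_carrier_\<Gamma> assms] inv_GL by simp
qed

lemma comp_\<Gamma>: "v \<in> carrier \<Gamma> \<Longrightarrow> w \<in> carrier \<Gamma> \<Longrightarrow> v \<circ> w \<in> carrier \<Gamma>"
  using subgroup.m_closed[OF subgroup_carrier_\<Gamma>] by (simp add: general_linear_group_def)

lemma id_\<Gamma>: "id \<in> carrier \<Gamma>"
  using subgroup.one_closed[OF subgroup_carrier_\<Gamma>] by (simp add: general_linear_group_def)

lemma R_eq: "R = {orthogonal_reflection (w (\<alpha> i)) | w i. w \<in> carrier \<Gamma> \<and> i < k + 2}"
proof -
  have conj: "w \<circ> orthogonal_reflection (\<alpha> i) \<circ> inv\<^bsub>\<Gamma>\<^esub> w = orthogonal_reflection (w (\<alpha> i))"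
    if "w \<in> carrier \<Gamma>" for w i
    using that carrier_\<Gamma>_subset_W W_orth by (simp add: inv_\<Gamma> orthogonal_reflection_image subset_iff)
  have "R = {w \<circ> orthogonal_reflection (\<alpha> i) \<circ> inv\<^bsub>\<Gamma>\<^esub> w | w i. w \<in> carrier \<Gamma> \<and> i < k + 2}"
    unfolding R_def reflections_def reflections_of_def simple_reflections_def \<Gamma>_def[symmetric]
      mult_\<Gamma>
    by blast
  also have "\<dots> = {orthogonal_reflection (w (\<alpha> i)) | w i. w \<in> carrier \<Gamma> \<and> i < k + 2}"
    using conj by (intro Collect_cong ex_cong1) auto
  finally show ?thesis .
qed

lemma reflection_in_\<Gamma>:
  assumes "orthogonal_reflection b \<in> R"
  shows "orthogonal_reflection b \<in> carrier \<Gamma>"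
proof -
  obtain w i where b_reflects: "w \<in> carrier \<Gamma>" "i < k + 2"
      "orthogonal_reflection b = orthogonal_reflection (w (\<alpha> i))"
    using assms unfolding R_eq by blast
  have "orthogonal_reflection (\<alpha> i) \<in> carrier \<Gamma>"
    unfolding carrier_\<Gamma> using b_reflects(2)
    by (intro generate.incl) (simp add: simple_reflections_def)
  then show ?thesis
    using b_reflects comp_\<Gamma> inv_\<Gamma>(2) carrier_\<Gamma>_subset_W W_orth
    by (simp add: orthogonal_reflection_image subset_iff)
qed

lemma reflection_image_in_R:
  assumes refl_b_in_R: "orthogonal_reflection b \<in> R" and w_in_Gamma: "w \<in> carrier \<Gamma>"
  shows "orthogonal_reflection (w b) \<in> R"
proof -
  obtain u i where b_reflects: "u \<in> carrier \<Gamma>" "i < k + 2"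
      "orthogonal_reflection b = orthogonal_reflection (u (\<alpha> i))"
    using refl_b_in_R unfolding R_eq by blast
  have "orthogonal_transformation w" using w_in_Gamma carrier_\<Gamma>_subset_W W_orth by blast
  then have "orthogonal_reflection (w b) = orthogonal_reflection ((w \<circ> u) (\<alpha> i))"
    using b_reflects(3) by (simp add: orthogonal_reflection_image)
  then show ?thesis unfolding R_eq using comp_\<Gamma>[OF w_in_Gamma b_reflects(1)] b_reflects(2) by blast
qed

definition linked :: "'a \<Rightarrow> 'a \<Rightarrow> bool" where
  "linked a b \<longleftrightarrow> orthogonal_reflection (a - b) \<in> R"

lemma linked_commute: "linked a b \<longleftrightarrow> linked b a"
  unfolding linked_def using orthogonal_reflection_uminus[of "a - b"] by simp

lemma linked_uminus: "linked (- a) (- b) \<longleftrightarrow> linked a b"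
  using linked_commute[of a b] by (simp add: linked_def)

lemma linked_trans:
  assumes "linked a b" "linked b d" and in_X: "a \<in> X" "b \<in> X" "d \<in> X"
    and neq: "b \<noteq> a" "b \<noteq> - a" "d \<noteq> a" "d \<noteq> - a" "d \<noteq> b" "d \<noteq> - b"
  shows "linked a d"
proof -
  let ?s = "orthogonal_reflection (a - b)"
  have "?s b = a" "?s d = d"
    using root_reflection_X[OF in_X(1,2) neq(1,2) in_X(2)]
      root_reflection_X[OF in_X(1,2) neq(1,2) in_X(3)] neq
    by auto
  then have "?s (b - d) = a - d" by (simp add: linear_diff[OF orthogonal_reflection_linear])
  moreover have "?s \<in> carrier \<Gamma>" using assms(1) unfolding linked_def by (rule reflection_in_\<Gamma>)
  ultimately show ?thesis
    using reflection_image_in_R[of "b - d" ?s] assms(2) unfolding linked_def by simp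
qed

lemma linked_simple:
  shows "i \<le> k \<Longrightarrow> linked (e i) (e (Suc i))" and "linked (e k) (- e (Suc k))"
proof -
  have "orthogonal_reflection (sqrt 2 *\<^sub>R \<alpha> i) \<in> R" if "i < k + 2" for i
  proof -
    have "orthogonal_reflection (id (\<alpha> i)) \<in> R" unfolding R_eq using id_\<Gamma> that by blast
    then show ?thesis by (simp add: orthogonal_reflection_scaleR)
  qed
  from this[of i] this[of "Suc k"]
  show "i \<le> k \<Longrightarrow> linked (e i) (e (Suc i))" "linked (e k) (- e (Suc k))"
    by (simp_all add: linked_def \<alpha>_path \<alpha>_last)
qed

lemma linked_e:
  assumes "i < j" "j < k + 2"
  shows "linked (e i) (e j)"
  using assms
proof (induction j)
  case (Suc j)
  show ?case
  proof (cases "i = j")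
    case True
    then show ?thesis using linked_simple(1)[of i] Suc.prems by simp
  next
    case False
    then show ?thesis
      using Suc linked_simple(1)[of j] e_X e_eq_iff e_neq_uminus
      by (intro linked_trans[of "e i" "e j" "e (Suc j)"]) auto
  qed
qed simp

lemma linked_uminus_e:
  assumes ij_range: "i < j" "j < k + 2"
  shows "linked (e i) (- e j)"
proof -
  have neq: "e a \<noteq> e b" "e a \<noteq> - e b" "- e a \<noteq> e b" if "a \<noteq> b" "a < k + 2" "b < k + 2" for a b
    using that e_eq_iff e_neq_uminus[of a b] e_neq_uminus[of b a] by auto
  have last: "linked (e i) (- e (Suc k))" if "i \<le> k" for i
  proof (cases "i = k")
    case False
    then show ?thesis
      using that linked_e[of i k] linked_simple(2) e_X neq
      by (intro linked_trans[of "e i" "e k" "- e (Suc k)"]) auto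
  qed (use linked_simple(2) in simp)
  show ?thesis
  proof (cases "j = Suc k")
    case False
    then have "linked (- e (Suc k)) (- e j)"
      using ij_range linked_e[of j "Suc k"] by (simp add: linked_uminus linked_commute)
    then show ?thesis
      using ij_range False last[of i] e_X neq
      by (intro linked_trans[of "e i" "- e (Suc k)" "- e j"]) auto
  qed (use last ij_range in simp)
qed

lemma root_reflection_in_R:
  assumes "b \<in> roots"
  shows "orthogonal_reflection b \<in> R"
proof -
  obtain x y where b_eq: "x \<in> X" "y \<in> X" "y \<noteq> x" "y \<noteq> - x" "b = x - y" using assms by (rule rootE)
  obtain i where x_eq: "i < k + 2" "x = e i \<or> x = - e i" using b_eq(1) by (rule XE)
  obtain j where y_eq: "j < k + 2" "y = e j \<or> y = - e j" using b_eq(2) by (rule XE)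
  have "i < j \<or> j < i" using x_eq y_eq b_eq(3,4) by (cases "i = j") auto
  then have "linked (e i) (e j)" "linked (e i) (- e j)" "linked (- e i) (e j)"
    using x_eq(1) y_eq(1) linked_e[of i j] linked_e[of j i] linked_uminus_e[of i j]
      linked_uminus_e[of j i]
      linked_uminus[of "e i" "- e j"] linked_commute by auto
  then have "linked x y" using x_eq(2) y_eq(2) linked_uminus by auto
  then show ?thesis using b_eq(5) by (simp add: linked_def)
qed

lemma \<Gamma>_eq_G: "\<Gamma> = G"
proof -
  have "w \<in> carrier \<Gamma>" if "w \<in> W" for w
    using that
  proof (induction rule: W_induct)
    case (reflection b w)
    then show ?case using comp_\<Gamma> reflection_in_\<Gamma> root_reflection_in_R by blast
  qed (rule id_\<Gamma>)
  then have "carrier \<Gamma> = W" using carrier_\<Gamma>_subset_W by blast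
  then show ?thesis by (simp add: G_def \<Gamma>_def reflection_group_def general_linear_group_def)
qed

lemma R_eq_T: "R = T"
proof
  show "T \<subseteq> R" using root_reflection_in_R by (auto simp: T_def)
  show "R \<subseteq> T"
  proof
    fix t assume "t \<in> R"
    then obtain w i where t_eq: "w \<in> W" "i < k + 2" "t = orthogonal_reflection (w (\<alpha> i))"
      unfolding R_eq using carrier_\<Gamma>_subset_W by blast
    obtain r where r_root: "r \<in> roots" "orthogonal_reflection (\<alpha> i) = orthogonal_reflection r"
      using t_eq(2) by (rule simple_root_reflection)
    have "t = orthogonal_reflection (w r)"
      using t_eq(3) r_root(2) W_orth[OF t_eq(1)] by (simp add: orthogonal_reflection_image)
    then show "t \<in> T" using W_roots[OF t_eq(1) r_root(1)] by (simp add: T_def)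
  qed
qed

lemma ex_D_coxeter:
  assumes "D_coxeter_element (k + 2) \<alpha> c"
  obtains E z where "D_coxeter X (int (k + 1)) E z c"
proof -
  have c_in_W: "c \<in> W" and ord: "group.ord G c = 2 * (k + 1)" and reg: "regular_element T c"
    using assms unfolding D_coxeter_element_def D_coxeter_number_def \<Gamma>_def[symmetric]
      R_def[symmetric]
      \<Gamma>_eq_G R_eq_T by (simp_all add: carrier_G)
  obtain \<mu> x y where eig: "complex_eigenvector c \<mu> (x, y)" and "\<forall>t\<in>T. \<not> (t x = x \<and> t y = y)"
    using reg by (auto simp: regular_element_def)
  then have "\<forall>b\<in>roots. \<not> (x \<bullet> b = 0 \<and> y \<bullet> b = 0)"
    using orthogonal_reflection_fixes_iff[OF roots_nonzero] by (auto simp: T_def)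
  moreover have "c ^^ l = id \<longleftrightarrow> 2 * (k + 1) dvd l" for l
    using group.pow_eq_id[OF group_G, of c l] c_in_W ord by (simp add: carrier_G one_G pow_G)
  ultimately have "\<exists>E z. D_coxeter X (int (k + 1)) E z c"
    using k_ge card_X by (intro ex_coxeter_labelling[OF c_in_W _ _ _ eig]) auto
  then show thesis using that by blast
qed

end

theorem theorem6p1:
  fixes n :: nat and \<alpha> :: "nat \<Rightarrow> 'a::euclidean_space" and c :: "'a \<Rightarrow> 'a"
  assumes "n \<ge> 4"
    and "D_simple_roots n \<alpha>"
    and "D_coxeter_element n \<alpha> c"
  shows "(\<forall>w \<in> carrier (reflection_group n \<alpha>).
            (Pop\<^sub>T n \<alpha> c ^^ (2 * n - 3)) w = \<one>\<^bsub>reflection_group n \<alpha>\<^esub>) \<and>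
         (MAX w \<in> carrier (reflection_group n \<alpha>). card (forward_orbit (Pop\<^sub>T n \<alpha> c) w)) = 2 * n - 2"
proof -
  obtain k where n_eq: "n = k + 2" "1 \<le> k" using assms(1) by (intro that[of "n - 2"]) auto
  interpret D_simple_system k \<alpha> using assms(2) n_eq by unfold_locales auto
  obtain E z where "D_coxeter X (int (k + 1)) E z c" using assms(3) ex_D_coxeter n_eq(1) by blast
  then interpret D_coxeter X "int (k + 1)" E z c .
  have group: "reflection_group n \<alpha> = G" and pop: "Pop\<^sub>T n \<alpha> c = pop"
    unfolding Pop\<^sub>T_def n_eq(1) \<Gamma>_def[symmetric] R_def[symmetric] \<Gamma>_eq_G R_eq_T by simp_all
  have "nat (2 * int (k + 1) - 1) = 2 * n - 3" "nat (2 * int (k + 1)) = 2 * n - 2"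
    using n_eq(1) by simp_all
  then show ?thesis
    using funpow_pop_eq_id Max_card_orbit unfolding group pop carrier_G one_G by simp
qed

end
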